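(* Let $f,g,\tau$ be real-valued $\nu$-Hölder continuous functions on $\widehat U$ (extended to $U$), where $\nu>0$. For every $i=1,\dots,k$ fix an arbitrary point $x_i\in U_i$ and let $\chi_i$ be the characteristic function of $U_i$. Then for every $\epsilon>0$ and sufficiently small $a_0>0$, $c_0>0$ there exists a constant $C_\epsilon>0$ such that $$\Bigl|Z_n(f-s\tau+zg)-\sum_{i=1}^kL^n_{f-s\tau+zg}\chi_i(x_i)\Bigr|\le C_\epsilon(1+|s|)(1+|z|)\sum_{m=2}^n\|L^{n-m}_{f-s\tau+zg}\|_\nu\,\gamma_0^{-m\nu}\,e^{m(\epsilon+\Pr(f-a\tau+cg))},\qquad \forall n\in\mathbb{N},$$ for $s=a+\mathbf{i}b$, $z=c+\mathbf{i}w$ ($a,b,c,w\in\mathbb{R}$) with $|a|\le a_0$, $|c|\le c_0$.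
   Context: $\phi_t$ is a $C^2$ weak mixing Axiom A flow on a $C^2$ complete Riemannian manifold $M$ with distance $d$, and $\Lambda$ is a basic set (compact, invariant, hyperbolic, transitive, locally maximal). $W^s_\epsilon,W^u_\epsilon$ are the local (strong) stable/unstable manifolds; for nearby $x,y\in\Lambda$, $[x,y]\in\Lambda$ is the unique point of $W^s_{\epsilon_0}(x)\cap\phi_{[-\epsilon_0,\epsilon_0]}(W^u_{\epsilon_0}(y))$. $\mathcal R=\{R_i\}_{i=1}^k$ is a fixed Markov partition by rectangles $R_i=[U_i,S_i]=\{[x,y]:x\in U_i,y\in S_i\}$, with $U_i$, $S_i$ pieces of unstable, resp. stable, local manifolds intersected with $\Lambda$; $R=\bigcup R_i$, $U=\bigcup U_i$. $\tau(x)>0$ is the first return time to $R$ (constant on stable leaves, hence a function on $U$), $\mathcal P(x)=\phi_{\tau(x)}(x)$ the Poincaré map, $\sigma=\pi^{(U)}\circ\mathcal P:U\to U$ with $\pi^{(U)}:R\to U$ the projection along stable leaves. $\widehat U$ is the set of $x\in U$ such that $\mathcal P^m(x)$ is not a boundary point of a rectangle for any integer $m$. The transition matrix $A(i,j)=1$ if $\mathcal P(\mathrm{Int}R_i)\cap\mathrm{Int}R_j\ne\emptyset$, $0$ otherwise, is irreducible and aperiodic. There are constants $\kappa\in(0,1]$ and $\gamma_1>\gamma_0>1$ with $\kappa\gamma_0^m d(u_1,u_2)\le d(\sigma^m(u_1),\sigma^m(u_2))\le\kappa^{-1}\gamma_1^m d(u_1,u_2)$ whenever $\sigma^j(u_1),\sigma^j(u_2)$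 lie in the same $U_{i_j}$ for all $j=0,\dots,m$. Notation: $v^n=v+v\circ\sigma+\dots+v\circ\sigma^{n-1}$; $Z_n(f-s\tau+zg)=\sum_{\sigma^nx=x}e^{f^n(x)-s\tau^n(x)+zg^n(x)}$; $L_{f-s\tau+zg}v(x)=\sum_{\sigma y=x}e^{f(y)-s\tau(y)+zg(y)}v(y)$, acting on $\nu$-Hölder functions; $L^0$ is the identity. $|w|_\nu=\sup\{|w(x)-w(y)|/d(x,y)^\nu : x\ne y\text{ in the same }U_i\}$, $\|w\|_\nu=\|w\|_\infty+|w|_\nu$, and $\|\cdot\|_\nu$ also denotes the corresponding operator norm. For real Hölder $h$, $\Pr(h)=\sup_m\{h(\sigma,m)+\int h\,dm\}$ over $\sigma$-invariant Borel probability measures $m$ (metric entropy plus integral). *)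

theory Defs
  imports "HOL-Analysis.Analysis" "HOL-Probability.Probability_Measure"
begin

section \<open>Riemannian manifolds of class C2\<close>

definition C1_on :: "'a::real_normed_vector set \<Rightarrow> ('a \<Rightarrow> 'b::real_normed_vector) \<Rightarrow> bool" where
  "C1_on S f \<longleftrightarrow>
     (\<exists>f'. (\<forall>x\<in>S. (f has_derivative blinfun_apply (f' x)) (at x)) \<and> continuous_on S f')"

definition C2_on :: "'a::real_normed_vector set \<Rightarrow> ('a \<Rightarrow> 'b::real_normed_vector) \<Rightarrow> bool" where
  "C2_on S f \<longleftrightarrow>
     (\<exists>f'. (\<forall>x\<in>S. (f has_derivative blinfun_apply (f' x)) (at x)) \<and> C1_on S f')"

text \<open>
  The manifold is the whole type \<open>'m\<close>, whose \<^const>\<open>dist\<close> will be the Riemannian distance.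
  The atlas is indexed by the points: \<open>cmap M p\<close> is a chart on the neighbourhood \<open>cdom M p\<close> of \<open>p\<close>.
  The tangent space at \<open>p\<close> is identified with \<open>'e\<close> through this particular chart, and
  \<open>metr M p\<close> is the inner product on it.
\<close>

record ('m, 'e) manifold =
  cdom :: "'m \<Rightarrow> 'm set"
  cmap :: "'m \<Rightarrow> 'm \<Rightarrow> 'e"
  metr :: "'m \<Rightarrow> 'e \<Rightarrow> 'e \<Rightarrow> real"

definition cinv :: "('m, 'e) manifold \<Rightarrow> 'm \<Rightarrow> 'e \<Rightarrow> 'm" where
  "cinv M p = inv_into (cdom M p) (cmap M p)"

definition C2_atlas :: "('m::metric_space, 'e::euclidean_space) manifold \<Rightarrow> bool" where
  "C2_atlas M \<longleftrightarrow>
     (\<forall>p. p \<in> cdom M p \<and> open (cdom M p) \<and> open (cmap M p ` cdom M p) \<and>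
          homeomorphism (cdom M p) (cmap M p ` cdom M p) (cmap M p) (cinv M p)) \<and>
     (\<forall>p q. C2_on (cmap M p ` (cdom M p \<inter> cdom M q)) (cmap M q \<circ> cinv M p))"

text \<open>
  On a C2 manifold the coefficients of a metric tensor can be of class C1 at most.
  The derivative below carries the coordinates of a tangent vector at \<open>q\<close> with respect to the
  chart of \<open>p\<close> to those with respect to the chart of \<open>q\<close>.
\<close>

definition metric_tensor :: "('m::metric_space, 'e::euclidean_space) manifold \<Rightarrow> bool" where
  "metric_tensor M \<longleftrightarrow>
     (\<forall>p. bilinear (metr M p) \<and> (\<forall>v w. metr M p v w = metr M p w v) \<and>
          (\<forall>v. v \<noteq> 0 \<longrightarrow> 0 < metr M p v v)) \<and>
     (\<forall>p v w. C1_on (cmap M p ` cdom M p)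
        (\<lambda>x. let q = cinv M p x; T = frechet_derivative (cmap M q \<circ> cinv M p) (at x)
             in metr M q (T v) (T w)))"

definition tnorm :: "('m, 'e) manifold \<Rightarrow> 'm \<Rightarrow> 'e \<Rightarrow> real" where
  "tnorm M p v = sqrt (metr M p v v)"

definition velocity :: "('m, 'e::real_normed_vector) manifold \<Rightarrow> (real \<Rightarrow> 'm) \<Rightarrow> real \<Rightarrow> 'e" where
  "velocity M c t = vector_derivative (cmap M (c t) \<circ> c) (at t)"

text \<open>
  Integrability of the speed has to be asked for, because \<^const>\<open>piecewise_C1_differentiable_on\<close>
  does not bound the derivative near the exceptional points.
\<close>

definition admissible_curve ::
  "('m::metric_space, 'e::euclidean_space) manifold \<Rightarrow> (real \<Rightarrow> 'm) \<Rightarrow> bool" where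
  "admissible_curve M c \<longleftrightarrow>
     continuous_on {0..1} c \<and>
     (\<forall>p a b. {a..b} \<subseteq> {0..1} \<and> c ` {a..b} \<subseteq> cdom M p \<longrightarrow>
        (cmap M p \<circ> c) piecewise_C1_differentiable_on {a..b}) \<and>
     (\<lambda>t. tnorm M (c t) (velocity M c t)) integrable_on {0..1}"

definition curve_length ::
  "('m, 'e::real_normed_vector) manifold \<Rightarrow> (real \<Rightarrow> 'm) \<Rightarrow> real" where
  "curve_length M c = integral {0..1} (\<lambda>t. tnorm M (c t) (velocity M c t))"

definition complete_riemannian_manifold ::
  "('m::metric_space, 'e::euclidean_space) manifold \<Rightarrow> bool" where
  "complete_riemannian_manifold M \<longleftrightarrow>
     C2_atlas M \<and> metric_tensor M \<and> connected (UNIV :: 'm set) \<and>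
     (\<forall>x y. dist x y = Inf {curve_length M c | c. admissible_curve M c \<and> c 0 = x \<and> c 1 = y}) \<and>
     complete (UNIV :: 'm set)"


section \<open>Axiom A flows and basic sets\<close>

definition C2_flow ::
  "('m::metric_space, 'e::euclidean_space) manifold \<Rightarrow> (real \<Rightarrow> 'm \<Rightarrow> 'm) \<Rightarrow> bool" where
  "C2_flow M \<phi> \<longleftrightarrow>
     (\<forall>x. \<phi> 0 x = x) \<and> (\<forall>s t x. \<phi> (s + t) x = \<phi> s (\<phi> t x)) \<and>
     continuous_on UNIV (\<lambda>(t, x). \<phi> t x) \<and>
     (\<forall>p q. C2_on {(t, x). x \<in> cmap M p ` cdom M p \<and> \<phi> t (cinv M p x) \<in> cdom M q}
               (\<lambda>(t, x). cmap M q (\<phi> t (cinv M p x))))"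

definition tangent_map ::
  "('m, 'e::euclidean_space) manifold \<Rightarrow> ('m \<Rightarrow> 'm) \<Rightarrow> 'm \<Rightarrow> 'e \<Rightarrow> 'e" where
  "tangent_map M F p = frechet_derivative (cmap M (F p) \<circ> F \<circ> cinv M p) (at (cmap M p p))"

text \<open>
  The span of the generating vector field is the flow direction \<open>E\<^sup>0\<close>; at a fixed point it is
  the zero space, so that the same definition covers hyperbolic fixed points.
\<close>

definition hyperbolic ::
  "('m::metric_space, 'e::euclidean_space) manifold \<Rightarrow> (real \<Rightarrow> 'm \<Rightarrow> 'm) \<Rightarrow> 'm set \<Rightarrow> bool" where
  "hyperbolic M \<phi> K \<longleftrightarrow>
     (\<forall>t. \<phi> t ` K = K) \<and>
     (\<exists>Es Eu :: 'm \<Rightarrow> 'e set. \<exists>C>0. \<exists>r. 0 < r \<and> r < 1 \<and>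
        (\<forall>x\<in>K. subspace (Es x) \<and> subspace (Eu x) \<and>
           (\<forall>v. \<exists>!(a, b, c). a \<in> span {velocity M (\<lambda>t. \<phi> t x) 0} \<and>
                               b \<in> Es x \<and> c \<in> Eu x \<and> v = a + b + c) \<and>
           (\<forall>t. tangent_map M (\<phi> t) x ` Es x = Es (\<phi> t x) \<and>
                tangent_map M (\<phi> t) x ` Eu x = Eu (\<phi> t x)) \<and>
           (\<forall>t\<ge>0. \<forall>v\<in>Es x.
              tnorm M (\<phi> t x) (tangent_map M (\<phi> t) x v) \<le> C * r powr t * tnorm M x v) \<and>
           (\<forall>t\<le>0. \<forall>v\<in>Eu x.
              tnorm M (\<phi> t x) (tangent_map M (\<phi> t) x v) \<le> C * r powr (- t) * tnorm M x v)))"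

definition fixed_point :: "(real \<Rightarrow> 'm \<Rightarrow> 'm) \<Rightarrow> 'm \<Rightarrow> bool" where
  "fixed_point \<phi> x \<longleftrightarrow> (\<forall>t. \<phi> t x = x)"

definition nonwandering :: "(real \<Rightarrow> 'm::topological_space \<Rightarrow> 'm) \<Rightarrow> 'm set" where
  "nonwandering \<phi> = {x. \<forall>V T. open V \<and> x \<in> V \<longrightarrow> (\<exists>t>T. \<phi> t ` V \<inter> V \<noteq> {})}"

definition axiom_A ::
  "('m::metric_space, 'e::euclidean_space) manifold \<Rightarrow> (real \<Rightarrow> 'm \<Rightarrow> 'm) \<Rightarrow> bool" where
  "axiom_A M \<phi> \<longleftrightarrow>
     (\<exists>F K. nonwandering \<phi> = F \<union> K \<and> F \<inter> K = {} \<and>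
        finite F \<and> (\<forall>p\<in>F. fixed_point \<phi> p \<and> hyperbolic M \<phi> {p}) \<and>
        compact K \<and> hyperbolic M \<phi> K \<and> (\<forall>p\<in>K. \<not> fixed_point \<phi> p) \<and>
        K \<subseteq> closure {x\<in>K. \<exists>t>0. \<phi> t x = x})"

definition basic_set ::
  "('m::metric_space, 'e::euclidean_space) manifold \<Rightarrow> (real \<Rightarrow> 'm \<Rightarrow> 'm) \<Rightarrow> 'm set \<Rightarrow> bool" where
  "basic_set M \<phi> \<Lambda> \<longleftrightarrow>
     \<Lambda> \<noteq> {} \<and> compact \<Lambda> \<and> (\<forall>t. \<phi> t ` \<Lambda> = \<Lambda>) \<and>
     hyperbolic M \<phi> \<Lambda> \<and> (\<forall>p\<in>\<Lambda>. \<not> fixed_point \<phi> p) \<and>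
     (\<exists>x\<in>\<Lambda>. \<Lambda> \<subseteq> closure {\<phi> t x | t. 0 \<le> t}) \<and>
     (\<exists>V. open V \<and> \<Lambda> = (\<Inter>t. \<phi> t ` V))"

definition weak_mixing_on :: "'m::topological_space set \<Rightarrow> (real \<Rightarrow> 'm \<Rightarrow> 'm) \<Rightarrow> bool" where
  "weak_mixing_on \<Lambda> \<phi> \<longleftrightarrow>
     \<not> (\<exists>a::real. \<exists>F :: 'm \<Rightarrow> complex. a \<noteq> 0 \<and> continuous_on \<Lambda> F \<and> (\<exists>x\<in>\<Lambda>. F x \<noteq> 0) \<and>
          (\<forall>x\<in>\<Lambda>. \<forall>t. F (\<phi> t x) = exp (\<i> * of_real (a * t)) * F x))"

definition Ws :: "(real \<Rightarrow> 'm::metric_space \<Rightarrow> 'm) \<Rightarrow> real \<Rightarrow> 'm \<Rightarrow> 'm set" where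
  "Ws \<phi> \<epsilon> x = {y. (\<forall>t\<ge>0. dist (\<phi> t x) (\<phi> t y) \<le> \<epsilon>) \<and>
                  ((\<lambda>t. dist (\<phi> t x) (\<phi> t y)) \<longlongrightarrow> 0) at_top}"

definition Wu :: "(real \<Rightarrow> 'm::metric_space \<Rightarrow> 'm) \<Rightarrow> real \<Rightarrow> 'm \<Rightarrow> 'm set" where
  "Wu \<phi> \<epsilon> x = {y. (\<forall>t\<le>0. dist (\<phi> t x) (\<phi> t y) \<le> \<epsilon>) \<and>
                  ((\<lambda>t. dist (\<phi> t x) (\<phi> t y)) \<longlongrightarrow> 0) at_bot}"

definition product_set :: "(real \<Rightarrow> 'm::metric_space \<Rightarrow> 'm) \<Rightarrow> real \<Rightarrow> 'm \<Rightarrow> 'm \<Rightarrow> 'm set" where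
  "product_set \<phi> \<epsilon> x y = Ws \<phi> \<epsilon> x \<inter> (\<Union>t\<in>{- \<epsilon>..\<epsilon>}. \<phi> t ` Wu \<phi> \<epsilon> y)"

definition local_product_structure ::
  "(real \<Rightarrow> 'm::metric_space \<Rightarrow> 'm) \<Rightarrow> 'm set \<Rightarrow> real \<Rightarrow> real \<Rightarrow> bool" where
  "local_product_structure \<phi> \<Lambda> \<epsilon> \<delta> \<longleftrightarrow>
     0 < \<epsilon> \<and> 0 < \<delta> \<and>
     (\<forall>x\<in>\<Lambda>. \<forall>y\<in>\<Lambda>. dist x y < \<delta> \<longrightarrow> (\<exists>p\<in>\<Lambda>. product_set \<phi> \<epsilon> x y = {p}))"

definition bracket :: "(real \<Rightarrow> 'm::metric_space \<Rightarrow> 'm) \<Rightarrow> real \<Rightarrow> 'm \<Rightarrow> 'm \<Rightarrow> 'm" where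
  "bracket \<phi> \<epsilon> x y = (THE p. p \<in> product_set \<phi> \<epsilon> x y)"


section \<open>Markov partitions\<close>

text \<open>
  The rectangles are \<open>R\<^sub>i = [U\<^sub>i, S\<^sub>i]\<close> for \<open>i < num Q\<close>, where \<open>U\<^sub>i = Us Q i\<close> and \<open>S\<^sub>i = Ss Q i\<close> are
  pieces of the unstable and the stable manifold of size \<open>eps Q\<close> of the point \<open>base Q i\<close>.
\<close>

record 'm rectangles =
  flow :: "real \<Rightarrow> 'm \<Rightarrow> 'm"
  basic :: "'m set"
  eps :: real
  num :: nat
  base :: "nat \<Rightarrow> 'm"
  Us :: "nat \<Rightarrow> 'm set"
  Ss :: "nat \<Rightarrow> 'm set"

abbreviation br :: "'m::metric_space rectangles \<Rightarrow> 'm \<Rightarrow> 'm \<Rightarrow> 'm" where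
  "br Q \<equiv> bracket (flow Q) (eps Q)"

definition rect :: "'m::metric_space rectangles \<Rightarrow> nat \<Rightarrow> 'm set" where
  "rect Q i = {br Q x y | x y. x \<in> Us Q i \<and> y \<in> Ss Q i}"

definition Rset :: "'m::metric_space rectangles \<Rightarrow> 'm set" where
  "Rset Q = (\<Union>i<num Q. rect Q i)"

definition Uset :: "'m rectangles \<Rightarrow> 'm set" where
  "Uset Q = (\<Union>i<num Q. Us Q i)"

definition Utop :: "'m::metric_space rectangles \<Rightarrow> nat \<Rightarrow> 'm topology" where
  "Utop Q i = top_of_set (Wu (flow Q) (eps Q) (base Q i) \<inter> basic Q)"

definition Stop :: "'m::metric_space rectangles \<Rightarrow> nat \<Rightarrow> 'm topology" where
  "Stop Q i = top_of_set (Ws (flow Q) (eps Q) (base Q i) \<inter> basic Q)"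

abbreviation IntU :: "'m::metric_space rectangles \<Rightarrow> nat \<Rightarrow> 'm set" where
  "IntU Q i \<equiv> Utop Q i interior_of Us Q i"

abbreviation IntS :: "'m::metric_space rectangles \<Rightarrow> nat \<Rightarrow> 'm set" where
  "IntS Q i \<equiv> Stop Q i interior_of Ss Q i"

text \<open>
  A rectangle has empty interior in the basic set; its interior is taken transversally to the flow.
\<close>

definition Int_rect :: "'m::metric_space rectangles \<Rightarrow> nat \<Rightarrow> 'm set" where
  "Int_rect Q i = {br Q x y | x y. x \<in> IntU Q i \<and> y \<in> IntS Q i}"

definition return_time :: "'m::metric_space rectangles \<Rightarrow> 'm \<Rightarrow> real" where
  "return_time Q x = Inf {t. 0 < t \<and> flow Q t x \<in> Rset Q}"

definition poincare :: "'m::metric_space rectangles \<Rightarrow> 'm \<Rightarrow> 'm" where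
  "poincare Q x = flow Q (return_time Q x) x"

definition projU :: "'m::metric_space rectangles \<Rightarrow> 'm \<Rightarrow> 'm" where
  "projU Q y = (THE u. \<exists>i<num Q. u \<in> Us Q i \<and> (\<exists>s\<in>Ss Q i. y = br Q u s))"

definition shift :: "'m::metric_space rectangles \<Rightarrow> 'm \<Rightarrow> 'm" where
  "shift Q = projU Q \<circ> poincare Q"

text \<open>
  In a Markov family of size \<open>\<rho>\<close> (Bowen) every orbit meets the rectangles within time \<open>\<rho>\<close>, every
  rectangle is a local cross section of time \<open>\<rho>\<close>, and no two rectangles can each be
  reached from the other within time \<open>\<rho>\<close>; with time 0 admitted this makes them disjoint.
  The number \<open>\<delta>\<close> is the radius within which the bracket is defined.
\<close>

definition markov_partition :: "real \<Rightarrow> real \<Rightarrow> 'm::metric_space rectangles \<Rightarrow> bool" where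
  "markov_partition \<delta> \<rho> Q \<longleftrightarrow>
     0 < \<rho> \<and> \<rho> \<le> \<delta> \<and> 0 < num Q \<and>
     (\<forall>i<num Q.
        Us Q i \<subseteq> Wu (flow Q) (eps Q) (base Q i) \<inter> basic Q \<and>
        Ss Q i \<subseteq> Ws (flow Q) (eps Q) (base Q i) \<inter> basic Q \<and>
        compact (Us Q i) \<and> Us Q i = Utop Q i closure_of IntU Q i \<and>
        compact (Ss Q i) \<and> Ss Q i = Stop Q i closure_of IntS Q i \<and>
        base Q i \<in> IntU Q i \<and> base Q i \<in> IntS Q i \<and>
        (\<forall>x\<in>Us Q i. \<forall>y\<in>Ss Q i. dist x y < \<delta>) \<and>
        compact (rect Q i) \<and> diameter (rect Q i) < \<rho>) \<and>
     (\<forall>x\<in>basic Q. \<exists>t. 0 < t \<and> t \<le> \<rho> \<and> flow Q t x \<in> Rset Q) \<and>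
     (\<forall>i<num Q. \<forall>t. 0 < t \<and> t \<le> \<rho> \<longrightarrow> rect Q i \<inter> flow Q t ` rect Q i = {}) \<and>
     (\<forall>i<num Q. \<forall>j<num Q. i \<noteq> j \<longrightarrow>
        rect Q i \<inter> (\<Union>t\<in>{0..\<rho>}. flow Q t ` rect Q j) = {} \<or>
        rect Q j \<inter> (\<Union>t\<in>{0..\<rho>}. flow Q t ` rect Q i) = {}) \<and>
     (\<forall>i<num Q. \<forall>j<num Q. \<forall>u\<in>IntU Q i. \<forall>s\<in>IntS Q i. \<forall>u'\<in>IntU Q j. \<forall>s'\<in>IntS Q j.
        poincare Q (br Q u s) = br Q u' s' \<longrightarrow>
          poincare Q ` (br Q u ` IntS Q i) \<subseteq> br Q u' ` IntS Q j \<and>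
          (\<lambda>x. br Q x s') ` IntU Q j \<subseteq> poincare Q ` ((\<lambda>x. br Q x s) ` IntU Q i))"

definition boundary :: "'m::metric_space rectangles \<Rightarrow> 'm set" where
  "boundary Q = (\<Union>i<num Q. rect Q i - Int_rect Q i)"

text \<open>Negative iterates of the Poincare map are expressed through preimages.\<close>

definition Uhat :: "'m::metric_space rectangles \<Rightarrow> 'm set" where
  "Uhat Q = {x \<in> Uset Q. \<forall>n. (poincare Q ^^ n) x \<notin> boundary Q \<and>
               (\<forall>y\<in>Rset Q. (poincare Q ^^ n) y = x \<longrightarrow> y \<notin> boundary Q)}"

definition transition :: "'m::metric_space rectangles \<Rightarrow> (nat \<times> nat) set" where
  "transition Q = {(i, j). i < num Q \<and> j < num Q \<and> poincare Q ` Int_rect Q i \<inter> Int_rect Q j \<noteq> {}}"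

definition irreducible_aperiodic :: "nat \<Rightarrow> (nat \<times> nat) set \<Rightarrow> bool" where
  "irreducible_aperiodic k A \<longleftrightarrow>
     (\<forall>i<k. \<forall>j<k. (i, j) \<in> A\<^sup>+) \<and>
     (\<forall>i<k. Gcd {n. 0 < n \<and> (i, i) \<in> A ^^ n} = 1)"

definition expansion_constants ::
  "'m::metric_space rectangles \<Rightarrow> real \<Rightarrow> real \<Rightarrow> real \<Rightarrow> bool" where
  "expansion_constants Q \<kappa> \<gamma>0 \<gamma>1 \<longleftrightarrow>
     0 < \<kappa> \<and> \<kappa> \<le> 1 \<and> 1 < \<gamma>0 \<and> \<gamma>0 < \<gamma>1 \<and>
     (\<forall>m. \<forall>u\<in>Uset Q. \<forall>v\<in>Uset Q.
        (\<forall>j\<le>m. \<exists>i<num Q. (shift Q ^^ j) u \<in> Us Q i \<and> (shift Q ^^ j) v \<in> Us Q i) \<longrightarrow>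
          \<kappa> * \<gamma>0 ^ m * dist u v \<le> dist ((shift Q ^^ m) u) ((shift Q ^^ m) v) \<and>
          dist ((shift Q ^^ m) u) ((shift Q ^^ m) v) \<le> inverse \<kappa> * \<gamma>1 ^ m * dist u v)"


section \<open>Hoelder functions and transfer operators\<close>

definition hoelder_on :: "real \<Rightarrow> 'm::metric_space set \<Rightarrow> ('m \<Rightarrow> 'b::real_normed_vector) \<Rightarrow> bool" where
  "hoelder_on \<nu> A w \<longleftrightarrow> (\<exists>C. \<forall>x\<in>A. \<forall>y\<in>A. norm (w x - w y) \<le> C * dist x y powr \<nu>)"

definition hoelder :: "'m::metric_space rectangles \<Rightarrow> real \<Rightarrow> ('m \<Rightarrow> 'b::real_normed_vector) \<Rightarrow> bool" where
  "hoelder Q \<nu> w \<longleftrightarrow> (\<forall>i<num Q. hoelder_on \<nu> (Us Q i) w)"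

text \<open>Hoelder on \<open>Uhat Q\<close>, with the values on \<open>Uset Q\<close> given by continuous extension.\<close>

definition hoelder_extended ::
  "'m::metric_space rectangles \<Rightarrow> real \<Rightarrow> ('m \<Rightarrow> 'b::real_normed_vector) \<Rightarrow> bool" where
  "hoelder_extended Q \<nu> w \<longleftrightarrow>
     (\<forall>i<num Q. hoelder_on \<nu> (Us Q i \<inter> Uhat Q) w \<and> continuous_on (Us Q i) w)"

definition hoelder_norm :: "'m::metric_space rectangles \<Rightarrow> real \<Rightarrow> ('m \<Rightarrow> complex) \<Rightarrow> real" where
  "hoelder_norm Q \<nu> w =
     (SUP x\<in>Uset Q. cmod (w x)) +
     Sup (insert 0 {cmod (w x - w y) / dist x y powr \<nu> | x y i.
                      i < num Q \<and> x \<in> Us Q i \<and> y \<in> Us Q i \<and> x \<noteq> y})"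

definition op_norm ::
  "'m::metric_space rectangles \<Rightarrow> real \<Rightarrow> (('m \<Rightarrow> complex) \<Rightarrow> 'm \<Rightarrow> complex) \<Rightarrow> real" where
  "op_norm Q \<nu> F = Sup {hoelder_norm Q \<nu> (F v) | v. hoelder Q \<nu> v \<and> hoelder_norm Q \<nu> v \<le> 1}"

definition birkhoff_sum :: "('m \<Rightarrow> 'm) \<Rightarrow> nat \<Rightarrow> ('m \<Rightarrow> 'b::comm_monoid_add) \<Rightarrow> 'm \<Rightarrow> 'b" where
  "birkhoff_sum T n v x = (\<Sum>j<n. v ((T ^^ j) x))"

definition transfer_op ::
  "'m::metric_space rectangles \<Rightarrow> ('m \<Rightarrow> complex) \<Rightarrow> ('m \<Rightarrow> complex) \<Rightarrow> 'm \<Rightarrow> complex" where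
  "transfer_op Q h v x = (\<Sum>y\<in>{y\<in>Uset Q. shift Q y = x}. exp (h y) * v y)"

definition Zsum :: "'m::metric_space rectangles \<Rightarrow> nat \<Rightarrow> ('m \<Rightarrow> complex) \<Rightarrow> complex" where
  "Zsum Q n h = (\<Sum>x\<in>{x\<in>Uset Q. (shift Q ^^ n) x = x}. exp (birkhoff_sum (shift Q) n h x))"


section \<open>Metric entropy and pressure\<close>

definition invariant_measures :: "'m::topological_space set \<Rightarrow> ('m \<Rightarrow> 'm) \<Rightarrow> 'm measure set" where
  "invariant_measures X T =
     {m. prob_space m \<and> sets m = sets (restrict_space borel X) \<and>
         T \<in> measurable m m \<and> distr m m T = m}"

text \<open>
  A finite measurable partition is given by its labelling \<open>\<xi>\<close>, a measurable function with finitely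
  many values; the labelling of the join of its first \<open>n\<close> preimages is the itinerary of length \<open>n\<close>.
\<close>

definition partition_entropy :: "'m measure \<Rightarrow> ('m \<Rightarrow> 'c) \<Rightarrow> real" where
  "partition_entropy m \<xi> =
     (\<Sum>c\<in>\<xi> ` space m. - measure m (\<xi> -` {c} \<inter> space m) * ln (measure m (\<xi> -` {c} \<inter> space m)))"

definition itinerary :: "('m \<Rightarrow> 'm) \<Rightarrow> ('m \<Rightarrow> nat) \<Rightarrow> nat \<Rightarrow> 'm \<Rightarrow> nat list" where
  "itinerary T \<xi> n x = map (\<lambda>j. \<xi> ((T ^^ j) x)) [0..<n]"

text \<open>The limit superior below is a limit, by subadditivity.\<close>

definition metric_entropy :: "('m \<Rightarrow> 'm) \<Rightarrow> 'm measure \<Rightarrow> ereal" where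
  "metric_entropy T m =
     (SUP \<xi>\<in>{\<xi>. \<xi> \<in> measurable m (count_space UNIV) \<and> finite (\<xi> ` space m)}.
        limsup (\<lambda>n. ereal (partition_entropy m (itinerary T \<xi> n) / real n)))"

definition pressure :: "'m::metric_space rectangles \<Rightarrow> ('m \<Rightarrow> real) \<Rightarrow> real" where
  "pressure Q h = real_of_ereal
     (SUP m\<in>invariant_measures (Uset Q) (shift Q).
        metric_entropy (shift Q) m + ereal (integral\<^sup>L m h))"

end

theory Submission
  imports Defs "HOL-Probability.Information" "HOL-Probability.Infinite_Product_Measure"
begin

text \<open>
  Write \<open>\<chi>\<^sub>\<alpha>\<close> for the indicator of the cylinder of a word \<open>\<alpha>\<close> in the letters \<open>U\<^sub>i\<close>, and \<open>L\<close> for the transfer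
  operator. Choose a point \<open>x\<^sub>\<alpha>\<close> in every cylinder: the given points for words of length 1, and the
  periodic point, if there is one, for words of length \<open>n\<close>. Then \<open>Z\<^sub>n\<close> is the sum of \<open>L\<^sup>n \<chi>\<^sub>\<alpha> (x\<^sub>\<alpha>)\<close> over the
  words of length \<open>n\<close>, the sum subtracted from it is the same sum for length 1, and telescoping over the
  length \<open>m\<close> leaves the differences of \<open>L\<^sup>n \<chi>\<^sub>\<alpha>\<close> at \<open>x\<^sub>\<alpha>\<close> and at the point of the word without its last letter.
  Writing \<open>L\<^sup>n = L\<^bsup>n-m\<^esup> L\<^sup>m\<close>, expansion makes the distance of these points at most a multiple of \<open>\<gamma>\<^sub>0\<^bsup>-m\<^esup>\<close>,
  and bounded distortion makes the Hoelder norm of \<open>L\<^sup>m \<chi>\<^sub>\<alpha>\<close> at most a multiple of \<open>exp (\<phi>\<^sup>m)\<close> at any point of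
  the cylinder, \<open>\<phi>\<close> being the real part of the potential.

  It remains to bound the sum of \<open>exp (\<phi>\<^sup>m)\<close> over the cylinders by a multiple of \<open>exp (m Pr(\<phi>))\<close>. By
  irreducibility, a fixed proportion of the sum comes from words that can be closed up to
  loops of one common length at a single letter. The Bernoulli measure on sequences of these
  loops with Gibbs weights, averaged over one period, is an invariant measure whose entropy plus energy
  is, up to bounded factors, the logarithm of the sum divided by \<open>m\<close>. All constants depend on \<open>\<phi>\<close> only
  through a bound and a Hoelder constant, so they are uniform in \<open>a\<close> and \<open>c\<close>.
\<close>

section \<open>Full-branched expanding maps: words and cylinders\<close>

text \<open>The coding works on all of \<open>Uset Q\<close>, boundary points included, because the
  rectangles are pairwise disjoint and the return time is continuous on each closed piece. So the
  first return map is continuous on each compact \<open>Us Q i\<close>, every point has exactly one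
  word of each length, and a cylinder of length n contains at most one fixed point of the n-th
  iterate. The locale keeps only such consequences and forgets the flow.

  Another obstacle is that \<open>pressure\<close>, \<open>op_norm\<close> and
  \<open>hoelder_norm\<close> are real numbers made from suprema, meaningful only when these are
  finite. Hence the uniform bound on the entropy of invariant measures and the proof that the
  transfer operator is bounded.

  The imaginary parts of s and z only rotate the values of the exponentials: on a half plane of
  bounded real part, exp is Lipschitz with a constant given by the real part. They contribute a
  factor growing linearly in |s| and in |z|, while pressure and distortion see only Re s and Re
  z.\<close>

locale markov_map =
  fixes Q :: "'m::metric_space rectangles" and \<kappa> \<gamma> :: real
  assumes compact_Us: "i < num Q \<Longrightarrow> compact (Us Q i)"
    and Us_nonempty: "i < num Q \<Longrightarrow> Us Q i \<noteq> {}"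
    and Us_disjoint: "i < num Q \<Longrightarrow> j < num Q \<Longrightarrow> x \<in> Us Q i \<Longrightarrow> x \<in> Us Q j \<Longrightarrow> i = j"
    and num_pos: "0 < num Q"
    and shift_in: "x \<in> Uset Q \<Longrightarrow> shift Q x \<in> Uset Q"
    and continuous_shift: "i < num Q \<Longrightarrow> continuous_on (Us Q i) (shift Q)"
    and full_branch: "i < num Q \<Longrightarrow> j < num Q \<Longrightarrow> x \<in> Us Q i \<Longrightarrow> shift Q x \<in> Us Q j \<Longrightarrow>
        Us Q j \<subseteq> shift Q ` Us Q i"
    and \<kappa>_pos: "0 < \<kappa>" and \<gamma>_gt_1: "1 < \<gamma>"
    and expanding: "u \<in> Uset Q \<Longrightarrow> v \<in> Uset Q \<Longrightarrow>
        (\<And>j. j \<le> m \<Longrightarrow> \<exists>i<num Q. (shift Q ^^ j) u \<in> Us Q i \<and> (shift Q ^^ j) v \<in> Us Q i) \<Longrightarrow>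
        \<kappa> * \<gamma> ^ m * dist u v \<le> dist ((shift Q ^^ m) u) ((shift Q ^^ m) v)"
    and irreducible: "i < num Q \<Longrightarrow> j < num Q \<Longrightarrow>
        (i, j) \<in> {(i, j). i < num Q \<and> j < num Q \<and> (\<exists>x\<in>Us Q i. shift Q x \<in> Us Q j)}\<^sup>+"
    and no_self_transition: "i < num Q \<Longrightarrow> x \<in> Us Q i \<Longrightarrow> shift Q x \<notin> Us Q i"
begin

abbreviation "T \<equiv> shift Q"
abbreviation "U \<equiv> Us Q"
abbreviation "X \<equiv> Uset Q"
abbreviation "k \<equiv> num Q"

definition succ :: "nat \<Rightarrow> nat \<Rightarrow> bool" where
  "succ i j \<longleftrightarrow> i < k \<and> j < k \<and> (\<exists>x\<in>U i. T x \<in> U j)"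

definition letter :: "'m \<Rightarrow> nat" where
  "letter x = (THE i. i < k \<and> x \<in> U i)"

definition cyl :: "nat list \<Rightarrow> 'm set" where
  "cyl ws = {x \<in> X. \<forall>j<length ws. (T ^^ j) x \<in> U (ws ! j)}"

text \<open>All words over the letters, forbidden ones included: these have empty cylinders and
  contribute 0 to the sums of branch values.\<close>

definition wds :: "nat \<Rightarrow> nat list set" where
  "wds n = {ws. set ws \<subseteq> {..<k} \<and> length ws = n}"

lemma Uset_iff: "x \<in> X \<longleftrightarrow> (\<exists>i<k. x \<in> U i)"
  by (auto simp: Uset_def)

lemma letter_eq: "i < k \<Longrightarrow> x \<in> U i \<Longrightarrow> letter x = i"
  unfolding letter_def using Us_disjoint by (intro the_equality) auto

lemma letter_less: "x \<in> X \<Longrightarrow> letter x < k"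
  and in_U_letter: "x \<in> X \<Longrightarrow> x \<in> U (letter x)"
  using letter_eq by (auto simp: Uset_iff)

lemma in_U_iff: "x \<in> X \<Longrightarrow> i < k \<Longrightarrow> x \<in> U i \<longleftrightarrow> letter x = i"
  using letter_eq in_U_letter by auto

lemma compact_X: "compact X"
  unfolding Uset_def using compact_Us by (intro compact_UN) auto

lemma U_subset_X: "i < k \<Longrightarrow> U i \<subseteq> X"
  by (auto simp: Uset_def)

lemma funpow_in: "x \<in> X \<Longrightarrow> (T ^^ n) x \<in> X"
  by (induction n) (auto intro: shift_in)

lemma funpow_add_apply: "(T ^^ (m + n)) x = (T ^^ n) ((T ^^ m) x)"
  by (metis add.commute comp_apply funpow_add)

lemma continuous_on_X:
  assumes "\<And>i. i < k \<Longrightarrow> continuous_on (U i) w"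
  shows "continuous_on X w"
  unfolding Uset_def using compact_Us assms
  by (intro continuous_on_closed_Union) (auto intro: compact_imp_closed)

lemma continuous_shift_X: "continuous_on X T"
  using continuous_shift by (rule continuous_on_X)

lemma continuous_funpow: "continuous_on X (T ^^ n)"
proof (induction n)
  case (Suc n)
  have "continuous_on X (T \<circ> (T ^^ n))"
    by (intro continuous_on_compose Suc) (auto intro!: continuous_on_subset[OF continuous_shift_X] funpow_in)
  then show ?case by simp
qed simp

lemma finite_wds [simp]: "finite (wds n)"
  unfolding wds_def by (intro finite_lists_length_eq) auto

lemma card_wds: "card (wds n) = k ^ n"
  unfolding wds_def by (subst card_lists_length_eq) auto

lemma wds_0: "wds 0 = {[]}"
  by (auto simp: wds_def)

lemma wds_length: "ws \<in> wds n \<Longrightarrow> length ws = n"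
  by (simp add: wds_def)

lemma wds_nth: "ws \<in> wds n \<Longrightarrow> j < n \<Longrightarrow> ws ! j < k"
  by (auto simp: wds_def dest!: nth_mem)

lemma wds_Suc_snoc: "wds (Suc n) = (\<lambda>(vs, i). vs @ [i]) ` (wds n \<times> {..<k})"
proof (intro equalityI subsetI)
  fix ws assume a: "ws \<in> wds (Suc n)"
  then have "ws = butlast ws @ [last ws]" "butlast ws \<in> wds n" "last ws < k"
    by (auto simp: wds_def dest: in_set_butlastD) 
      (metis append_butlast_last_id length_0_conv nat.distinct(1),
       metis last_in_set length_0_conv lessThan_iff nat.distinct(1) subsetD)
  then show "ws \<in> (\<lambda>(vs, i). vs @ [i]) ` (wds n \<times> {..<k})"
    by (intro image_eqI[where x = "(butlast ws, last ws)"]) auto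
qed (auto simp: wds_def)

lemma sum_wds_Suc: "(\<Sum>ws\<in>wds (Suc n). F ws) = (\<Sum>vs\<in>wds n. \<Sum>i<k. F (vs @ [i]))"
proof -
  have "(\<Sum>ws\<in>wds (Suc n). F ws) = (\<Sum>p\<in>wds n \<times> {..<k}. F (fst p @ [snd p]))"
    unfolding wds_Suc_snoc
    by (subst sum.reindex) (auto simp: inj_on_def case_prod_unfold)
  then show ?thesis by (simp add: sum.cartesian_product case_prod_unfold)
qed

lemma cyl_Cons: "i < k \<Longrightarrow> cyl (i # ws) = {x \<in> U i. T x \<in> cyl ws}"
  using U_subset_X[of i] shift_in
  unfolding cyl_def
  by (auto simp: All_less_Suc2 funpow_Suc_right simp del: funpow.simps)

lemma cyl_Nil [simp]: "cyl [] = X"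
  by (simp add: cyl_def)

lemma cyl_single: "i < k \<Longrightarrow> cyl [i] = U i"
  using U_subset_X shift_in by (auto simp: cyl_def)

lemma cyl_append: "cyl (ws @ vs) = {x \<in> cyl ws. (T ^^ length ws) x \<in> cyl vs}"
proof -
  have *: "(\<forall>j<length (ws @ vs). (T ^^ j) x \<in> U ((ws @ vs) ! j)) \<longleftrightarrow>
     (\<forall>j<length ws. (T ^^ j) x \<in> U (ws ! j)) \<and> (\<forall>j<length vs. (T ^^ j) ((T ^^ length ws) x) \<in> U (vs ! j))"
    (is "?l \<longleftrightarrow> ?r1 \<and> ?r2") for x
  proof (intro iffI conjI allI impI)
    fix j assume l: ?l
    show "(T ^^ j) x \<in> U (ws ! j)" if "j < length ws"
      using l[rule_format, of j] that by (simp add: nth_append)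
    show "(T ^^ j) ((T ^^ length ws) x) \<in> U (vs ! j)" if "j < length vs"
      using l[rule_format, of "length ws + j"] that by (simp add: nth_append funpow_add_apply)
  next
    fix j assume r: "?r1 \<and> ?r2" and j: "j < length (ws @ vs)"
    show "(T ^^ j) x \<in> U ((ws @ vs) ! j)"
    proof (cases "j < length ws")
      case False
      then show ?thesis using r j funpow_add_apply[of "length ws" "j - length ws" x]
        by (auto simp: nth_append)
    qed (use r in \<open>auto simp: nth_append\<close>)
  qed
  show ?thesis unfolding cyl_def using * funpow_in by auto
qed

lemma cyl_subset_X: "cyl ws \<subseteq> X"
  by (auto simp: cyl_def)

lemma cyl_subset_U: "ws \<in> wds n \<Longrightarrow> 0 < n \<Longrightarrow> cyl ws \<subseteq> U (hd ws)"
  by (auto simp: cyl_def wds_def hd_conv_nth)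

lemma compact_cyl: "ws \<in> wds n \<Longrightarrow> compact (cyl ws)"
proof -
  assume a: "ws \<in> wds n"
  have "closed (X \<inter> (T ^^ j) -` U (ws ! j))" if "j < n" for j
    using wds_nth[OF a that] compact_Us compact_X
    by (intro continuous_closed_preimage continuous_funpow) (auto intro: compact_imp_closed)
  then have "compact (X \<inter> (\<Inter>j\<in>{..<n}. X \<inter> (T ^^ j) -` U (ws ! j)))"
    by (intro compact_Int_closed compact_X closed_INT) auto
  moreover have "cyl ws = X \<inter> (\<Inter>j\<in>{..<n}. X \<inter> (T ^^ j) -` U (ws ! j))"
    using wds_length[OF a] by (auto simp: cyl_def)
  ultimately show ?thesis by simp
qed

lemma cyl_letters:
  assumes "ws \<in> wds n"
  shows "x \<in> cyl ws \<longleftrightarrow> x \<in> X \<and> (\<forall>j<n. letter ((T ^^ j) x) = ws ! j)"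
  using assms in_U_iff funpow_in wds_nth[OF assms] by (auto simp: cyl_def wds_length)

definition word :: "nat \<Rightarrow> 'm \<Rightarrow> nat list" where
  "word n x = map (\<lambda>j. letter ((T ^^ j) x)) [0..<n]"

lemma word_in: "x \<in> X \<Longrightarrow> word n x \<in> wds n"
  using letter_less funpow_in by (auto simp: word_def wds_def)

lemma in_cyl_iff: "ws \<in> wds n \<Longrightarrow> x \<in> cyl ws \<longleftrightarrow> x \<in> X \<and> word n x = ws"
  by (auto simp: cyl_letters word_def list_eq_iff_nth_eq wds_length)

lemma succ_letter: "x \<in> X \<Longrightarrow> succ (letter x) (letter (T x))"
  using letter_less in_U_letter shift_in unfolding succ_def by blast

lemma onto_succ: "succ i j \<Longrightarrow> y \<in> U j \<Longrightarrow> \<exists>x\<in>U i. T x = y"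
  using full_branch unfolding succ_def by blast

section \<open>Admissible words and nonempty cylinders\<close>

definition chain :: "nat list \<Rightarrow> bool" where
  "chain ws \<longleftrightarrow> (\<forall>j. Suc j < length ws \<longrightarrow> succ (ws ! j) (ws ! Suc j))"

lemma chain_iff: "chain ws \<longleftrightarrow> successively succ ws"
  by (simp add: chain_def successively_conv_nth)

lemma chain_if_cyl: "ws \<in> wds n \<Longrightarrow> x \<in> cyl ws \<Longrightarrow> chain ws"
proof -
  assume a: "ws \<in> wds n" "x \<in> cyl ws"
  show "chain ws"
    unfolding chain_def
  proof (intro allI impI)
    fix j assume "Suc j < length ws"
    then have "ws ! j = letter ((T ^^ j) x)" "ws ! Suc j = letter (T ((T ^^ j) x))" "x \<in> X"
      using a by (auto simp: cyl_letters wds_length)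
    then show "succ (ws ! j) (ws ! Suc j)"
      using succ_letter funpow_in by simp
  qed
qed

text \<open>Full branching lets a prescribed end point be pulled back one letter at a time, starting
  from the last letter.\<close>

lemma chain_onto:
  "ws \<in> wds n \<Longrightarrow> chain ws \<Longrightarrow> 0 < n \<Longrightarrow> succ (last ws) j \<Longrightarrow> y \<in> U j \<Longrightarrow> \<exists>x\<in>cyl ws. (T ^^ n) x = y"
proof (induction ws arbitrary: n)
  case (Cons i vs)
  have i: "i < k" using Cons.prems by (auto simp: wds_def)
  show ?case
  proof (cases vs)
    case Nil
    then have "n = 1" using Cons.prems by (simp add: wds_def)
    obtain x where "x \<in> U i" "T x = y" using onto_succ Cons.prems Nil by force
    then show ?thesis using Nil i \<open>n = 1\<close> by (auto simp: cyl_single)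
  next
    case (Cons i' vs')
    obtain m where m: "n = Suc m" "0 < m" "vs \<in> wds m" using Cons.prems Cons by (cases n) (auto simp: wds_def)
    have "chain vs" using Cons.prems(2) Cons by (simp add: chain_iff successively_Cons)
    then obtain x where x: "x \<in> cyl vs" "(T ^^ m) x = y"
      using Cons.IH[of m] m Cons.prems Cons by auto
    have "x \<in> U i'" using cyl_subset_U[OF m(3,2)] x Cons by auto
    moreover have "succ i i'" using Cons.prems(2) Cons unfolding chain_def by force
    ultimately obtain w where w: "w \<in> U i" "T w = x" using onto_succ by blast
    then have "w \<in> cyl (i # vs)" using x i by (simp add: cyl_Cons)
    moreover have "(T ^^ n) w = y" using x w m by (simp add: funpow_Suc_right del: funpow.simps)
    ultimately show ?thesis by blast
  qed
qed (simp add: wds_def)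

lemma succ_last:
  assumes "ws \<in> wds n" "0 < n" "x \<in> cyl ws" "(T ^^ n) x \<in> U j" "j < k"
  shows "succ (last ws) j"
proof -
  obtain m where n: "n = Suc m" using assms by (cases n) auto
  have "last ws = ws ! m" using wds_length[OF assms(1)] n by (subst last_conv_nth) auto
  then have "last ws = letter ((T ^^ m) x)" using assms n cyl_letters by auto
  moreover have "j = letter (T ((T ^^ m) x))" using assms n letter_eq by auto
  moreover have "(T ^^ m) x \<in> X" using assms(3) cyl_subset_X funpow_in by blast
  ultimately show ?thesis using succ_letter[of "(T ^^ m) x"] by simp
qed

text \<open>The all-or-nothing property of branches: an inverse branch is defined on a whole piece
  or nowhere on it.\<close>

lemma cyl_onto:
  assumes "ws \<in> wds n" "0 < n" "x \<in> cyl ws" "(T ^^ n) x \<in> U j" "j < k" "y \<in> U j"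
  shows "\<exists>x\<in>cyl ws. (T ^^ n) x = y"
  using chain_onto[OF assms(1) chain_if_cyl[OF assms(1,3)] assms(2) succ_last[OF assms(1-5)] assms(6)] .

lemma cyl_nonempty: "ws \<in> wds n \<Longrightarrow> chain ws \<Longrightarrow> cyl ws \<noteq> {}"
proof (cases "n = 0")
  case True
  then show "ws \<in> wds n \<Longrightarrow> ?thesis" using Us_nonempty num_pos by (auto simp: wds_def Uset_def)
next
  case False
  assume a: "ws \<in> wds n" "chain ws"
  have "last ws < k" using a False by (auto simp: wds_def dest!: last_in_set)
  then obtain x where "x \<in> U (last ws)" using Us_nonempty by blast
  moreover have "succ (last ws) (letter (T x))"
    using succ_letter[of x] calculation U_subset_X \<open>last ws < k\<close> letter_eq by force
  moreover obtain y where "y \<in> U (letter (T x))" 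
    using calculation U_subset_X \<open>last ws < k\<close> in_U_letter shift_in by blast
  ultimately show ?thesis using chain_onto[OF a] False by blast
qed

section \<open>Expansion, expansivity and coding\<close>

lemma dist_bound:
  assumes "x \<in> X" "y \<in> X" "\<And>j. j \<le> m \<Longrightarrow> letter ((T ^^ j) x) = letter ((T ^^ j) y)"
  shows "dist x y \<le> dist ((T ^^ m) x) ((T ^^ m) y) / (\<kappa> * \<gamma> ^ m)"
proof -
  have "\<exists>i<k. (T ^^ j) x \<in> U i \<and> (T ^^ j) y \<in> U i" if "j \<le> m" for j
    using assms(3)[OF that] in_U_letter funpow_in assms(1,2) letter_less by metis
  then have "\<kappa> * \<gamma> ^ m * dist x y \<le> dist ((T ^^ m) x) ((T ^^ m) y)"
    using expanding assms by blast
  then show ?thesis using \<kappa>_pos \<gamma>_gt_1 by (simp add: field_simps)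
qed

definition diam :: real where "diam = diameter X"

lemma dist_le_diam: "x \<in> X \<Longrightarrow> y \<in> X \<Longrightarrow> dist x y \<le> diam"
  unfolding diam_def using compact_X by (intro diameter_bounded_bound) (auto intro: compact_imp_bounded)

lemma diam_nonneg: "0 \<le> diam"
  unfolding diam_def using compact_X by (intro diameter_ge_0) (auto intro: compact_imp_bounded)

lemma dist_cyl_end:
  assumes "ws \<in> wds n" "x \<in> cyl ws" "y \<in> cyl ws" "letter ((T ^^ n) x) = letter ((T ^^ n) y)" "j \<le> n"
  shows "dist ((T ^^ j) x) ((T ^^ j) y) \<le> dist ((T ^^ n) x) ((T ^^ n) y) / (\<kappa> * \<gamma> ^ (n - j))"
proof -
  have "letter ((T ^^ i) ((T ^^ j) x)) = letter ((T ^^ i) ((T ^^ j) y))" if "i \<le> n - j" for i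
  proof (cases "j + i = n")
    case False
    then have "j + i < n" using that assms by auto
    then show ?thesis using assms(1,2,3) by (simp add: cyl_letters flip: funpow_add_apply)
  qed (use assms in \<open>simp flip: funpow_add_apply\<close>)
  then have "dist ((T ^^ j) x) ((T ^^ j) y) 
    \<le> dist ((T ^^ (n - j)) ((T ^^ j) x)) ((T ^^ (n - j)) ((T ^^ j) y)) / (\<kappa> * \<gamma> ^ (n - j))"
    using assms cyl_subset_X funpow_in by (intro dist_bound) blast+
  then show ?thesis using \<open>j \<le> n\<close> by (simp flip: funpow_add_apply)
qed

text \<open>A word of n + 1 letters yields only n expanding steps, because the expansion estimate
  asks for equal letters at both ends. In \<open>dist_cyl_end\<close> the common letter of the end
  points supplies the missing one.\<close>

lemma dist_cyl:
  assumes "ws \<in> wds (Suc n)" "x \<in> cyl ws" "y \<in> cyl ws" "j \<le> n"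
  shows "dist ((T ^^ j) x) ((T ^^ j) y) \<le> diam / (\<kappa> * \<gamma> ^ (n - j))"
proof -
  have "letter ((T ^^ i) ((T ^^ j) x)) = letter ((T ^^ i) ((T ^^ j) y))" if "i \<le> n - j" for i
    using assms that by (simp add: cyl_letters flip: funpow_add_apply)
  then have "dist ((T ^^ j) x) ((T ^^ j) y) 
    \<le> dist ((T ^^ (n - j)) ((T ^^ j) x)) ((T ^^ (n - j)) ((T ^^ j) y)) / (\<kappa> * \<gamma> ^ (n - j))"
    using assms cyl_subset_X funpow_in by (intro dist_bound) blast+
  also have "\<dots> \<le> diam / (\<kappa> * \<gamma> ^ (n - j))"
    using assms cyl_subset_X[of ws] funpow_in \<kappa>_pos \<gamma>_gt_1
    by (intro divide_right_mono dist_le_diam) (auto intro: funpow_in)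
  finally show ?thesis .
qed

lemma inj_cyl:
  assumes "ws \<in> wds n" "x \<in> cyl ws" "y \<in> cyl ws" "(T ^^ n) x = (T ^^ n) y"
  shows "x = y"
  using dist_cyl_end[OF assms(1-3), of 0] assms(4) by simp

text \<open>The word of length n separates the preimages. Finiteness matters because sums over
  infinite sets are 0 by convention.\<close>

lemma finite_preimage: "finite {y \<in> X. (T ^^ n) y = x}"
proof -
  have "inj_on (word n) {y \<in> X. (T ^^ n) y = x}"
  proof (intro inj_onI)
    fix y z assume a: "y \<in> {y \<in> X. (T ^^ n) y = x}" "z \<in> {y \<in> X. (T ^^ n) y = x}" "word n y = word n z"
    then show "y = z"
      using inj_cyl[of "word n y" n y z] word_in in_cyl_iff[of "word n y" n] by auto
  qed
  moreover have "word n ` {y \<in> X. (T ^^ n) y = x} \<subseteq> wds n" using word_in by auto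
  ultimately show ?thesis using finite_wds by (metis finite_subset inj_on_finite)
qed

lemma finite_preimage1: "finite {y \<in> X. T y = x}"
  using finite_preimage[of 1 x] by simp

lemma kappa_gamma_large: "\<exists>N. \<forall>n\<ge>N. c < \<kappa> * \<gamma> ^ n"
proof -
  obtain N where N: "c / \<kappa> < \<gamma> ^ N" using \<gamma>_gt_1 real_arch_pow by blast
  show ?thesis
  proof (intro exI allI impI)
    fix n assume "N \<le> n"
    then have "\<gamma> ^ N \<le> \<gamma> ^ n" using \<gamma>_gt_1 by (intro power_increasing) auto
    then show "c < \<kappa> * \<gamma> ^ n" using N \<kappa>_pos by (simp add: field_simps) (smt (verit) mult_left_mono)
  qed
qed

text \<open>Expansivity: distinct points with equal letters for ever would be driven further apart
  than the diameter.\<close>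

lemma eq_if_all_letters:
  assumes "x \<in> X" "y \<in> X" "\<And>j. letter ((T ^^ j) x) = letter ((T ^^ j) y)"
  shows "x = y"
proof (rule ccontr)
  assume "x \<noteq> y"
  then have d: "0 < dist x y" by simp
  obtain N where N: "diam / dist x y < \<kappa> * \<gamma> ^ N" using kappa_gamma_large by blast
  have "dist x y \<le> dist ((T ^^ N) x) ((T ^^ N) y) / (\<kappa> * \<gamma> ^ N)" using dist_bound assms by blast
  also have "\<dots> \<le> diam / (\<kappa> * \<gamma> ^ N)"
    using assms funpow_in \<kappa>_pos \<gamma>_gt_1 by (intro divide_right_mono dist_le_diam) auto
  finally have "dist x y * (\<kappa> * \<gamma> ^ N) \<le> diam" using \<kappa>_pos \<gamma>_gt_1 by (simp add: field_simps)
  moreover have "diam < dist x y * (\<kappa> * \<gamma> ^ N)" using N d by (simp add: field_simps)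
  ultimately show False by simp
qed

text \<open>The cylinders of the initial segments are nonempty, compact and nested, so they have a
  common point.\<close>

lemma coding_exists:
  assumes "\<And>t. succ (s t) (s (Suc t))"
  shows "\<exists>x\<in>X. \<forall>t. letter ((T ^^ t) x) = s t"
proof -
  define ws where "ws n = map s [0..<n]" for n
  have lt: "s t < k" for t using assms succ_def by blast
  have a: "ws n \<in> wds n" for n using lt by (auto simp: ws_def wds_def)
  have "chain (ws n)" for n using assms by (auto simp: chain_def ws_def)
  then have ne: "cyl (ws n) \<noteq> {}" for n using cyl_nonempty a by blast
  have mem: "x \<in> cyl (ws n) \<longleftrightarrow> x \<in> X \<and> (\<forall>j<n. letter ((T ^^ j) x) = s j)" for x n
    using cyl_letters[OF a] by (auto simp: ws_def)
  have "X \<inter> (\<Inter>n. cyl (ws n)) \<noteq> {}"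
  proof (rule compact_imp_fip_image[OF compact_X])
    show "closed (cyl (ws n))" for n using compact_cyl[OF a] compact_imp_closed by blast
    fix I :: "nat set" assume "finite I"
    obtain x where "x \<in> cyl (ws (Max (insert 0 I)))" using ne by blast
    moreover have "n \<le> Max (insert 0 I)" if "n \<in> I" for n using that \<open>finite I\<close> by simp
    ultimately have "x \<in> X \<inter> (\<Inter>n\<in>I. cyl (ws n))" by (auto simp: mem intro: less_le_trans)
    then show "X \<inter> (\<Inter>n\<in>I. cyl (ws n)) \<noteq> {}" by blast
  qed
  then obtain x where "\<And>n. x \<in> cyl (ws n)" by auto
  then show ?thesis using mem by blast
qed

text \<open>The point is coded by the word repeated for ever. This code is unchanged by n shifts, so
  expansivity makes the point a fixed point of \<open>T ^^ n\<close>. The orbit ending in the first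
  piece is what allows the last letter to be followed by the first.\<close>

lemma fixed_point_in_cyl:
  assumes a: "ws \<in> wds n" "0 < n" and x: "x \<in> cyl ws" "(T ^^ n) x \<in> U (hd ws)"
  shows "\<exists>p\<in>cyl ws. (T ^^ n) p = p"
proof -
  define s where "s t = ws ! (t mod n)" for t
  have hd: "hd ws = ws ! 0" "last ws = ws ! (n - 1)"
    using a by (auto simp: wds_def hd_conv_nth last_conv_nth)
  have "succ (last ws) (hd ws)" using succ_last[OF a x] hd wds_nth[OF a(1)] a by simp
  have *: "succ (ws ! j) (ws ! Suc j)" if "Suc j < n" for j
    using chain_if_cyl[OF a(1) x(1)] that wds_length[OF a(1)] unfolding chain_def by blast
  have "succ (s t) (s (Suc t))" for t
  proof (cases "Suc (t mod n) = n")
    case True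
    then have "t mod n = n - 1" by simp
    then show ?thesis using \<open>succ (last ws) (hd ws)\<close> True hd by (simp add: s_def mod_Suc)
  next
    case False
    then have "Suc (t mod n) < n" using a(2) mod_less_divisor[of n t] by linarith
    then show ?thesis using * False by (simp add: s_def mod_Suc)
  qed
  then obtain p where p: "p \<in> X" "\<And>t. letter ((T ^^ t) p) = s t" using coding_exists by blast
  have "letter ((T ^^ t) ((T ^^ n) p)) = letter ((T ^^ t) p)" for t
    using p(2) by (simp add: s_def flip: funpow_add_apply)
  then have "(T ^^ n) p = p" using eq_if_all_letters p funpow_in by blast
  moreover have "p \<in> cyl ws" using p a cyl_letters s_def by auto
  ultimately show ?thesis by blast
qed

abbreviation bsum :: "nat \<Rightarrow> ('m \<Rightarrow> 'b::comm_monoid_add) \<Rightarrow> 'm \<Rightarrow> 'b" where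
  "bsum \<equiv> birkhoff_sum T"

lemma birkhoff_add:
  fixes h :: "'m \<Rightarrow> 'b::comm_monoid_add"
  shows "bsum (m + n) h x = bsum m h x + bsum n h ((T ^^ m) x)"
proof -
  have "(\<Sum>j<m + n. h ((T ^^ j) x)) = (\<Sum>j<m. h ((T ^^ j) x)) + (\<Sum>j\<in>{m..<m + n}. h ((T ^^ j) x))"
    by (subst sum.union_disjoint[symmetric]) (auto intro: sum.cong)
  also have "(\<Sum>j\<in>{m..<m + n}. h ((T ^^ j) x)) = (\<Sum>j<n. h ((T ^^ (m + j)) x))"
    by (rule sum.reindex_bij_witness[where i = "\<lambda>j. m + j" and j = "\<lambda>j. j - m"]) auto
  finally show ?thesis by (simp add: birkhoff_sum_def funpow_add_apply)
qed

end

section \<open>Entropy of invariant measures is uniformly bounded\<close>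

text \<open>Allows entropies to be summed over a fixed set of labels such as \<open>wds n\<close>,
  attained or not.\<close>

lemma partition_entropy_superset:
  assumes "finite A" "\<xi> ` space m \<subseteq> A"
  shows "partition_entropy m \<xi> = 
    (\<Sum>c\<in>A. - measure m (\<xi> -` {c} \<inter> space m) * ln (measure m (\<xi> -` {c} \<inter> space m)))"
  unfolding partition_entropy_def
proof (rule sum.mono_neutral_left[OF assms], intro ballI)
  fix c assume "c \<in> A - \<xi> ` space m"
  then have "\<xi> -` {c} \<inter> space m = {}" by auto
  then show "- measure m (\<xi> -` {c} \<inter> space m) * ln (measure m (\<xi> -` {c} \<inter> space m)) = 0" by simp
qed

context prob_space
begin

text \<open>The base e turns Shannon entropy into \<open>partition_entropy\<close>, which makes data
  processing and the chain rule available.\<close>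

lemma information_space_exp: "information_space M (exp 1)"
  by unfold_locales simp

lemma partition_entropy_eq:
  assumes "simple_function M \<xi>"
  shows "partition_entropy M \<xi> = entropy (exp 1) (count_space (\<xi> ` space M)) \<xi>"
  by (subst information_space.entropy_simple_distributed[OF information_space_exp
        simple_distributedI[OF assms measure_nonneg refl]])
     (simp add: partition_entropy_def sum_negf log_def)

lemma partition_entropy_comp:
  assumes "simple_function M \<xi>"
  shows "partition_entropy M (\<lambda>x. F (\<xi> x)) \<le> partition_entropy M \<xi>"
  using information_space.entropy_data_processing[OF information_space_exp assms, of F]
    partition_entropy_eq[OF assms] partition_entropy_eq[OF simple_function_compose[OF assms, of F]]
  by (simp add: comp_def)

lemma partition_entropy_pair:
  assumes "simple_function M \<xi>" "simple_function M \<zeta>"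
  shows "partition_entropy M (\<lambda>x. (\<xi> x, \<zeta> x)) \<le> partition_entropy M \<xi> + partition_entropy M \<zeta>"
  using information_space.entropy_chain_rule[OF information_space_exp assms]
    information_space.conditional_entropy_less_eq_entropy[OF information_space_exp assms(2,1)]
  by (simp add: partition_entropy_eq assms simple_function_Pair)

lemma partition_entropy_le_card:
  assumes "simple_function M \<xi>"
  shows "partition_entropy M \<xi> \<le> ln (real (card (\<xi> ` space M)))"
  using information_space.entropy_le_card[OF information_space_exp
        simple_distributedI[OF assms measure_nonneg refl]]
  by (simp add: partition_entropy_eq assms log_def)

end

text \<open>This bound tends to 0 with p and controls the small atoms of a nearly constant
  partition; the bound 1 - p of the next lemma controls its one large atom.\<close>

lemma neg_x_ln_x_le_sqrt:
  fixes p :: real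
  assumes "0 \<le> p"
  shows "- p * ln p \<le> 2 * sqrt p"
proof (cases "p = 0")
  case False
  then have p: "0 < p" using assms by simp
  have "- ln (sqrt p) = ln (1 / sqrt p)" using p by (simp add: ln_div)
  also have "\<dots> \<le> 1 / sqrt p - 1" using p by (intro ln_le_minus_one) simp
  finally have "- ln p \<le> 2 * (1 / sqrt p)" using p by (simp add: ln_sqrt)
  then have "p * (- ln p) \<le> p * (2 * (1 / sqrt p))" using p by (intro mult_left_mono) auto
  also have "\<dots> = 2 * (p / sqrt p)" by simp
  also have "\<dots> = 2 * sqrt p" using p by (simp only: real_div_sqrt)
  finally show ?thesis by simp
qed simp

lemma neg_x_ln_x_le_one_minus:
  fixes p :: real
  assumes "0 \<le> p"
  shows "- p * ln p \<le> 1 - p"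
proof (cases "p = 0")
  case False
  then have p: "0 < p" using assms by simp
  have "- ln p = ln (1 / p)" using p by (simp add: ln_div)
  also have "\<dots> \<le> 1 / p - 1" using p by (intro ln_le_minus_one) simp
  finally have "p * (- ln p) \<le> p * (1 / p - 1)" using p by (intro mult_left_mono) auto
  also have "\<dots> = 1 - p" using p by (simp add: right_diff_distrib)
  finally show ?thesis by simp
qed simp

section \<open>Itineraries under a measure-preserving map\<close>

locale invariant_prob = prob_space m for m :: "'m measure" +
  fixes T :: "'m \<Rightarrow> 'm"
  assumes T_meas: "T \<in> measurable m m" and T_inv: "distr m m T = m"
begin

lemma funpow_meas [measurable]: "(T ^^ n) \<in> measurable m m"
proof (induction n)
  case (Suc n)
  then show ?case using T_meas by (simp add: measurable_comp)
qed (simp add: id_def)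

lemma distr_funpow: "distr m m (T ^^ n) = m"
proof (induction n)
  case (Suc n)
  have "distr m m (T ^^ Suc n) = distr (distr m m (T ^^ n)) m T"
    by (subst distr_distr) (auto simp: T_meas)
  then show ?case unfolding Suc T_inv .
qed (simp add: id_def)

lemma measure_funpow:
  assumes "B \<in> sets m"
  shows "measure m ((T ^^ n) -` B \<inter> space m) = measure m B"
  using measure_distr[OF funpow_meas assms, of n] by (simp add: distr_funpow)

lemma partition_entropy_funpow:
  assumes "simple_function m \<xi>"
  shows "partition_entropy m (\<lambda>x. \<xi> ((T ^^ n) x)) = partition_entropy m \<xi>"
proof -
  have f: "finite (\<xi> ` space m)" using assms by (simp add: simple_function_def)
  \<comment> \<open>The map need not be onto, so the shifted labelling may attain fewer values; both
    entropies are summed over the values of \<xi>.\<close>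
  have i: "(\<lambda>x. \<xi> ((T ^^ n) x)) ` space m \<subseteq> \<xi> ` space m"
    using measurable_space[OF funpow_meas] by blast
  have "measure m ((\<lambda>x. \<xi> ((T ^^ n) x)) -` {c} \<inter> space m) = measure m (\<xi> -` {c} \<inter> space m)" for c
  proof -
    have "(\<lambda>x. \<xi> ((T ^^ n) x)) -` {c} \<inter> space m = (T ^^ n) -` (\<xi> -` {c} \<inter> space m) \<inter> space m"
      using measurable_space[OF funpow_meas] by auto
    then show ?thesis using measure_funpow[OF simple_functionD(2)[OF assms, of "{c}"], of n] by simp
  qed
  then show ?thesis
    by (simp add: partition_entropy_superset[OF f i] partition_entropy_superset[OF f order.refl])
qed

lemma simple_funpow:
  assumes "simple_function m \<xi>"
  shows "simple_function m (\<lambda>x. \<xi> ((T ^^ n) x))"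
proof -
  have "\<xi> \<in> measurable m (count_space UNIV)" using assms measurable_simple_function by blast
  then have "(\<lambda>x. \<xi> ((T ^^ n) x)) \<in> measurable m (count_space UNIV)"
    by (rule measurable_compose[OF funpow_meas])
  moreover have "(\<lambda>x. \<xi> ((T ^^ n) x)) ` space m \<subseteq> \<xi> ` space m"
    using measurable_space[OF funpow_meas] by blast
  then have "finite ((\<lambda>x. \<xi> ((T ^^ n) x)) ` space m)"
    using simple_functionD(1)[OF assms] finite_subset by blast
  ultimately show ?thesis by (simp add: simple_function_def measurable_def)
qed

lemma simple_itinerary:
  assumes "simple_function m \<xi>"
  shows "simple_function m (itinerary T \<xi> n)"
proof (induction n)
  case (Suc n)
  from simple_function_compose2[OF Suc simple_funpow[OF assms, of n], of "\<lambda>l y. l @ [y]"]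
  show ?case by (simp add: itinerary_def[abs_def])
qed (simp add: itinerary_def[abs_def])

text \<open>Subadditivity of entropy; by invariance each further entry costs at most the entropy of
  \<xi>.\<close>

lemma partition_entropy_itinerary_le:
  assumes "simple_function m \<xi>"
  shows "partition_entropy m (itinerary T \<xi> n) \<le> real n * partition_entropy m \<xi>"
proof (induction n)
  case 0
  have "itinerary T \<xi> 0 = (\<lambda>x. [])" by (simp add: itinerary_def fun_eq_iff)
  moreover have "(\<lambda>x. [] :: nat list) ` space m = {[]}" using not_empty by auto
  ultimately show ?case by (simp add: partition_entropy_def prob_space)
next
  case (Suc n)
  note s = simple_funpow[OF assms, of n]
  have "itinerary T \<xi> (Suc n) = (\<lambda>x. (\<lambda>(l, y). l @ [y]) (itinerary T \<xi> n x, \<xi> ((T ^^ n) x)))"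
    by (auto simp: itinerary_def)
  then have "partition_entropy m (itinerary T \<xi> (Suc n)) 
    \<le> partition_entropy m (\<lambda>x. (itinerary T \<xi> n x, \<xi> ((T ^^ n) x)))"
    using partition_entropy_comp[OF simple_function_Pair[OF simple_itinerary[OF assms] s],
        of "\<lambda>(l, y). l @ [y]" n] by simp
  also have "\<dots> \<le> partition_entropy m (itinerary T \<xi> n) + partition_entropy m \<xi>"
    using partition_entropy_pair[OF simple_itinerary[OF assms] s]
    by (simp add: partition_entropy_funpow assms)
  finally show ?case using Suc by (simp add: algebra_simps)
qed

end

section \<open>Measurability of letters and words\<close>

context markov_map
begin

lemma shift_measurable: 
  assumes "sets m = sets (restrict_space borel X)"
  shows "T \<in> measurable m m"
proof -
  have "T \<in> borel_measurable (restrict_space borel X)"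
    by (intro borel_measurable_continuous_on_restrict continuous_shift_X)
  then have "T \<in> measurable (restrict_space borel X) (restrict_space borel X)"
    by (intro measurable_restrict_space2) (auto simp: space_restrict_space intro: shift_in)
  then show ?thesis using measurable_cong_sets[OF assms assms] by simp
qed

lemma space_eq_X: "sets m = sets (restrict_space borel X) \<Longrightarrow> space m = X"
  using sets_eq_imp_space_eq[of m "restrict_space borel X"] by (simp add: space_restrict_space)

lemma letter_measurable:
  assumes "sets m = sets (restrict_space borel X)"
  shows "letter \<in> measurable m (count_space UNIV)"
proof -
  have sp: "space m = X" using assms space_eq_X by blast
  have c: "closed (U i)" if "i < k" for i using compact_Us that compact_imp_closed by blast
  have "letter -` A \<inter> X \<in> sets m" for A
  proof -
    have "letter -` A \<inter> X = (\<Union>i\<in>A \<inter> {..<k}. X \<inter> U i)"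
      using letter_less in_U_letter in_U_iff by auto
    moreover have "X \<inter> U i \<in> sets m" if "i < k" for i
      unfolding assms sets_restrict_space using c[OF that] by auto
    then have "(\<Union>i\<in>A \<inter> {..<k}. X \<inter> U i) \<in> sets m" by (intro sets.finite_UN) auto
    ultimately show ?thesis by simp
  qed
  then show ?thesis using sp by (simp add: measurable_def)
qed

lemma word_eq_itinerary: "word n = itinerary T letter n"
  by (simp add: word_def itinerary_def fun_eq_iff)

lemma take_word: "n \<le> N \<Longrightarrow> take n (word N x) = word n x"
  by (simp add: word_def take_map)

lemma word_shift: "j + n \<le> N \<Longrightarrow> take n (drop j (word N x)) = word n ((T ^^ j) x)"
  by (rule nth_equalityI) (auto simp: word_def simp flip: funpow_add_apply)

end

section \<open>A bound on the entropy of every invariant measure\<close>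

locale markov_measure = markov_map Q \<kappa> \<gamma> for Q :: "'m::metric_space rectangles" and \<kappa> \<gamma> +
  fixes m :: "'m measure"
  assumes m: "m \<in> invariant_measures X T"
begin

lemma sets_m: "sets m = sets (restrict_space borel X)"
  using m by (simp add: invariant_measures_def)

lemma space_m: "space m = X"
  using space_eq_X[OF sets_m] .

sublocale invariant_prob m T
  using m unfolding invariant_measures_def invariant_prob_def invariant_prob_axioms_def by auto

lemma simple_letter: "simple_function m letter"
  unfolding simple_function_def
proof
  show "finite (letter ` space m)"
    using letter_less by (intro finite_subset[of "letter ` space m" "{..<k}"]) (auto simp: space_m)
  show "\<forall>x\<in>letter ` space m. letter -` {x} \<inter> space m \<in> sets m"
    using letter_measurable[OF sets_m] by (auto simp: measurable_def)
qed

lemma simple_word: "simple_function m (word n)"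
  unfolding word_eq_itinerary by (rule simple_itinerary[OF simple_letter])

lemma word_meas [measurable]: "word n \<in> measurable m (count_space UNIV)"
  using measurable_simple_function[OF simple_word] .

abbreviation err :: "'m set \<Rightarrow> nat \<Rightarrow> nat list set \<Rightarrow> 'm set" where
  "err B n W \<equiv> {x \<in> X. (x \<in> B) \<noteq> (word n x \<in> W)}"

text \<open>Expresses that the letters generate the Borel sets up to small measure: B nearly
  coincides with a union of cylinders of one length.\<close>

definition approximable :: "'m set \<Rightarrow> bool" where
  "approximable B \<longleftrightarrow> (\<forall>e>0. \<exists>n W. measure m (err B n W) < e)"

lemma borel_Int_X: "B \<in> sets borel \<Longrightarrow> X \<inter> B \<in> sets m"
  unfolding sets_m sets_restrict_space by auto

lemma word_set: "{x \<in> X. word n x \<in> W} \<in> sets m"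
  using measurable_sets[OF word_meas, of W n] by (simp add: space_m vimage_def Int_def conj_commute)

text \<open>Cylinders shrink to points, so the cylinders of length n inside an open set exhaust it
  as n grows, and continuity of the measure leaves a small remainder.\<close>

lemma approximable_open:
  assumes "open S"
  shows "approximable S"
  unfolding approximable_def
proof (intro allI impI)
  fix e :: real assume e: "0 < e"
  define W where "W n = {ws \<in> wds n. cyl ws \<subseteq> S}" for n
  define A where "A n = {x \<in> X. word n x \<in> W n}" for n
  have A: "x \<in> A n \<longleftrightarrow> x \<in> X \<and> cyl (word n x) \<subseteq> S" for x n
    using word_in by (auto simp: A_def W_def)
  have sub: "cyl (word N x) \<subseteq> cyl (word n x)" if "n \<le> N" "x \<in> X" for n N x
    using in_cyl_iff[OF word_in[OF that(2)]] take_word[OF that(1)] by (metis subsetI)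
  have "incseq A"
  proof (intro incseq_SucI subsetI)
    fix n x assume "x \<in> A n"
    then show "x \<in> A (Suc n)" using A[of x n] A[of x "Suc n"] sub[of n "Suc n" x] by auto
  qed
  moreover have "X \<inter> S = (\<Union>n. A n)"
  proof (intro equalityI subsetI)
    fix x assume "x \<in> (\<Union>n. A n)"
    then show "x \<in> X \<inter> S" using A in_cyl_iff[OF word_in] by blast
  next
    fix x assume x: "x \<in> X \<inter> S"
    then obtain r where r: "r > 0" "\<And>y. dist y x < r \<Longrightarrow> y \<in> S" 
      using assms by (auto simp: open_dist)
    obtain N where N: "diam / r < \<kappa> * \<gamma> ^ N" using kappa_gamma_large by blast
    have "cyl (word (Suc N) x) \<subseteq> S"
    proof
      fix y assume y: "y \<in> cyl (word (Suc N) x)"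
      have "x \<in> cyl (word (Suc N) x)" using x in_cyl_iff[OF word_in] by blast
      then have "dist y x \<le> diam / (\<kappa> * \<gamma> ^ N)"
        using dist_cyl[OF word_in[of x "Suc N"], of y x 0] x y by auto
      also have "\<dots> < r" using N r \<kappa>_pos \<gamma>_gt_1 by (simp add: field_simps)
      finally show "y \<in> S" using r by blast
    qed
    then show "x \<in> (\<Union>n. A n)" using A x by blast
  qed
  moreover have "range A \<subseteq> sets m" using word_set by (auto simp: A_def)
  ultimately have "(\<lambda>n. measure m (A n)) \<longlonglongrightarrow> measure m (X \<inter> S)"
    using finite_Lim_measure_incseq[of A] by simp
  then have "eventually (\<lambda>n. measure m (X \<inter> S) - e < measure m (A n)) sequentially"
    using e by (intro order_tendstoD) auto
  then obtain n where n: "measure m (X \<inter> S) - e < measure m (A n)"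
    by (auto simp: eventually_sequentially)
  have "{x \<in> X. (x \<in> S) \<noteq> (word n x \<in> W n)} = X \<inter> S - A n"
  proof -
    have "A n \<subseteq> X \<inter> S" using \<open>X \<inter> S = (\<Union>n. A n)\<close> by blast
    then show ?thesis by (auto simp: A_def)
  qed
  moreover have "measure m (X \<inter> S - A n) = measure m (X \<inter> S) - measure m (A n)"
    using assms \<open>range A \<subseteq> sets m\<close> \<open>X \<inter> S = (\<Union>n. A n)\<close>
    by (intro finite_measure_Diff borel_Int_X) auto
  ultimately show "\<exists>n W. measure m (err S n W) < e"
    using n by (intro exI[of _ n] exI[of _ "W n"]) simp
qed

lemma approximable_error_set:
  assumes "B \<in> sets borel"
  shows "(err B n W) \<in> sets m"
proof -
  have "(err B n W) = 
    (X \<inter> B - {x \<in> X. word n x \<in> W}) \<union> ({x \<in> X. word n x \<in> W} - X \<inter> B)" by auto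
  then show ?thesis using borel_Int_X[OF assms] word_set by auto
qed

text \<open>Approximability passes to complements and countable unions, hence from the open sets to
  the \<sigma>-algebra that they generate.\<close>

lemma approximable_borel:
  assumes "B \<in> sets borel"
  shows "approximable B"
proof -
  have eq: "sets borel = sigma_sets (UNIV :: 'm set) {S. open S}"
    by (simp add: borel_def)
  have "B \<in> sigma_sets UNIV {S. open S}" using assms eq by simp
  then show ?thesis
  proof induction
    case (Basic S)
    then show ?case using approximable_open by simp
  next
    case Empty
    show ?case using approximable_open by simp
  next
    case (Compl B)
    show ?case unfolding approximable_def
    proof (intro allI impI)
      fix e :: real assume "0 < e"
      then obtain n W where "measure m (err B n W) < e"
        using Compl approximable_def by blast
      moreover have "(err (UNIV - B) n (- W)) = (err B n W)"
        by auto
      ultimately show "\<exists>n W. measure m (err (UNIV - B) n W) < e"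
        by (intro exI[of _ n] exI[of _ "- W"]) simp
    qed
  next
    case (Union B)
    have Bm: "B i \<in> sets borel" for i using Union(1) eq by simp
    show ?case unfolding approximable_def
    proof (intro allI impI)
      fix e :: real assume e: "0 < e"
      define A where "A n = X \<inter> (\<Union>i<n. B i)" for n
      have Am: "A n \<in> sets m" for n unfolding A_def using Bm by (intro borel_Int_X) auto
      have "incseq A" by (force simp: incseq_def A_def)
      then have "(\<lambda>n. measure m (A n)) \<longlonglongrightarrow> measure m (\<Union>n. A n)"
        using Am by (intro finite_Lim_measure_incseq) auto
      then have "eventually (\<lambda>n. measure m (\<Union>n. A n) - e / 2 < measure m (A n)) sequentially"
        using e by (intro order_tendstoD) auto
      then obtain N where N: "measure m (\<Union>n. A n) - e / 2 < measure m (A N)"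
        by (auto simp: eventually_sequentially)
      have UA: "(\<Union>n. A n) = X \<inter> (\<Union>i. B i)" unfolding A_def by auto
      have tail: "measure m ((\<Union>n. A n) - A N) < e / 2"
        using N Am by (subst finite_measure_Diff) auto
      \<comment> \<open>Half of e is reserved for the tail of the union, the other half is shared by
        the N approximations; N + 1 avoids division by 0.\<close>
      have "0 < e / (2 * real (N + 1))" using e by simp
      then have "\<forall>i. \<exists>n W. measure m (err (B i) n W) < e / (2 * real (N + 1))"
        using Union.IH unfolding approximable_def by blast
      then obtain n where "\<forall>i. \<exists>W. measure m (err (B i) (n i) W) < e / (2 * real (N + 1))"
        using choice[of "\<lambda>i n. \<exists>W. measure m (err (B i) n W) < e / (2 * real (N + 1))"]
        by blast
      from choice[OF this] obtain W where
        nW: "\<And>i. measure m (err (B i) (n i) (W i)) < e / (2 * real (N + 1))"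
        by blast
      define E where "E i = (err (B i) (n i) (W i))" for i
      \<comment> \<open>A common length for all approximations, whose shorter words are read off as
        prefixes. The sum is a convenient upper bound.\<close>
      define n0 where "n0 = (\<Sum>i<N. n i)"
      have n0: "n i \<le> n0" if "i < N" for i
        unfolding n0_def using that by (intro member_le_sum) auto
      define V where "V = {ws. \<exists>i<N. take (n i) ws \<in> W i}"
      have Em: "E i \<in> sets m" for i unfolding E_def using approximable_error_set Bm by blast
      have "(err (\<Union>i. B i) n0 V) \<subseteq> ((\<Union>n. A n) - A N) \<union> (\<Union>i<N. E i)"
        unfolding UA
        using take_word n0 by (auto simp: A_def E_def V_def)
      then have "measure m (err (\<Union>i. B i) n0 V) 
        \<le> measure m (((\<Union>n. A n) - A N) \<union> (\<Union>i<N. E i))"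
        using Am Em by (intro finite_measure_mono) auto
      also have "\<dots> \<le> measure m ((\<Union>n. A n) - A N) + measure m (\<Union>i<N. E i)"
        using Am Em by (intro measure_Un_le) auto
      also have "measure m (\<Union>i<N. E i) \<le> (\<Sum>i<N. measure m (E i))"
        using Em by (intro finite_measure_subadditive_finite) auto
      also have "(\<Sum>i<N. measure m (E i)) \<le> (\<Sum>i<N. e / (2 * real (N + 1)))"
        using nW unfolding E_def by (intro sum_mono less_imp_le)
      also have "\<dots> \<le> e / 2" using e by (simp add: field_simps)
      finally have "measure m (err (\<Union>i. B i) n0 V) < e" using tail by simp
      then show "\<exists>n W. measure m (err (\<Union>i. B i) n W) < e" by blast
    qed
  qed
qed

lemma approximate_simple:
  fixes \<xi> :: "'m \<Rightarrow> nat"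
  assumes \<xi>: "simple_function m \<xi>" and e: "0 < e"
  shows "\<exists>n F. measure m {x \<in> X. \<xi> x \<noteq> F (word n x)} < e"
proof -
  define R where "R = \<xi> ` X"
  have R: "finite R" using simple_functionD(1)[OF \<xi>] by (simp add: R_def space_m)
  have "\<exists>B. B \<in> sets borel \<and> X \<inter> B = \<xi> -` {c} \<inter> X" for c
    using simple_functionD(2)[OF \<xi>, of "{c}"] by (auto simp: sets_m sets_restrict_space space_m)
  then obtain B where B: "\<And>c. B c \<in> sets borel" "\<And>c. X \<inter> B c = \<xi> -` {c} \<inter> X"
    by metis
  have B': "x \<in> B c \<longleftrightarrow> \<xi> x = c" if "x \<in> X" for x c using B(2)[of c] that by blast
  define e' where "e' = e / (real (card R) + 1)"
  have "0 < e'" using e by (simp add: e'_def add_nonneg_pos)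
  then have "\<forall>c. \<exists>n W. measure m (err (B c) n W) < e'"
    using approximable_borel B unfolding approximable_def by blast
  then obtain n W where nW: "\<And>c. measure m (err (B c) (n c) (W c)) < e'"
    by metis
  define E where "E c = (err (B c) (n c) (W c))" for c
  have Em: "E c \<in> sets m" for c unfolding E_def using approximable_error_set B by blast
  define n0 where "n0 = (\<Sum>c\<in>R. n c)"
  have n0: "n c \<le> n0" if "c \<in> R" for c
    unfolding n0_def using that R by (intro member_le_sum) auto
  \<comment> \<open>Off the error sets exactly one value passes its test, namely that of \<xi>;
    elsewhere F is arbitrary.\<close>
  define F where "F ws = (THE c. c \<in> R \<and> take (n c) ws \<in> W c)" for ws
  have "\<xi> x = F (word n0 x)" if "x \<in> X" "\<forall>c\<in>R. x \<notin> E c" for x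
  proof -
    have "take (n c) (word n0 x) \<in> W c \<longleftrightarrow> \<xi> x = c" if "c \<in> R" for c
      using that \<open>\<forall>c\<in>R. x \<notin> E c\<close> B'[OF \<open>x \<in> X\<close>] take_word[OF n0[OF that]] \<open>x \<in> X\<close> by (auto simp: E_def)
    moreover have "\<xi> x \<in> R" using that by (simp add: R_def)
    ultimately show ?thesis unfolding F_def by (intro the_equality[symmetric]) auto
  qed
  then have "{x \<in> X. \<xi> x \<noteq> F (word n0 x)} \<subseteq> (\<Union>c\<in>R. E c)" by blast
  then have "measure m {x \<in> X. \<xi> x \<noteq> F (word n0 x)} \<le> measure m (\<Union>c\<in>R. E c)"
    using Em R by (intro finite_measure_mono) auto
  also have "\<dots> \<le> (\<Sum>c\<in>R. measure m (E c))"
    using Em R by (intro finite_measure_subadditive_finite) auto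
  also have "\<dots> \<le> (\<Sum>c\<in>R. e')"
    using nW unfolding E_def by (intro sum_mono less_imp_le)
  also have "\<dots> < e" using e by (simp add: e'_def field_simps)
  finally show ?thesis by blast
qed

text \<open>With q = 1 / (4 (card A + 1)), each label in A has measure at most q^2 and so costs at
  most 2 q, together at most 1/2; the label 0 costs at most 1/4. The threshold is a square because
  of the square root bound.\<close>

lemma partition_entropy_nearly_constant:
  fixes \<eta> :: "'m \<Rightarrow> nat"
  assumes \<eta>: "simple_function m \<eta>" and A: "finite A" "\<eta> ` X \<subseteq> insert 0 A" "0 \<notin> A"
    and p: "measure m {x \<in> X. \<eta> x \<noteq> 0} < (1 / (4 * (real (card A) + 1)))\<^sup>2"
  shows "partition_entropy m \<eta> \<le> 1"
proof -
  define q where "q = 1 / (4 * (real (card A) + 1))"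
  have q: "0 < q" "q \<le> 1 / 4" by (auto simp: q_def field_simps)
  let ?p = "\<lambda>c. measure m (\<eta> -` {c} \<inter> space m)"
  have sing: "\<eta> -` {c} \<inter> space m \<in> sets m" for c using simple_functionD(2)[OF \<eta>] by blast
  have err: "{x \<in> X. \<eta> x \<noteq> 0} = space m - (\<eta> -` {0} \<inter> space m)" by (auto simp: space_m)
  have "?p c \<le> q\<^sup>2" if "c \<in> A" for c
  proof -
    have "?p c \<le> measure m {x \<in> X. \<eta> x \<noteq> 0}"
    proof (rule finite_measure_mono)
      show "\<eta> -` {c} \<inter> space m \<subseteq> {x \<in> X. \<eta> x \<noteq> 0}"
        using that A(3) by (auto simp: space_m intro!: gr0I)
      show "{x \<in> X. \<eta> x \<noteq> 0} \<in> sets m" unfolding err using sing[of 0] by auto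
    qed
    then show ?thesis using p by (simp add: q_def)
  qed
  then have "sqrt (?p c) \<le> q" if "c \<in> A" for c
    using that q(1) by (intro real_le_lsqrt) auto
  then have s: "- ?p c * ln (?p c) \<le> 2 * q" if "c \<in> A" for c
    using that neg_x_ln_x_le_sqrt[of "?p c"] by fastforce
  have "1 - ?p 0 < q\<^sup>2"
    using p prob_compl[OF sing[of 0]] unfolding err q_def by simp
  moreover have "q\<^sup>2 \<le> q * 1" unfolding power2_eq_square using q by (intro mult_left_mono) auto
  ultimately have z: "- ?p 0 * ln (?p 0) \<le> 1 / 4"
    using neg_x_ln_x_le_one_minus[of "?p 0"] q by fastforce
  have "partition_entropy m \<eta> = (\<Sum>c\<in>insert 0 A. - ?p c * ln (?p c))"
    using A by (intro partition_entropy_superset) (auto simp: space_m)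
  also have "\<dots> = - ?p 0 * ln (?p 0) + (\<Sum>c\<in>A. - ?p c * ln (?p c))"
    using A by simp
  also have "\<dots> \<le> 1 / 4 + (\<Sum>c\<in>A. 2 * q)"
    using z s by (intro add_mono sum_mono) auto
  also have "(\<Sum>c\<in>A. 2 * q) \<le> 1 / 2" by (simp add: q_def field_simps)
  finally show ?thesis by simp
qed

text \<open>
  Up to a small error set, \<open>\<xi>\<close> is a function of the first \<open>N\<close> letters. The map \<open>\<eta>\<close> records \<open>\<xi>\<close> on the error
  set and is \<open>0\<close> elsewhere, so that the itinerary of \<open>\<xi>\<close> is a function of a word and of the itinerary
  of \<open>\<eta>\<close>. A bound independent of \<open>\<xi>\<close> is indispensable: an infinite supremum in \<^const>\<open>pressure\<close>
  would be turned into \<open>0\<close> by \<^const>\<open>real_of_ereal\<close>.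
\<close>

lemma partition_entropy_linear_bound:
  fixes \<xi> :: "'m \<Rightarrow> nat"
  assumes \<xi>: "simple_function m \<xi>"
  shows "\<exists>N. \<forall>n. partition_entropy m (itinerary T \<xi> n) \<le> real (n + N) * ln k + real n"
proof -
  \<comment> \<open>Values are shifted by one so that 0 can stand for a correct guess.\<close>
  define A where "A = Suc ` \<xi> ` X"
  have A: "finite A" "0 \<notin> A" using simple_functionD(1)[OF \<xi>] by (auto simp: A_def space_m)
  obtain N F where NF: "measure m {x \<in> X. \<xi> x \<noteq> F (word N x)} < (1 / (4 * (real (card A) + 1)))\<^sup>2"
    using approximate_simple[OF \<xi>, of "(1 / (4 * (real (card A) + 1)))\<^sup>2"] by (auto simp: add_nonneg_eq_0_iff)
  define \<eta> where "\<eta> x = (if \<xi> x = F (word N x) then 0 else Suc (\<xi> x))" for x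
  have \<eta>: "simple_function m \<eta>"
    using simple_function_compose2[OF \<xi> simple_word[of N], of "\<lambda>a b. if a = F b then 0 else Suc a"]
    by (simp add: \<eta>_def[abs_def])
  have "{x \<in> X. \<eta> x \<noteq> 0} = {x \<in> X. \<xi> x \<noteq> F (word N x)}" by (auto simp: \<eta>_def)
  then have \<eta>1: "partition_entropy m \<eta> \<le> 1"
    using NF A by (intro partition_entropy_nearly_constant[OF \<eta>]) (auto simp: A_def \<eta>_def)
  show ?thesis
  proof (intro exI allI)
    fix n
    \<comment> \<open>The guess at time j < n reads N letters from position j on, so n + N letters
      suffice; where \<eta> is nonzero, the recorded value replaces the guess.\<close>
    define G where "G = (\<lambda>(w, l). map (\<lambda>j. if l ! j = (0::nat) then F (take N (drop j w)) else l ! j - 1) [0..<n])"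
    have "itinerary T \<xi> n = (\<lambda>x. G (word (n + N) x, itinerary T \<eta> n x))"
      by (auto simp: G_def itinerary_def word_shift \<eta>_def fun_eq_iff)
    then have "partition_entropy m (itinerary T \<xi> n) 
      \<le> partition_entropy m (\<lambda>x. (word (n + N) x, itinerary T \<eta> n x))"
      using partition_entropy_comp[OF simple_function_Pair[OF simple_word[of "n + N"] simple_itinerary[OF \<eta>, of n]], of G]
      by simp
    also have "\<dots> \<le> partition_entropy m (word (n + N)) + partition_entropy m (itinerary T \<eta> n)"
      by (rule partition_entropy_pair[OF simple_word simple_itinerary[OF \<eta>]])
    also have "partition_entropy m (word (n + N)) \<le> ln (card (word (n + N) ` space m))"
      by (rule partition_entropy_le_card[OF simple_word])
    also have "\<dots> \<le> ln (real (k ^ (n + N)))"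
    proof -
      have "card (word (n + N) ` space m) \<le> card (wds (n + N))"
        using word_in by (intro card_mono) (auto simp: space_m)
      moreover have "0 < card (word (n + N) ` space m)"
        using simple_functionD(1)[OF simple_word] not_empty by (simp add: card_gt_0_iff)
      ultimately show ?thesis unfolding card_wds by (subst ln_le_cancel_iff) (auto simp: num_pos simp flip: of_nat_power)
    qed
    also have "\<dots> = real (n + N) * ln k" using num_pos by (simp add: ln_realpow)
    also have "partition_entropy m (itinerary T \<eta> n) \<le> real n * partition_entropy m \<eta>"
      by (rule partition_entropy_itinerary_le[OF \<eta>])
    also have "\<dots> \<le> real n * 1" using \<eta>1 by (intro mult_left_mono) auto
    finally show "partition_entropy m (itinerary T \<xi> n) \<le> real (n + N) * ln k + real n" by simp
  qed
qed

text \<open>The length N of the approximating words depends on \<xi>, but disappears on division by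
  n. What remains, ln k for the letters and 1 for the corrections, depends neither on \<xi> nor on
  m.\<close>

lemma metric_entropy_le: "metric_entropy T m \<le> ereal (ln k + 1)"
  unfolding metric_entropy_def
proof (intro SUP_least)
  fix \<xi> :: "'m \<Rightarrow> nat" assume "\<xi> \<in> {\<xi>. \<xi> \<in> measurable m (count_space UNIV) \<and> finite (\<xi> ` space m)}"
  then have "simple_function m \<xi>" by (simp add: simple_function_def measurable_def)
  then obtain N where N: "\<And>n. partition_entropy m (itinerary T \<xi> n) \<le> real (n + N) * ln k + real n"
    using partition_entropy_linear_bound by blast
  have "((\<lambda>n. ln (real k) + 1 + real N * ln k * (1 / real n)) \<longlongrightarrow> ln (real k) + 1 + real N * ln k * 0) sequentially"
    by (intro tendsto_intros lim_1_over_n)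
  then have lim: "((\<lambda>n. ereal (ln (real k) + 1 + real N * ln k * (1 / real n))) \<longlongrightarrow> ereal (ln (real k) + 1)) sequentially"
    by simp
  have "limsup (\<lambda>n. ereal (partition_entropy m (itinerary T \<xi> n) / real n)) 
    \<le> limsup (\<lambda>n. ereal (ln (real k) + 1 + real N * ln k * (1 / real n)))"
  proof (intro Limsup_mono eventually_mono[OF eventually_gt_at_top[of 0]])
    fix n :: nat assume "0 < n"
    then show "ereal (partition_entropy m (itinerary T \<xi> n) / real n) \<le> ereal (ln (real k) + 1 + real N * ln k * (1 / real n))"
      using N[of n] by (simp add: field_simps)
  qed
  also have "\<dots> = ereal (ln (real k) + 1)"
    using lim by (intro lim_imp_Limsup) auto
  finally show "limsup (\<lambda>n. ereal (partition_entropy m (itinerary T \<xi> n) / real n)) \<le> ereal (ln k + 1)" .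
qed

end

section \<open>Points determined by symbol sequences\<close>

context markov_map
begin

definition pt :: "nat list \<Rightarrow> 'm" where
  "pt ws = (SOME x. x \<in> cyl ws)"

lemma pt_in: "cyl ws \<noteq> {} \<Longrightarrow> pt ws \<in> cyl ws"
  unfolding pt_def by (rule some_in_eq[THEN iffD2])

definition code :: "(nat \<Rightarrow> nat) \<Rightarrow> 'm" where
  "code s = (SOME x. x \<in> X \<and> (\<forall>t. letter ((T ^^ t) x) = s t))"

lemma letter_code:
  assumes "\<And>t. succ (s t) (s (Suc t))"
  shows "code s \<in> X" "letter ((T ^^ t) (code s)) = s t"
proof -
  have "\<exists>x. x \<in> X \<and> (\<forall>t. letter ((T ^^ t) x) = s t)"
    using coding_exists[of s] assms by blast
  from someI_ex[OF this] show "code s \<in> X" "letter ((T ^^ t) (code s)) = s t"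
    unfolding code_def by auto
qed

text \<open>A point is the limit of functions of finitely many of its letters; this is how the
  coding map is seen to be measurable.\<close>

lemma pt_word_tendsto:
  assumes "x \<in> X"
  shows "(\<lambda>n. pt (word n x)) \<longlonglongrightarrow> x"
proof (rule metric_LIMSEQ_I)
  fix r :: real assume r: "0 < r"
  obtain N where N: "\<And>n. n \<ge> N \<Longrightarrow> diam / r < \<kappa> * \<gamma> ^ n" using kappa_gamma_large by blast
  show "\<exists>no. \<forall>n\<ge>no. dist (pt (word n x)) x < r"
  proof (intro exI allI impI)
    fix n assume "Suc N \<le> n"
    then obtain n' where n: "n = Suc n'" "N \<le> n'" by (cases n) auto
    have x: "x \<in> cyl (word n x)" using assms in_cyl_iff[OF word_in] by blast
    then have "pt (word n x) \<in> cyl (word n x)" using pt_in by blast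
    then have "dist (pt (word n x)) x \<le> diam / (\<kappa> * \<gamma> ^ n')"
      using dist_cyl[of "word n x" n' "pt (word n x)" x 0] word_in[OF assms] x n by auto
    also have "\<dots> < r" using N[OF n(2)] r \<kappa>_pos \<gamma>_gt_1 by (simp add: field_simps)
    finally show "dist (pt (word n x)) x < r" .
  qed
qed

end

section \<open>Bernoulli measures on loops\<close>

text \<open>The entropy of n independent draws is n times that of one. Both facts are proved
  together because the induction step for the entropy uses the total mass.\<close>

lemma sum_lists_prod_list:
  fixes p :: "'a \<Rightarrow> real"
  assumes L: "finite L" and p: "\<And>a. a \<in> L \<Longrightarrow> 0 \<le> p a" "(\<Sum>a\<in>L. p a) = 1"
  shows "(\<Sum>l | set l \<subseteq> L \<and> length l = n. prod_list (map p l)) = 1"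
    and "(\<Sum>l | set l \<subseteq> L \<and> length l = n. - prod_list (map p l) * ln (prod_list (map p l)))
      = real n * (\<Sum>a\<in>L. - p a * ln (p a))"
proof (induction n)
  case 0
  have e: "{l. set l \<subseteq> L \<and> length l = 0} = {[]}" by auto
  case 1 show ?case unfolding e by simp
  case 2 show ?case unfolding e by simp
next
  case (Suc n)
  let ?S = "\<lambda>n. {l. set l \<subseteq> L \<and> length l = n}"
  have S: "(\<Sum>l\<in>?S (Suc n). F l) = (\<Sum>a\<in>L. \<Sum>l\<in>?S n. F (a # l))" for F :: "'a list \<Rightarrow> real"
  proof -
    have "?S (Suc n) = (\<lambda>(a, l). a # l) ` (L \<times> ?S n)"
    proof (intro equalityI subsetI)
      fix l assume "l \<in> ?S (Suc n)"
      then obtain a l' where "l = a # l'" "a \<in> L" "l' \<in> ?S n" by (cases l) auto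
      then show "l \<in> (\<lambda>(a, l). a # l) ` (L \<times> ?S n)" by (intro image_eqI[of _ _ "(a, l')"]) auto
    qed auto
    then have "(\<Sum>l\<in>?S (Suc n). F l) = (\<Sum>q\<in>L \<times> ?S n. F (fst q # snd q))"
      by (simp only:, subst sum.reindex) (auto simp: inj_on_def case_prod_unfold)
    then show ?thesis by (simp add: sum.cartesian_product case_prod_unfold)
  qed
  have q: "0 \<le> prod_list (map p l)" if "l \<in> ?S n" for l
    using that p(1) by (intro prod_list_nonneg) auto
  have eta: "- (a * b) * ln (a * b) = a * (- b * ln b) + b * (- a * ln a)" if "0 \<le> a" "0 \<le> b" for a b :: real
    using that by (cases "a = 0 \<or> b = 0") (auto simp: ln_mult algebra_simps)
  case 1
  show ?case unfolding S using Suc.IH(1) p(2) by (simp flip: sum_distrib_left)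
  case 2
  have "(\<Sum>l\<in>?S (Suc n). - prod_list (map p l) * ln (prod_list (map p l))) =
    (\<Sum>a\<in>L. \<Sum>l\<in>?S n. p a * (- prod_list (map p l) * ln (prod_list (map p l)))
      + prod_list (map p l) * (- p a * ln (p a)))"
    unfolding S using q p(1) by (intro sum.cong refl) (simp only: list.map prod_list.Cons, intro eta, auto)
  also have "\<dots> = (\<Sum>a\<in>L. p a * (\<Sum>l\<in>?S n. - prod_list (map p l) * ln (prod_list (map p l)))
      + (\<Sum>l\<in>?S n. prod_list (map p l)) * (- p a * ln (p a)))"
    by (simp only: sum.distrib sum_distrib_left sum_distrib_right)
  also have "\<dots> = (\<Sum>a\<in>L. p a * (real n * (\<Sum>a\<in>L. - p a * ln (p a))) + (- p a * ln (p a)))"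
    unfolding Suc.IH by simp
  also have "\<dots> = (\<Sum>a\<in>L. p a) * (real n * (\<Sum>a\<in>L. - p a * ln (p a))) + (\<Sum>a\<in>L. - p a * ln (p a))"
    by (simp only: sum.distrib sum_distrib_right)
  also have "\<dots> = real (Suc n) * (\<Sum>a\<in>L. - p a * ln (p a))" unfolding p(2) by (simp add: algebra_simps)
  finally show ?case .
qed

text \<open>The tangent at A to the convex function q ln q. Summed over values q with mean A, it
  gives Jensen's inequality.\<close>

lemma x_ln_x_tangent:
  fixes q A :: real
  assumes "0 \<le> q" "0 < A"
  shows "q * ln A + q - A \<le> q * ln q"
proof (cases "q = 0")
  case False
  then have q: "0 < q" using assms by simp
  have "q * ln (A / q) \<le> q * (A / q - 1)" using q assms by (intro mult_left_mono ln_le_minus_one) auto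
  then show ?thesis using q assms by (simp add: ln_div algebra_simps)
qed (use assms in simp)

text \<open>
  A sequence \<open>\<omega>\<close> of independent blocks from \<open>L\<close> is read as the sequence of letters \<open>sq \<omega>\<close>, which codes the
  point \<open>cd \<omega>\<close>. The law of \<open>cd \<omega>\<close> is invariant under the \<open>M\<close>-th iterate of the map only; \<open>\<mu>\<close> averages its
  first \<open>M\<close> images, with \<open>V\<close> the uniform law on the phases \<open>r < M\<close>.
\<close>

locale bernoulli_loops = markov_map Q \<kappa> \<gamma> for Q :: "'m::metric_space rectangles" and \<kappa> \<gamma> +
  fixes M :: nat and L :: "nat list set" and p :: "nat list \<Rightarrow> real"
  assumes M_pos: "0 < M" and L_sub: "L \<subseteq> wds M"
    and L_chain: "w \<in> L \<Longrightarrow> chain w"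
    and L_loop: "w \<in> L \<Longrightarrow> w' \<in> L \<Longrightarrow> succ (last w) (hd w')"
    and p_pos: "w \<in> L \<Longrightarrow> 0 < p w" and p_sum: "(\<Sum>w\<in>L. p w) = 1"
begin

lemma finite_L: "finite L"
  using L_sub finite_wds finite_subset by blast

lemma L_length: "w \<in> L \<Longrightarrow> length w = M"
  using L_sub wds_length by blast

definition block_law :: "nat list measure" where
  "block_law = point_measure L (\<lambda>w. ennreal (p w))"

definition \<Omega> :: "(nat \<Rightarrow> nat list) measure" where
  "\<Omega> = (\<Pi>\<^sub>M i\<in>UNIV. block_law)"

lemma space_block_law: "space block_law = L"
  by (simp add: block_law_def space_point_measure)

lemma sets_block_law: "sets block_law = Pow L"
  by (simp add: block_law_def sets_point_measure)

lemma measure_block_law: "A \<subseteq> L \<Longrightarrow> emeasure block_law A = ennreal (\<Sum>w\<in>A. p w)"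
  unfolding block_law_def using finite_L p_pos 
  by (subst emeasure_point_measure_finite) (auto intro!: sum_ennreal simp: less_imp_le subset_iff)

lemma prob_block_law: "prob_space block_law"
  by (rule prob_spaceI) (simp add: space_block_law measure_block_law p_sum)

sublocale P: product_prob_space "\<lambda>_::nat. block_law" UNIV
  by (intro product_prob_spaceI prob_block_law)

sublocale O: prob_space \<Omega>
  unfolding \<Omega>_def using prob_block_law by (rule prob_space_PiM)

lemma space_\<Omega>: "\<omega> \<in> space \<Omega> \<longleftrightarrow> (\<forall>q. \<omega> q \<in> L)"
  by (simp add: \<Omega>_def space_PiM space_block_law PiE_UNIV_domain Pi_iff)

definition sq :: "(nat \<Rightarrow> nat list) \<Rightarrow> nat \<Rightarrow> nat" where
  "sq \<omega> t = \<omega> (t div M) ! (t mod M)"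

definition cd :: "(nat \<Rightarrow> nat list) \<Rightarrow> 'm" where
  "cd \<omega> = code (sq \<omega>)"

lemma sq_succ:
  assumes "\<omega> \<in> space \<Omega>"
  shows "succ (sq \<omega> t) (sq \<omega> (Suc t))"
proof (cases "Suc (t mod M) = M")
  case True
  let ?w = "\<omega> (t div M)" and ?w' = "\<omega> (Suc (t div M))"
  have w: "?w \<in> L" "?w' \<in> L" using assms space_\<Omega> by auto
  have "sq \<omega> t = last ?w"
  proof -
    have "t mod M = M - 1" "?w \<noteq> []" using True L_length[OF w(1)] M_pos by auto
    then show ?thesis using L_length[OF w(1)] unfolding sq_def by (simp add: last_conv_nth)
  qed
  moreover have "sq \<omega> (Suc t) = hd ?w'"
    using True L_length[OF w(2)] M_pos unfolding sq_def
    by (subst hd_conv_nth) (auto simp: mod_Suc div_Suc)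
  ultimately show ?thesis using L_loop w by simp
next
  case False
  let ?w = "\<omega> (t div M)"
  have w: "?w \<in> L" using assms space_\<Omega> by auto
  have "Suc (t mod M) < M" using False M_pos mod_less_divisor[of M t] by linarith
  moreover have "Suc t div M = t div M" "Suc t mod M = Suc (t mod M)"
    using False by (auto simp: mod_Suc div_Suc)
  ultimately show ?thesis
    using L_chain[OF w] L_length[OF w] unfolding chain_def sq_def by simp
qed

lemma cd_in: "\<omega> \<in> space \<Omega> \<Longrightarrow> cd \<omega> \<in> X"
  and letter_cd: "\<omega> \<in> space \<Omega> \<Longrightarrow> letter ((T ^^ t) (cd \<omega>)) = sq \<omega> t"
  unfolding cd_def using letter_code sq_succ by blast+

lemma word_cd: "\<omega> \<in> space \<Omega> \<Longrightarrow> word n ((T ^^ r) (cd \<omega>)) = map (\<lambda>j. sq \<omega> (r + j)) [0..<n]"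
  by (simp add: word_def letter_cd flip: funpow_add_apply)

lemma block_cd:
  assumes "\<omega> \<in> space \<Omega>"
  shows "word M ((T ^^ (q * M)) (cd \<omega>)) = \<omega> q"
proof -
  have "length (\<omega> q) = M" using assms L_length space_\<Omega> by blast
  then show ?thesis
    using M_pos by (auto simp: word_cd[OF assms] sq_def intro!: nth_equalityI)
qed

lemma measurable_component: "(\<lambda>\<omega>. \<omega> q) \<in> measurable \<Omega> block_law"
  unfolding \<Omega>_def by simp

lemma simple_component: "simple_function \<Omega> (\<lambda>\<omega>. F (\<omega> q))"
proof -
  have "simple_function \<Omega> (\<lambda>\<omega>. \<omega> q)"
    unfolding simple_function_def
  proof
    have "(\<lambda>\<omega>. \<omega> q) ` space \<Omega> \<subseteq> L" using space_\<Omega> by auto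
    then show "finite ((\<lambda>\<omega>. \<omega> q) ` space \<Omega>)" using finite_L finite_subset by blast
    show "\<forall>x\<in>(\<lambda>\<omega>. \<omega> q) ` space \<Omega>. (\<lambda>\<omega>. \<omega> q) -` {x} \<inter> space \<Omega> \<in> sets \<Omega>"
      using space_\<Omega> by (intro ballI measurable_sets[OF measurable_component]) (auto simp: sets_block_law)
  qed
  from simple_function_compose[OF this, of F] show ?thesis by (simp add: comp_def)
qed

lemma simple_sq: "simple_function \<Omega> (\<lambda>\<omega>. map (sq \<omega>) ts)"
proof (induction ts)
  case (Cons t ts)
  from simple_function_compose2[OF simple_component[of "\<lambda>w. w ! (t mod M)" "t div M"] this, of "(#)"]
  show ?case by (simp add: sq_def)
qed simp

lemma simple_word_cd: "simple_function \<Omega> (\<lambda>\<omega>. word n ((T ^^ r) (cd \<omega>)))"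
proof -
  have "simple_function \<Omega> (\<lambda>\<omega>. map (sq \<omega>) [r..<r + n])" by (rule simple_sq)
  moreover have "map (sq \<omega>) [r..<r + n] = word n ((T ^^ r) (cd \<omega>))" if "\<omega> \<in> space \<Omega>" for \<omega>
    by (rule nth_equalityI) (auto simp: word_cd[OF that])
  ultimately show ?thesis by (subst simple_function_cong[where g = "\<lambda>\<omega>. map (sq \<omega>) [r..<r + n]"]) auto
qed

abbreviation "X\<^sub>b \<equiv> restrict_space borel X"

lemma cd_measurable: "cd \<in> measurable \<Omega> X\<^sub>b"
proof -
  have "(\<lambda>\<omega>. pt (word n (cd \<omega>))) \<in> borel_measurable \<Omega>" for n
    using measurable_compose[OF measurable_simple_function[OF simple_word_cd[of n 0]], of pt borel] by simp
  moreover have "(\<lambda>n. pt (word n (cd \<omega>))) \<longlonglongrightarrow> cd \<omega>" if "\<omega> \<in> space \<Omega>" for \<omega>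
    using pt_word_tendsto cd_in that by blast
  ultimately have "cd \<in> borel_measurable \<Omega>" by (rule borel_measurable_LIMSEQ_metric)
  then show ?thesis using cd_in by (intro measurable_restrict_space2) auto
qed

lemma space_Xb: "space X\<^sub>b = X"
  by (simp add: space_restrict_space)

lemma funpow_Xb: "(T ^^ r) \<in> measurable X\<^sub>b X\<^sub>b"
proof (induction r)
  case (Suc r)
  then show ?case using shift_measurable[of X\<^sub>b] by (simp add: measurable_comp)
qed (simp add: id_def)

lemma funpow_cd: "(\<lambda>\<omega>. (T ^^ r) (cd \<omega>)) \<in> measurable \<Omega> X\<^sub>b"
  by (rule measurable_compose[OF cd_measurable funpow_Xb])

text \<open>Dropping a block moves the coded point by \<open>T ^^ M\<close>. As \<Omega> is
  stationary, the law of \<open>cd\<close> is invariant under this iterate.\<close>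

lemma cd_shift:
  assumes "\<omega> \<in> space \<Omega>"
  shows "cd (\<lambda>q. \<omega> (Suc q)) = (T ^^ M) (cd \<omega>)"
proof (rule eq_if_all_letters)
  have s: "(\<lambda>q. \<omega> (Suc q)) \<in> space \<Omega>" using assms by (simp add: space_\<Omega>)
  show "cd (\<lambda>q. \<omega> (Suc q)) \<in> X" using cd_in s .
  show "(T ^^ M) (cd \<omega>) \<in> X" using cd_in assms funpow_in by blast
  show "letter ((T ^^ t) (cd (\<lambda>q. \<omega> (Suc q)))) = letter ((T ^^ t) ((T ^^ M) (cd \<omega>)))" for t
    using M_pos by (simp add: letter_cd s assms sq_def flip: funpow_add_apply)
qed

lemma distr_shift: "distr \<Omega> \<Omega> (\<lambda>\<omega> q. \<omega> (Suc q)) = \<Omega>"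
  using distr_PiM_reindex[of UNIV "\<lambda>_. block_law" Suc UNIV] prob_block_law
  by (simp add: \<Omega>_def restrict_def)

lemma measurable_shift_\<Omega>: "(\<lambda>\<omega> q. \<omega> (Suc q)) \<in> measurable \<Omega> \<Omega>"
  unfolding \<Omega>_def by (rule measurable_PiM_single') (auto simp: space_PiM space_block_law)

section \<open>The invariant measure obtained by averaging over phases\<close>

definition V :: "nat measure" where
  "V = point_measure {..<M} (\<lambda>_. ennreal (1 / real M))"

lemma space_V: "space V = {..<M}"
  by (simp add: V_def space_point_measure)

sublocale V: prob_space V
proof
  have "emeasure V (space V) = ennreal (\<Sum>r<M. 1 / real M)"
    unfolding space_V by (simp add: V_def emeasure_point_measure_finite ennreal_of_nat_eq_real_of_nat flip: ennreal_mult)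
  then show "emeasure V (space V) = 1" using M_pos by simp
qed

sublocale VO: pair_prob_space V \<Omega> ..

definition \<mu> :: "'m measure" where
  "\<mu> = distr (V \<Otimes>\<^sub>M \<Omega>) X\<^sub>b (\<lambda>(r, \<omega>). (T ^^ r) (cd \<omega>))"

lemma tower_measurable: "(\<lambda>(r, \<omega>). (T ^^ r) (cd \<omega>)) \<in> measurable (V \<Otimes>\<^sub>M \<Omega>) X\<^sub>b"
proof -
  have "(\<lambda>(r, \<omega>). (T ^^ r) (cd \<omega>)) \<in> measurable (count_space {..<M} \<Otimes>\<^sub>M \<Omega>) X\<^sub>b"
    by (rule measurable_pair_measure_countable1) (auto intro: funpow_cd)
  moreover have "sets (V \<Otimes>\<^sub>M \<Omega>) = sets (count_space {..<M} \<Otimes>\<^sub>M \<Omega>)"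
    by (intro sets_pair_measure_cong) (auto simp: V_def sets_point_measure)
  ultimately show ?thesis by (simp cong: measurable_cong_sets)
qed

lemma sets_\<mu>: "sets \<mu> = sets X\<^sub>b" and space_\<mu>: "space \<mu> = X"
  by (simp_all add: \<mu>_def space_Xb)

sublocale \<mu>: prob_space \<mu>
  unfolding \<mu>_def by (rule VO.prob_space_distr[OF tower_measurable])

lemma measure_\<mu>:
  assumes B: "B \<in> sets X\<^sub>b"
  shows "measure \<mu> B = (\<Sum>r<M. measure \<Omega> {\<omega> \<in> space \<Omega>. (T ^^ r) (cd \<omega>) \<in> B}) / M"
proof -
  let ?f = "\<lambda>(r, \<omega>). (T ^^ r) (cd \<omega>)"
  let ?A = "?f -` B \<inter> space (V \<Otimes>\<^sub>M \<Omega>)"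
  have A: "?A \<in> sets (V \<Otimes>\<^sub>M \<Omega>)" using tower_measurable B by (rule measurable_sets)
  have "emeasure \<mu> B = emeasure (V \<Otimes>\<^sub>M \<Omega>) ?A"
    unfolding \<mu>_def by (rule emeasure_distr[OF tower_measurable B])
  also have "\<dots> = (\<integral>\<^sup>+ r. emeasure \<Omega> (Pair r -` ?A) \<partial>V)"
    by (rule O.emeasure_pair_measure_alt[OF A])
  also have "\<dots> = (\<Sum>r<M. ennreal (1 / M) * emeasure \<Omega> (Pair r -` ?A))"
    unfolding V_def by (subst nn_integral_point_measure_finite) auto
  also have "\<dots> = (\<Sum>r<M. ennreal (1 / M * measure \<Omega> {\<omega> \<in> space \<Omega>. (T ^^ r) (cd \<omega>) \<in> B}))"
  proof (intro sum.cong refl)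
    fix r assume "r \<in> {..<M}"
    then have "Pair r -` ?A = {\<omega> \<in> space \<Omega>. (T ^^ r) (cd \<omega>) \<in> B}"
      by (auto simp: space_pair_measure space_V)
    then show "ennreal (1 / M) * emeasure \<Omega> (Pair r -` ?A) = 
      ennreal (1 / M * measure \<Omega> {\<omega> \<in> space \<Omega>. (T ^^ r) (cd \<omega>) \<in> B})"
      by (simp only: O.emeasure_eq_measure) (simp add: ennreal_mult[symmetric])
  qed
  also have "\<dots> = ennreal ((\<Sum>r<M. measure \<Omega> {\<omega> \<in> space \<Omega>. (T ^^ r) (cd \<omega>) \<in> B}) / M)"
    by (subst sum_ennreal) (auto simp: sum_divide_distrib)
  finally show ?thesis
    unfolding \<mu>.emeasure_eq_measure by (subst (asm) ennreal_inj) (auto intro!: divide_nonneg_nonneg sum_nonneg)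
qed

text \<open>The map raises every phase by one. The phase M that comes in has the law of the phase 0
  that is lost, by stationarity of the blocks.\<close>

lemma \<mu>_invariant: "\<mu> \<in> invariant_measures X T"
proof -
  have Tm: "T \<in> measurable \<mu> \<mu>" using shift_measurable sets_\<mu> by blast
  have "distr \<mu> \<mu> T = \<mu>"
  proof (rule measure_eqI)
    fix B assume "B \<in> sets (distr \<mu> \<mu> T)"
    then have B: "B \<in> sets \<mu>" "B \<in> sets X\<^sub>b" by (simp_all add: sets_\<mu>)
    define a where "a r = measure \<Omega> {\<omega> \<in> space \<Omega>. (T ^^ r) (cd \<omega>) \<in> B}" for r
    have TB: "T -` B \<inter> space \<mu> \<in> sets X\<^sub>b" using measurable_sets[OF Tm B(1)] sets_\<mu> by simp
    have "a M = a 0"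
    proof -
      have m: "{\<omega> \<in> space \<Omega>. cd \<omega> \<in> B} \<in> sets \<Omega>"
        using measurable_sets[OF cd_measurable B(2)] by (simp add: vimage_def Int_def conj_commute)
      have "{\<omega> \<in> space \<Omega>. (T ^^ M) (cd \<omega>) \<in> B} = 
        (\<lambda>\<omega> q. \<omega> (Suc q)) -` {\<omega> \<in> space \<Omega>. cd \<omega> \<in> B} \<inter> space \<Omega>"
        using cd_shift by (auto simp: space_\<Omega>)
      then have "a M = measure (distr \<Omega> \<Omega> (\<lambda>\<omega> q. \<omega> (Suc q))) {\<omega> \<in> space \<Omega>. cd \<omega> \<in> B}"
        unfolding a_def by (subst measure_distr[OF measurable_shift_\<Omega> m]) simp
      then show ?thesis unfolding distr_shift by (simp add: a_def)
    qed
    have "measure (distr \<mu> \<mu> T) B = measure \<mu> (T -` B \<inter> space \<mu>)" by (rule measure_distr[OF Tm B(1)])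
    also have "\<dots> = (\<Sum>r<M. measure \<Omega> {\<omega> \<in> space \<Omega>. (T ^^ r) (cd \<omega>) \<in> T -` B \<inter> space \<mu>}) / M"
      by (rule measure_\<mu>[OF TB])
    also have "(\<Sum>r<M. measure \<Omega> {\<omega> \<in> space \<Omega>. (T ^^ r) (cd \<omega>) \<in> T -` B \<inter> space \<mu>}) = (\<Sum>r<M. a (Suc r))"
      using cd_in funpow_in by (intro sum.cong refl) (auto simp: a_def space_\<mu> intro!: arg_cong[where f = "measure \<Omega>"])
    also have "\<dots> = (\<Sum>r<M. a r)"
      using sum.lessThan_Suc_shift[of a M] sum.lessThan_Suc[of a M] \<open>a M = a 0\<close> by simp
    also have "\<dots> / M = measure \<mu> B" unfolding a_def by (rule measure_\<mu>[OF B(2), symmetric])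
    finally have "measure (distr \<mu> \<mu> T) B = measure \<mu> B" .
    then show "emeasure (distr \<mu> \<mu> T) B = emeasure \<mu> B"
      using finite_measure.emeasure_eq_measure[OF prob_space.finite_measure[OF \<mu>.prob_space_distr[OF Tm]]]
      by (simp add: \<mu>.emeasure_eq_measure)
  qed simp
  then show ?thesis
    unfolding invariant_measures_def using Tm sets_\<mu> \<mu>.prob_space_axioms by blast
qed

section \<open>Entropy and energy of the averaged measure\<close>

definition H :: real where "H = (\<Sum>w\<in>L. - p w * ln (p w))"

lemma H_nonneg: "0 \<le> H"
proof -
  have "p w \<le> 1" if "w \<in> L" for w
    using member_le_sum[OF that, of p] p_pos finite_L p_sum by (force intro: less_imp_le)
  then show ?thesis unfolding H_def using p_pos by (intro sum_nonneg) (simp add: mult_nonneg_nonpos less_imp_le)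
qed

text \<open>The blocks are counted from 1 because a word read from a phase r > 0 misses the
  beginning of block 0.\<close>

lemma block_entropy: "partition_entropy \<Omega> (\<lambda>\<omega>. map \<omega> [1..<J]) = real (J - 1) * H"
proof -
  let ?S = "{l. set l \<subseteq> L \<and> length l = J - 1}"
  have fin: "finite ?S" using finite_L by (rule finite_lists_length_eq)
  have sub: "(\<lambda>\<omega>. map \<omega> [1..<J]) ` space \<Omega> \<subseteq> ?S" using space_\<Omega> by auto
  have "measure \<Omega> ((\<lambda>\<omega>. map \<omega> [1..<J]) -` {l} \<inter> space \<Omega>) = prod_list (map p l)" if l: "l \<in> ?S" for l
  proof -
    have "(\<lambda>\<omega>. map \<omega> [1..<J]) -` {l} \<inter> space \<Omega> = {\<omega> \<in> space \<Omega>. \<forall>j\<in>{1..<J}. \<omega> j \<in> {l ! (j - 1)}}"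
    proof (intro equalityI subsetI)
      fix \<omega> assume "\<omega> \<in> (\<lambda>\<omega>. map \<omega> [1..<J]) -` {l} \<inter> space \<Omega>"
      then show "\<omega> \<in> {\<omega> \<in> space \<Omega>. \<forall>j\<in>{1..<J}. \<omega> j \<in> {l ! (j - 1)}}" by auto
    next
      fix \<omega> assume "\<omega> \<in> {\<omega> \<in> space \<Omega>. \<forall>j\<in>{1..<J}. \<omega> j \<in> {l ! (j - 1)}}"
      then show "\<omega> \<in> (\<lambda>\<omega>. map \<omega> [1..<J]) -` {l} \<inter> space \<Omega>"
        using l by (auto intro!: nth_equalityI)
    qed
    then have "emeasure \<Omega> ((\<lambda>\<omega>. map \<omega> [1..<J]) -` {l} \<inter> space \<Omega>) = (\<Prod>j\<in>{1..<J}. emeasure block_law {l ! (j - 1)})"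
      unfolding \<Omega>_def using l by (simp only:) (intro P.emeasure_PiM_Collect, auto simp: sets_block_law subset_iff)
    also have "\<dots> = (\<Prod>j\<in>{1..<J}. ennreal (p (l ! (j - 1))))"
      using l by (intro prod.cong refl) (auto simp: measure_block_law subset_iff)
    also have "\<dots> = ennreal (\<Prod>j\<in>{1..<J}. p (l ! (j - 1)))"
      using l p_pos by (intro prod_ennreal) (auto intro!: less_imp_le simp: subset_iff)
    also have "(\<Prod>j\<in>{1..<J}. p (l ! (j - 1))) = (\<Prod>j<J - 1. p (l ! j))"
      by (rule prod.reindex_bij_witness[where i = Suc and j = "\<lambda>j. j - 1"]) auto
    also have "\<dots> = prod_list (map p l)"
      using l by (simp add: prod.list_conv_set_nth atLeast0LessThan)
    finally have "emeasure \<Omega> ((\<lambda>\<omega>. map \<omega> [1..<J]) -` {l} \<inter> space \<Omega>) = ennreal (prod_list (map p l))" .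
    moreover have "0 \<le> prod_list (map p l)"
      using l p_pos by (intro prod_list_nonneg) (auto intro!: less_imp_le simp: subset_iff)
    ultimately show ?thesis by (simp add: measure_def)
  qed
  then have "partition_entropy \<Omega> (\<lambda>\<omega>. map \<omega> [1..<J]) = (\<Sum>l\<in>?S. - prod_list (map p l) * ln (prod_list (map p l)))"
    unfolding partition_entropy_superset[OF fin sub] by (intro sum.cong) auto
  also have "\<dots> = real (J - 1) * H"
    unfolding H_def using sum_lists_prod_list(2)[OF finite_L _ p_sum, of "J - 1"] p_pos less_imp_le by blast
  finally show ?thesis .
qed

text \<open>Block q starts at position q M - r of the observed word. So the complete blocks can be
  cut out of the word, and passing to a function of it cannot raise the entropy.\<close>

lemma word_entropy_ge:
  assumes "r < M"
  shows "real (n div M - 1) * H \<le> partition_entropy \<Omega> (\<lambda>\<omega>. word n ((T ^^ r) (cd \<omega>)))"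
proof -
  define F where "F l = map (\<lambda>q. take M (drop (q * M - r) l)) [1..<n div M]" for l :: "nat list"
  have "map \<omega> [1..<n div M] = F (word n ((T ^^ r) (cd \<omega>)))" if \<omega>: "\<omega> \<in> space \<Omega>" for \<omega>
    unfolding F_def
  proof (intro map_cong refl)
    fix q assume "q \<in> set [1..<n div M]"
    then have q: "1 \<le> q" "Suc q \<le> n div M" by auto
    then have "Suc q * M \<le> n" by (metis div_times_less_eq_dividend mult_le_mono1 order.trans)
    moreover have "r \<le> q * M" using assms q(1) by (metis less_imp_le_nat mult.left_neutral mult_le_mono1 order.trans)
    ultimately have "take M (drop (q * M - r) (word n ((T ^^ r) (cd \<omega>)))) = word M ((T ^^ (q * M)) (cd \<omega>))"
      by (subst word_shift) (auto simp flip: funpow_add_apply)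
    then show "\<omega> q = take M (drop (q * M - r) (word n ((T ^^ r) (cd \<omega>))))" using block_cd[OF \<omega>] by simp
  qed
  then have "partition_entropy \<Omega> (\<lambda>\<omega>. map \<omega> [1..<n div M]) = partition_entropy \<Omega> (\<lambda>\<omega>. F (word n ((T ^^ r) (cd \<omega>))))"
    unfolding partition_entropy_def
    by (intro sum.cong image_cong refl arg_cong2[where f = "(*)"] arg_cong[where f = ln] arg_cong[where f = uminus]
      arg_cong[where f = "measure \<Omega>"]) auto
  then show ?thesis
    using O.partition_entropy_comp[OF simple_word_cd[of n r], of F] block_entropy[of "n div M"] by simp
qed

text \<open>By concavity of \<open>- x ln x\<close>, averaging over the phase \<open>r < M\<close> does not lower the entropy.\<close>

lemma word_entropy_\<mu>: "real (n div M - 1) * H \<le> partition_entropy \<mu> (word n)"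
proof -
  define q where "q r ws = measure \<Omega> {\<omega> \<in> space \<Omega>. word n ((T ^^ r) (cd \<omega>)) = ws}" for r ws
  have eta: "(\<Sum>r<M. - q r ws * ln (q r ws)) / M \<le> - ((\<Sum>r<M. q r ws) / M) * ln ((\<Sum>r<M. q r ws) / M)" for ws
  proof -
    let ?A = "(\<Sum>r<M. q r ws) / M"
    have q: "0 \<le> q r ws" for r by (simp add: q_def)
    have "?A * ln ?A \<le> (\<Sum>r<M. q r ws * ln (q r ws)) / M"
    proof (cases "?A = 0")
      case True
      then have "\<forall>r\<in>{..<M}. q r ws = 0" using q M_pos by (subst sum_nonneg_eq_0_iff[symmetric]) auto
      then show ?thesis by simp
    next
      case False
      then have A: "0 < ?A" using q by (intro order_neq_le_trans[OF _ divide_nonneg_nonneg] sum_nonneg) auto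
      have "?A * M = (\<Sum>r<M. q r ws)" using M_pos by simp
      then have "M * (?A * ln ?A) = (\<Sum>r<M. q r ws * ln ?A + q r ws - ?A)"
        unfolding sum.distrib sum_subtractf sum_distrib_right[symmetric] by (simp add: field_simps)
      also have "\<dots> \<le> (\<Sum>r<M. q r ws * ln (q r ws))"
        by (intro sum_mono x_ln_x_tangent q A)
      finally show ?thesis using M_pos by (simp add: field_simps)
    qed
    then show ?thesis by (simp add: sum_negf)
  qed
  have ms: "measure \<mu> (word n -` {ws} \<inter> space \<mu>) = (\<Sum>r<M. q r ws) / M" for ws
  proof -
    interpret markov_measure Q \<kappa> \<gamma> \<mu>
      by unfold_locales (rule \<mu>_invariant)
    have B: "word n -` {ws} \<inter> space \<mu> \<in> sets X\<^sub>b"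
      using measurable_sets[OF word_meas, of "{ws}" n] by (simp add: sets_\<mu>)
    have "{\<omega> \<in> space \<Omega>. (T ^^ r) (cd \<omega>) \<in> word n -` {ws} \<inter> space \<mu>} = {\<omega> \<in> space \<Omega>. word n ((T ^^ r) (cd \<omega>)) = ws}" for r
      using cd_in funpow_in by (auto simp: space_\<mu>)
    then show ?thesis unfolding measure_\<mu>[OF B] q_def by simp
  qed
  have "real (n div M - 1) * H = (\<Sum>r<M. real (n div M - 1) * H) / M" using M_pos by simp
  also have "\<dots> \<le> (\<Sum>r<M. \<Sum>ws\<in>wds n. - q r ws * ln (q r ws)) / M"
  proof (intro divide_right_mono sum_mono)
    fix r assume "r \<in> {..<M}"
    moreover have "partition_entropy \<Omega> (\<lambda>\<omega>. word n ((T ^^ r) (cd \<omega>))) = (\<Sum>ws\<in>wds n. - q r ws * ln (q r ws))"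
      using word_in cd_in funpow_in
      by (subst partition_entropy_superset[of "wds n"]) (auto simp: q_def vimage_def Int_def conj_commute)
    ultimately show "real (n div M - 1) * H \<le> (\<Sum>ws\<in>wds n. - q r ws * ln (q r ws))"
      using word_entropy_ge[of r n] by simp
  qed simp
  also have "\<dots> = (\<Sum>ws\<in>wds n. (\<Sum>r<M. - q r ws * ln (q r ws)) / M)"
    by (subst sum.swap) (simp add: sum_divide_distrib)
  also have "\<dots> \<le> (\<Sum>ws\<in>wds n. - ((\<Sum>r<M. q r ws) / M) * ln ((\<Sum>r<M. q r ws) / M))"
    by (intro sum_mono eta)
  also have "\<dots> = partition_entropy \<mu> (word n)"
    using word_in unfolding ms[symmetric] by (intro partition_entropy_superset[symmetric]) (auto simp: space_\<mu>)
  finally show ?thesis .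
qed

text \<open>The partition into letters already achieves this rate: \<open>n div M - 1\<close> is at
  least n / M - 2, and the bounded loss disappears in the limit.\<close>

lemma metric_entropy_ge: "ereal (H / M) \<le> metric_entropy T \<mu>"
proof -
  interpret mm: markov_measure Q \<kappa> \<gamma> \<mu>
    by unfold_locales (rule \<mu>_invariant)
  have "((\<lambda>n. H / M - 2 * H * (1 / real n)) \<longlongrightarrow> H / M - 2 * H * 0) sequentially"
    by (intro tendsto_intros lim_1_over_n)
  then have lim: "((\<lambda>n. ereal (H / M - 2 * H * (1 / real n))) \<longlongrightarrow> ereal (H / M)) sequentially"
    by simp
  have "ereal (H / M) = limsup (\<lambda>n. ereal (H / M - 2 * H * (1 / real n)))"
    using lim by (intro lim_imp_Limsup[symmetric]) auto
  also have "\<dots> \<le> limsup (\<lambda>n. ereal (partition_entropy \<mu> (itinerary T letter n) / real n))"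
  proof (intro Limsup_mono eventually_mono[OF eventually_gt_at_top[of 0]])
    fix n :: nat assume n: "0 < n"
    have "n < (n div M + 1) * M" using M_pos by (metis add.commute dividend_less_times_div mult.commute plus_1_eq_Suc mult_Suc_right)
    then have "real n < (real (n div M) + 1) * real M"
      by (metis of_nat_1 of_nat_add of_nat_less_iff of_nat_mult)
    then have "real n / M \<le> real (n div M) + 1" using M_pos by (simp add: field_simps)
    then have "real n / M - 2 \<le> real (n div M - 1)" by linarith
    then have "(real n / M - 2) * H \<le> real (n div M - 1) * H" using H_nonneg by (rule mult_right_mono)
    also have "\<dots> \<le> partition_entropy \<mu> (word n)" by (rule word_entropy_\<mu>)
    finally have "((real n / M - 2) * H) / n \<le> partition_entropy \<mu> (word n) / n" by (rule divide_right_mono) simp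
    moreover have "((real n / M - 2) * H) / n = H / M - 2 * H * (1 / real n)" using n by (simp add: field_simps)
    ultimately show "ereal (H / M - 2 * H * (1 / real n)) \<le> ereal (partition_entropy \<mu> (itinerary T letter n) / real n)"
      by (simp add: word_eq_itinerary)
  qed
  also have "\<dots> \<le> metric_entropy T \<mu>"
    unfolding metric_entropy_def using mm.simple_letter letter_measurable[OF sets_\<mu>]
    by (intro SUP_upper) (auto simp: simple_function_def)
  finally show ?thesis .
qed

text \<open>Averaging over phases turns \<phi> into its Birkhoff sum over one period, divided by M.
  The coded point lies in the cylinder of the first block, on which a is a lower bound.\<close>

lemma integral_\<mu>_ge:
  assumes \<phi>: "\<phi> \<in> borel_measurable X\<^sub>b" and B: "\<And>x. x \<in> X \<Longrightarrow> \<bar>\<phi> x\<bar> \<le> B"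
    and D: "\<And>x w. w \<in> L \<Longrightarrow> x \<in> cyl w \<Longrightarrow> a w \<le> bsum M \<phi> x"
  shows "(\<Sum>w\<in>L. p w * a w) / M \<le> integral\<^sup>L \<mu> \<phi>"
proof -
  let ?f = "\<lambda>(r, \<omega>). (T ^^ r) (cd \<omega>)"
  have m: "(\<lambda>\<omega>. \<phi> ((T ^^ r) (cd \<omega>))) \<in> borel_measurable \<Omega>" for r
    by (rule measurable_compose[OF funpow_cd \<phi>])
  have i: "integrable \<Omega> (\<lambda>\<omega>. \<phi> ((T ^^ r) (cd \<omega>)))" for r
    using m B cd_in funpow_in by (intro O.integrable_const_bound[where B = B]) auto
  have iv: "integrable (V \<Otimes>\<^sub>M \<Omega>) (\<lambda>x. \<phi> (?f x))"
  proof (rule VO.integrable_const_bound[where B = B])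
    show "(\<lambda>x. \<phi> (?f x)) \<in> borel_measurable (V \<Otimes>\<^sub>M \<Omega>)"
      by (rule measurable_compose[OF tower_measurable \<phi>])
    show "AE x in V \<Otimes>\<^sub>M \<Omega>. norm (\<phi> (?f x)) \<le> B"
      using B cd_in funpow_in by (intro AE_I2) (auto simp: space_pair_measure)
  qed
  have "integral\<^sup>L \<mu> \<phi> = integral\<^sup>L (V \<Otimes>\<^sub>M \<Omega>) (\<lambda>x. \<phi> (?f x))"
    unfolding \<mu>_def by (rule integral_distr[OF tower_measurable \<phi>])
  also have "\<dots> = (\<integral>r. (\<integral>\<omega>. \<phi> (?f (r, \<omega>)) \<partial>\<Omega>) \<partial>V)"
    by (rule VO.integral_fst'[OF iv, symmetric])
  also have "\<dots> = (\<Sum>r<M. 1 / M * (\<integral>\<omega>. \<phi> ((T ^^ r) (cd \<omega>)) \<partial>\<Omega>))"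
    unfolding V_def by (subst lebesgue_integral_point_measure_finite) auto
  also have "\<dots> = (\<integral>\<omega>. bsum M \<phi> (cd \<omega>) \<partial>\<Omega>) / M"
    unfolding birkhoff_sum_def using i by (subst Bochner_Integration.integral_sum) (auto simp: sum_divide_distrib)
  finally have eq: "integral\<^sup>L \<mu> \<phi> = (\<integral>\<omega>. bsum M \<phi> (cd \<omega>) \<partial>\<Omega>) / M" .
  have am: "a \<in> borel_measurable block_law" by (simp add: block_law_def)
  have "(\<Sum>w\<in>L. p w * a w) = integral\<^sup>L block_law a"
    unfolding block_law_def using finite_L p_pos by (subst lebesgue_integral_point_measure_finite) (auto intro: less_imp_le)
  also have "\<dots> = integral\<^sup>L (distr \<Omega> block_law (\<lambda>\<omega>. \<omega> 0)) a"
    unfolding \<Omega>_def by (subst P.PiM_component) auto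
  also have "\<dots> = (\<integral>\<omega>. a (\<omega> 0) \<partial>\<Omega>)"
    by (rule integral_distr[OF measurable_component am])
  also have "\<dots> \<le> (\<integral>\<omega>. bsum M \<phi> (cd \<omega>) \<partial>\<Omega>)"
  proof (rule integral_mono)
    have "finite (a ` L)" using finite_L by simp
    have "\<bar>a (\<omega> 0)\<bar> \<le> (\<Sum>w\<in>L. \<bar>a w\<bar>)" if "\<omega> \<in> space \<Omega>" for \<omega>
      using member_le_sum[of "\<omega> 0" L "\<lambda>w. \<bar>a w\<bar>"] that finite_L space_\<Omega> by auto
    then show "integrable \<Omega> (\<lambda>\<omega>. a (\<omega> 0))"
      using measurable_compose[OF measurable_component am]
      by (intro O.integrable_const_bound[where B = "\<Sum>w\<in>L. \<bar>a w\<bar>"]) auto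
    show "integrable \<Omega> (\<lambda>\<omega>. bsum M \<phi> (cd \<omega>))"
      unfolding birkhoff_sum_def using i by (intro Bochner_Integration.integrable_sum)
    fix \<omega> assume \<omega>: "\<omega> \<in> space \<Omega>"
    have "cd \<omega> \<in> cyl (\<omega> 0)"
      using block_cd[OF \<omega>, of 0] in_cyl_iff[of "\<omega> 0" M "cd \<omega>"] cd_in[OF \<omega>] L_sub \<omega> space_\<Omega> by auto
    then show "a (\<omega> 0) \<le> bsum M \<phi> (cd \<omega>)" using D \<omega> space_\<Omega> by blast
  qed
  finally show ?thesis unfolding eq by (rule divide_right_mono) simp
qed

end

section \<open>Partition sums are bounded by the pressure\<close>

context markov_map
begin

definition potential :: "('m \<Rightarrow> real) \<Rightarrow> real \<Rightarrow> real \<Rightarrow> bool" where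
  "potential \<phi> B D \<longleftrightarrow> continuous_on X \<phi> \<and> (\<forall>x\<in>X. \<bar>\<phi> x\<bar> \<le> B) \<and>
     (\<forall>n. \<forall>ws\<in>wds n. \<forall>x\<in>cyl ws. \<forall>y\<in>cyl ws. bsum n \<phi> x \<le> bsum n \<phi> y + D)"

lemma X_nonempty: "X \<noteq> {}"
  using Us_nonempty num_pos by (auto simp: Uset_def)

lemma potential_nonneg:
  assumes "potential \<phi> B D"
  shows "0 \<le> B" "0 \<le> D"
proof -
  obtain x where x: "x \<in> X" using X_nonempty by blast
  show "0 \<le> B" using assms x unfolding potential_def by fastforce
  have "[] \<in> wds 0" "x \<in> cyl []" using x by (auto simp: wds_0)
  then show "0 \<le> D" using assms unfolding potential_def by (fastforce simp: birkhoff_sum_def)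
qed

lemma birkhoff_abs_le:
  assumes "\<forall>x\<in>X. \<bar>\<phi> x\<bar> \<le> (B :: real)" "x \<in> X"
  shows "\<bar>bsum n \<phi> x\<bar> \<le> real n * B"
proof -
  have "\<bar>bsum n \<phi> x\<bar> \<le> (\<Sum>j<n. \<bar>\<phi> ((T ^^ j) x)\<bar>)" unfolding birkhoff_sum_def by (rule sum_abs)
  also have "\<dots> \<le> (\<Sum>j<n. B)" using assms funpow_in by (intro sum_mono) auto
  finally show ?thesis by simp
qed

lemma potential_measurable:
  assumes "potential \<phi> B D" 
  shows "\<phi> \<in> borel_measurable (restrict_space borel X)"
  using assms by (intro borel_measurable_continuous_on_restrict) (simp add: potential_def)

lemma free_energy_le:
  assumes \<phi>: "potential \<phi> B D" and m: "m \<in> invariant_measures X T"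
  shows "metric_entropy T m + ereal (integral\<^sup>L m \<phi>) \<le> ereal (ln k + 1 + B)"
proof -
  interpret markov_measure Q \<kappa> \<gamma> m by unfold_locales (rule m)
  have "\<phi> \<in> borel_measurable m"
    using potential_measurable[OF \<phi>] measurable_cong_sets[OF sets_m refl] by blast
  then have i: "integrable m \<phi>"
    using \<phi> by (intro integrable_const_bound[where B = B]) (auto simp: potential_def space_m)
  have "integral\<^sup>L m \<phi> \<le> integral\<^sup>L m (\<lambda>x. B)"
    using i \<phi> by (intro integral_mono) (auto simp: potential_def space_m abs_le_iff)
  then have "integral\<^sup>L m \<phi> \<le> B" by (simp add: prob_space)
  then have "metric_entropy T m + ereal (integral\<^sup>L m \<phi>) \<le> ereal (ln k + 1) + ereal B"
    by (intro add_mono metric_entropy_le) simp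
  then show ?thesis by simp
qed

text \<open>The given measure bounds the supremum from below and \<open>free_energy_le\<close>
  bounds it from above, so \<open>real_of_ereal\<close> returns its true value.\<close>

lemma pressure_ge:
  assumes \<phi>: "potential \<phi> B D" and m: "m \<in> invariant_measures X T"
    and c: "ereal c \<le> metric_entropy T m + ereal (integral\<^sup>L m \<phi>)"
  shows "c \<le> pressure Q \<phi>" "pressure Q \<phi> \<le> ln k + 1 + B"
proof -
  let ?S = "SUP m\<in>invariant_measures X T. metric_entropy T m + ereal (integral\<^sup>L m \<phi>)"
  have 1: "ereal c \<le> ?S" using c m by (rule SUP_upper2[rotated])
  have 2: "?S \<le> ereal (ln k + 1 + B)" using free_energy_le[OF \<phi>] by (intro SUP_least)
  have "?S = ereal (pressure Q \<phi>)"
    unfolding pressure_def using 1 2 by (cases ?S) auto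
  then show "c \<le> pressure Q \<phi>" "pressure Q \<phi> \<le> ln k + 1 + B" using 1 2 by auto
qed

text \<open>The Gibbs weights \<open>exp (a w) / Z\<close> maximise entropy plus energy, with maximal value \<open>ln Z\<close>.\<close>

lemma pressure_ge_loops:
  assumes \<phi>: "potential \<phi> B D" and M: "0 < M" and L: "L \<subseteq> wds M" "L \<noteq> {}"
    and L_chain: "\<And>w. w \<in> L \<Longrightarrow> chain w"
    and L_loop: "\<And>w w'. w \<in> L \<Longrightarrow> w' \<in> L \<Longrightarrow> succ (last w) (hd w')"
  shows "(ln (\<Sum>w\<in>L. exp (bsum M \<phi> (pt w))) - D) / M \<le> pressure Q \<phi>"
    and "pressure Q \<phi> \<le> ln k + 1 + B"
proof -
  \<comment> \<open>Subtracting D makes this a lower bound for the Birkhoff sum on the whole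
    cylinder, not only at the chosen point.\<close>
  define a where "a w = bsum M \<phi> (pt w) - D" for w
  define Z where "Z = (\<Sum>w\<in>L. exp (a w))"
  define p where "p w = exp (a w) / Z" for w
  have fin: "finite L" using L finite_wds finite_subset by blast
  have Z: "0 < Z" unfolding Z_def using fin L by (intro sum_pos) auto
  have ps: "(\<Sum>w\<in>L. p w) = 1" unfolding p_def using Z by (simp add: Z_def flip: sum_divide_distrib)
  interpret bernoulli_loops Q \<kappa> \<gamma> M L p
    by unfold_locales (use assms Z ps in \<open>auto simp: p_def\<close>)
  have "H + (\<Sum>w\<in>L. p w * a w) = (\<Sum>w\<in>L. p w * ln Z)"
    unfolding H_def sum.distrib[symmetric]
    using Z by (intro sum.cong) (auto simp: p_def ln_div right_diff_distrib diff_divide_distrib mult.commute)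
  also have "\<dots> = ln Z" using ps by (simp flip: sum_distrib_right)
  finally have Z_eq: "H / M + (\<Sum>w\<in>L. p w * a w) / M = ln Z / M" by (simp add: add_divide_distrib[symmetric])
  have "(\<Sum>w\<in>L. p w * a w) / M \<le> integral\<^sup>L \<mu> \<phi>"
  proof (rule integral_\<mu>_ge[OF potential_measurable[OF \<phi>]])
    show "\<And>x. x \<in> X \<Longrightarrow> \<bar>\<phi> x\<bar> \<le> B" using \<phi> by (simp add: potential_def)
    fix w x assume w: "w \<in> L" and x: "x \<in> cyl w"
    then have "pt w \<in> cyl w" by (intro pt_in) auto
    then have "bsum M \<phi> (pt w) \<le> bsum M \<phi> x + D"
      using \<phi> w x L unfolding potential_def by blast
    then show "a w \<le> bsum M \<phi> x" by (simp add: a_def)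
  qed
  then have "ereal (H / M) + ereal ((\<Sum>w\<in>L. p w * a w) / M) \<le> metric_entropy T \<mu> + ereal (integral\<^sup>L \<mu> \<phi>)"
    by (intro add_mono metric_entropy_ge) simp
  then have le: "ereal (ln Z / M) \<le> metric_entropy T \<mu> + ereal (integral\<^sup>L \<mu> \<phi>)"
    by (simp add: Z_eq)
  have "Z = exp (- D) * (\<Sum>w\<in>L. exp (bsum M \<phi> (pt w)))"
    unfolding Z_def a_def by (simp add: sum_distrib_left exp_diff exp_minus field_simps)
  moreover have "0 < (\<Sum>w\<in>L. exp (bsum M \<phi> (pt w)))" using fin L by (intro sum_pos) auto
  ultimately have "ln Z = ln (\<Sum>w\<in>L. exp (bsum M \<phi> (pt w))) - D" by (simp add: ln_mult)
  then show "(ln (\<Sum>w\<in>L. exp (bsum M \<phi> (pt w))) - D) / M \<le> pressure Q \<phi>"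
    using pressure_ge(1)[OF \<phi> \<mu>_invariant le] by simp
  show "pressure Q \<phi> \<le> ln k + 1 + B" by (rule pressure_ge(2)[OF \<phi> \<mu>_invariant le])
qed

section \<open>Closing words up to loops\<close>

lemma connecting_word:
  assumes "i < k" "j < k"
  shows "\<exists>vs. set vs \<subseteq> {..<k} \<and> chain (i # vs @ [j])"
proof -
  have "(i, j) \<in> {(i, j). succ i j}\<^sup>+" using irreducible[OF assms] by (simp add: succ_def)
  then show ?thesis
  proof (induction rule: trancl_induct)
    case (base j)
    then have "chain (i # [] @ [j])" by (simp add: chain_iff)
    then show ?case by (metis empty_set empty_subsetI)
  next
    case (step j l)
    then obtain vs where vs: "set vs \<subseteq> {..<k}" "chain (i # vs @ [j])" by blast
    have "chain (i # (vs @ [j]) @ [l])" using vs(2) step(2)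
      successively_append_iff[of succ "i # vs @ [j]" "[l]"] by (simp add: chain_iff)
    moreover have "set (vs @ [j]) \<subseteq> {..<k}" using vs(1) step(2) by (simp add: succ_def)
    ultimately show ?case by blast
  qed
qed

definition connection :: "nat \<Rightarrow> nat \<Rightarrow> nat list" where
  "connection i j = (SOME vs. set vs \<subseteq> {..<k} \<and> chain (i # vs @ [j]))"

lemma connection_chain:
  assumes "i < k" "j < k"
  shows "set (connection i j) \<subseteq> {..<k}" "chain (i # connection i j @ [j])"
  using someI_ex[OF connecting_word[OF assms]] unfolding connection_def by auto

text \<open>The sum over all pairs is a convenient bound for the longest connection.\<close>

definition gap :: nat where
  "gap = (\<Sum>(i, j)\<in>{..<k} \<times> {..<k}. length (connection i j))"

lemma connection_length: "i < k \<Longrightarrow> j < k \<Longrightarrow> length (connection i j) \<le> gap"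
  unfolding gap_def using member_le_sum[of "(i, j)" "{..<k} \<times> {..<k}" "\<lambda>(i, j). length (connection i j)"]
  by auto

text \<open>The factor \<open>k\<^sup>2\<close> is the loss from fixing the first and the last
  letter. In the exponent, D + gap B compares a word with its closed-up loop, another D comes from
  the Gibbs weights, and gap (ln k + 1 + B) bounds the pressure over the extra letters.\<close>

definition pressure_factor :: "real \<Rightarrow> real \<Rightarrow> real" where
  "pressure_factor B D = real (k\<^sup>2) * exp (2 * D + real gap * (ln k + 1 + 2 * B))"

definition partition_sum :: "('m \<Rightarrow> real) \<Rightarrow> nat \<Rightarrow> real" where
  "partition_sum \<phi> n = (\<Sum>ws | ws \<in> wds n \<and> cyl ws \<noteq> {}. exp (bsum n \<phi> (pt ws)))"

text \<open>Pigeonhole over the pairs of first and last letter.\<close>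

lemma partition_sum_le_pairs:
  assumes "0 < n"
  shows "\<exists>i<k. \<exists>j<k. partition_sum \<phi> n \<le> 
    real (k\<^sup>2) * (\<Sum>ws | ws \<in> wds n \<and> cyl ws \<noteq> {} \<and> hd ws = i \<and> last ws = j. exp (bsum n \<phi> (pt ws)))"
proof (rule ccontr)
  let ?G = "{ws. ws \<in> wds n \<and> cyl ws \<noteq> {}}"
  let ?f = "\<lambda>ws. exp (bsum n \<phi> (pt ws))"
  let ?S = "\<lambda>(i, j). \<Sum>ws | ws \<in> ?G \<and> (hd ws, last ws) = (i, j). ?f ws"
  assume "\<not> ?thesis"
  then have lt: "real (k\<^sup>2) * ?S q < partition_sum \<phi> n" if "q \<in> {..<k} \<times> {..<k}" for q
    using that by (cases q) (simp add: conj_assoc not_le)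
  have "(\<lambda>ws. (hd ws, last ws)) ` ?G \<subseteq> {..<k} \<times> {..<k}"
    using assms by (auto simp: wds_def intro!: hd_in_set last_in_set dest: subsetD)
  then have "partition_sum \<phi> n = (\<Sum>q\<in>{..<k} \<times> {..<k}. ?S q)"
    unfolding partition_sum_def by (subst sum.group[symmetric]) (auto intro!: sum.cong)
  then have "real (k\<^sup>2) * partition_sum \<phi> n = (\<Sum>q\<in>{..<k} \<times> {..<k}. real (k\<^sup>2) * ?S q)"
    by (simp add: sum_distrib_left)
  also have "\<dots> < (\<Sum>q\<in>{..<k} \<times> {..<k}. partition_sum \<phi> n)"
    using num_pos lt by (intro sum_strict_mono) auto
  also have "\<dots> = real (k\<^sup>2) * partition_sum \<phi> n" by (simp add: power2_eq_square)
  finally show False by simp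
qed

text \<open>Among words with equal first and equal last letters a single connection closes up all of
  them. The loops then have one length and can follow each other in any order, as
  \<open>pressure_ge_loops\<close> requires.\<close>

lemma partition_sum_le_pressure:
  assumes \<phi>: "potential \<phi> B D" and n: "0 < n"
  shows "partition_sum \<phi> n \<le> pressure_factor B D * exp (n * pressure Q \<phi>)"
proof -
  let ?f = "\<lambda>ws. exp (bsum n \<phi> (pt ws))"
  obtain i j where ij: "i < k" "j < k" and le: "partition_sum \<phi> n \<le> 
    real (k\<^sup>2) * (\<Sum>ws | ws \<in> wds n \<and> cyl ws \<noteq> {} \<and> hd ws = i \<and> last ws = j. ?f ws)"
    using partition_sum_le_pairs[OF n] by blast
  define G where "G = {ws \<in> wds n. cyl ws \<noteq> {} \<and> hd ws = i \<and> last ws = j}"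
  define vs where "vs = connection j i"
  define M where "M = n + length vs"
  define L where "L = (\<lambda>ws. ws @ vs) ` G"
  have vs: "set vs \<subseteq> {..<k}" "chain (j # vs @ [i])" using connection_chain ij by (auto simp: vs_def)
  have finG: "finite G" unfolding G_def by simp
  show ?thesis
  proof (cases "G = {}")
    case True
    then have "{ws. ws \<in> wds n \<and> cyl ws \<noteq> {} \<and> hd ws = i \<and> last ws = j} = {}" by (auto simp: G_def)
    then have "partition_sum \<phi> n \<le> 0" using le by (simp only:) simp
    then show ?thesis by (rule order.trans) (simp add: pressure_factor_def)
  next
    case False
    have Gne: "ws \<noteq> []" if "ws \<in> G" for ws using that n by (auto simp: G_def wds_def)
    have Lw: "L \<subseteq> wds M" using vs(1) by (auto simp: L_def G_def wds_def M_def)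
    have Lc: "chain w" if w: "w \<in> L" for w
    proof -
      obtain ws where ws: "w = ws @ vs" "ws \<in> G" using w unfolding L_def by blast
      then have "chain ws" using chain_if_cyl by (auto simp: G_def)
      then show ?thesis using ws vs(2) 
        by (auto simp: chain_iff successively_append_iff successively_Cons G_def)
    qed
    have Ll: "succ (last w) (hd w')" if w: "w \<in> L" "w' \<in> L" for w w'
    proof -
      obtain ws ws' where ws: "w = ws @ vs" "ws \<in> G" "w' = ws' @ vs" "ws' \<in> G" using w unfolding L_def by blast
      then show ?thesis using vs(2) Gne
        by (cases "vs = []") (auto simp: chain_iff successively_append_iff successively_Cons G_def)
    qed
    have M0: "0 < M" and Lne: "L \<noteq> {}" using n False by (auto simp: M_def L_def)
    note P = pressure_ge_loops[OF \<phi> M0 Lw Lne Lc Ll]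
    define P' where "P' = pressure Q \<phi>"
    have B: "0 \<le> B" "0 \<le> D" using potential_nonneg[OF \<phi>] by auto
    have len: "length vs \<le> gap" unfolding vs_def using connection_length ij by blast
    have ge: "?f ws * exp (- (D + gap * B)) \<le> exp (bsum M \<phi> (pt (ws @ vs)))" if ws: "ws \<in> G" for ws
    proof -
      have "ws @ vs \<in> L" using ws by (simp add: L_def)
      then have x: "pt (ws @ vs) \<in> cyl (ws @ vs)" using Lc Lw cyl_nonempty by (intro pt_in) blast
      then have xws: "pt (ws @ vs) \<in> cyl ws" "(T ^^ n) (pt (ws @ vs)) \<in> X"
        using cyl_subset_X funpow_in unfolding cyl_append by blast+
      have "bsum n \<phi> (pt ws) \<le> bsum n \<phi> (pt (ws @ vs)) + D"
        using \<phi> ws xws pt_in[of ws] unfolding potential_def G_def by blast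
      moreover have "\<bar>bsum (length vs) \<phi> ((T ^^ n) (pt (ws @ vs)))\<bar> \<le> length vs * B"
        using \<phi> xws by (intro birkhoff_abs_le) (auto simp: potential_def)
      moreover have "length vs * B \<le> gap * B" using len B by (intro mult_right_mono) auto
      ultimately have "bsum n \<phi> (pt ws) - (D + gap * B) \<le> bsum M \<phi> (pt (ws @ vs))"
        unfolding M_def birkhoff_add by linarith
      then show ?thesis by (simp add: exp_add[symmetric] mult_exp_exp)
    qed
    have "(\<Sum>ws\<in>G. ?f ws) * exp (- (D + gap * B)) \<le> (\<Sum>ws\<in>G. exp (bsum M \<phi> (pt (ws @ vs))))"
      unfolding sum_distrib_right by (intro sum_mono ge)
    also have "\<dots> = (\<Sum>w\<in>L. exp (bsum M \<phi> (pt w)))"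
      unfolding L_def by (subst sum.reindex) (auto simp: inj_on_def)
    finally have 1: "(\<Sum>ws\<in>G. ?f ws) * exp (- (D + gap * B)) \<le> (\<Sum>w\<in>L. exp (bsum M \<phi> (pt w)))" .
    have pos: "0 < (\<Sum>w\<in>L. exp (bsum M \<phi> (pt w)))"
      using Lne finG by (intro sum_pos) (auto simp: L_def)
    have "ln (\<Sum>w\<in>L. exp (bsum M \<phi> (pt w))) \<le> M * P' + D"
      using P(1) M0 by (simp add: P'_def field_simps)
    then have "(\<Sum>w\<in>L. exp (bsum M \<phi> (pt w))) \<le> exp (M * P' + D)"
      using pos by (metis exp_le_cancel_iff exp_ln)
    \<comment> \<open>The pressure may have either sign, so the surplus length is estimated with its
      upper bound, which is nonnegative.\<close>
    also have "\<dots> \<le> exp (n * P' + gap * (ln k + 1 + B) + D)"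
    proof -
      have k1: "0 \<le> ln (real k)" using num_pos by simp
      have "length vs * P' \<le> length vs * (ln k + 1 + B)" unfolding P'_def using P(2) by (intro mult_left_mono) auto
      also have "\<dots> \<le> gap * (ln k + 1 + B)" using len k1 B by (intro mult_right_mono) auto
      finally show ?thesis by (simp add: M_def algebra_simps)
    qed
    finally have 2: "(\<Sum>w\<in>L. exp (bsum M \<phi> (pt w))) \<le> exp (n * P' + gap * (ln k + 1 + B) + D)" .
    have "(\<Sum>ws\<in>G. ?f ws) = (\<Sum>ws\<in>G. ?f ws) * exp (- (D + gap * B)) * exp (D + gap * B)"
      by (simp add: mult.assoc mult_exp_exp)
    also have "\<dots> \<le> exp (n * P' + gap * (ln k + 1 + B) + D) * exp (D + gap * B)"
      using order.trans[OF 1 2] by (intro mult_right_mono) auto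
    also have "\<dots> = exp (2 * D + real gap * (ln k + 1 + 2 * B)) * exp (n * P')"
      by (simp add: mult_exp_exp algebra_simps)
    finally have "(\<Sum>ws\<in>G. ?f ws) \<le> exp (2 * D + real gap * (ln k + 1 + 2 * B)) * exp (n * P')" .
    then have "real (k\<^sup>2) * (\<Sum>ws\<in>G. ?f ws) \<le> real (k\<^sup>2) * (exp (2 * D + real gap * (ln k + 1 + 2 * B)) * exp (n * P'))"
      by (intro mult_left_mono) auto
    then show ?thesis using le by (simp add: G_def P'_def mult.assoc pressure_factor_def)
  qed
qed

end

section \<open>The first return map of a Markov partition\<close>

text \<open>Continuity of the return time up to the boundary of the pieces is part of the Hoelder
  hypothesis on \<tau>.\<close>

locale markov_partition_flow =
  fixes M :: "('m::metric_space, 'e::euclidean_space) manifold"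
    and Q :: "'m rectangles" and \<delta> \<rho> \<kappa> \<gamma>0 \<gamma>1 :: real
  assumes C2_flow: "C2_flow M (flow Q)"
    and product_structure: "local_product_structure (flow Q) (basic Q) (eps Q) \<delta>"
    and partition: "markov_partition \<delta> \<rho> Q"
    and Uhat_dense: "Uset Q \<subseteq> closure (Uhat Q)"
    and irreducible_transition: "irreducible_aperiodic (num Q) (transition Q)"
    and expansion: "expansion_constants Q \<kappa> \<gamma>0 \<gamma>1"
    and continuous_return_time: "i < num Q \<Longrightarrow> continuous_on (Us Q i) (return_time Q)"
begin

lemma flow_0: "flow Q 0 x = x"
  and continuous_flow: "continuous_on UNIV (\<lambda>(t, x). flow Q t x)"
  using C2_flow unfolding C2_flow_def by auto

lemma eps_pos: "0 < eps Q"
  using product_structure by (simp add: local_product_structure_def)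

lemma product_set_eq:
  assumes "x \<in> basic Q" "y \<in> basic Q" "dist x y < \<delta>"
  shows "product_set (flow Q) (eps Q) x y = {br Q x y}" "br Q x y \<in> basic Q"
proof -
  obtain p where p: "p \<in> basic Q" "product_set (flow Q) (eps Q) x y = {p}"
    using product_structure assms unfolding local_product_structure_def by blast
  then have "br Q x y = p" by (simp add: bracket_def)
  then show "product_set (flow Q) (eps Q) x y = {br Q x y}" "br Q x y \<in> basic Q" using p by auto
qed

lemma \<rho>: "0 < \<rho>" "\<rho> \<le> \<delta>" and num_pos: "0 < num Q"
  using partition unfolding markov_partition_def by auto

lemma rectangle:
  assumes "i < num Q"
  shows "Us Q i \<subseteq> Wu (flow Q) (eps Q) (base Q i) \<inter> basic Q"
    and "Ss Q i \<subseteq> Ws (flow Q) (eps Q) (base Q i) \<inter> basic Q"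
    and "compact (Us Q i)" "Us Q i = Utop Q i closure_of IntU Q i"
    and "base Q i \<in> IntU Q i" "base Q i \<in> IntS Q i"
    and "\<And>x y. x \<in> Us Q i \<Longrightarrow> y \<in> Ss Q i \<Longrightarrow> dist x y < \<delta>"
    and "compact (rect Q i)" "diameter (rect Q i) < \<rho>"
  using partition assms unfolding markov_partition_def by auto

lemma IntU_subset: "IntU Q i \<subseteq> Us Q i" and IntS_subset: "IntS Q i \<subseteq> Ss Q i"
  by (simp_all add: interior_of_subset)

lemma base_in: "i < num Q \<Longrightarrow> base Q i \<in> Us Q i" "i < num Q \<Longrightarrow> base Q i \<in> Ss Q i"
  using rectangle(5,6) IntU_subset IntS_subset by blast+

lemma cross_section: "\<forall>i<num Q. \<forall>t. 0 < t \<and> t \<le> \<rho> \<longrightarrow> rect Q i \<inter> flow Q t ` rect Q i = {}"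
  using partition unfolding markov_partition_def by (elim conjE)

lemma recurrence: "\<forall>x\<in>basic Q. \<exists>t. 0 < t \<and> t \<le> \<rho> \<and> flow Q t x \<in> Rset Q"
  using partition unfolding markov_partition_def by (elim conjE)

lemma one_way: "\<forall>i<num Q. \<forall>j<num Q. i \<noteq> j \<longrightarrow>
    rect Q i \<inter> (\<Union>t\<in>{0..\<rho>}. flow Q t ` rect Q j) = {} \<or>
    rect Q j \<inter> (\<Union>t\<in>{0..\<rho>}. flow Q t ` rect Q i) = {}"
  using partition unfolding markov_partition_def by (elim conjE)

lemma markov_property:
    "\<forall>i<num Q. \<forall>j<num Q. \<forall>u\<in>IntU Q i. \<forall>s\<in>IntS Q i. \<forall>u'\<in>IntU Q j. \<forall>s'\<in>IntS Q j.
      poincare Q (br Q u s) = br Q u' s' \<longrightarrow>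
        poincare Q ` (br Q u ` IntS Q i) \<subseteq> br Q u' ` IntS Q j \<and>
        (\<lambda>x. br Q x s') ` IntU Q j \<subseteq> poincare Q ` ((\<lambda>x. br Q x s) ` IntU Q i)"
  using partition unfolding markov_partition_def by (elim conjE)

lemma cross_time: "i < num Q \<Longrightarrow> 0 < t \<Longrightarrow> t \<le> \<rho> \<Longrightarrow> x \<in> rect Q i \<Longrightarrow> flow Q t x \<notin> rect Q i"
  using cross_section by blast

lemma rect_disjoint:
  assumes "i < num Q" "j < num Q" "x \<in> rect Q i" "x \<in> rect Q j"
  shows "i = j"
proof (rule ccontr)
  assume "i \<noteq> j"
  moreover have "x \<in> flow Q 0 ` rect Q i" "x \<in> flow Q 0 ` rect Q j" "0 \<in> {0..\<rho>}"
    using assms flow_0 \<rho> by (auto simp: image_iff)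
  ultimately show False using one_way assms by blast
qed

section \<open>Bracket coordinates in a rectangle\<close>

lemma br_base:
  assumes "i < num Q" "u \<in> Us Q i"
  shows "br Q u (base Q i) = u"
proof -
  have "u \<in> Ws (flow Q) (eps Q) u" using eps_pos by (simp add: Ws_def)
  moreover have "u \<in> flow Q 0 ` Wu (flow Q) (eps Q) (base Q i)" "0 \<in> {- eps Q..eps Q}"
    using rectangle(1)[OF assms(1)] assms(2) flow_0 eps_pos by (auto simp: image_iff)
  ultimately have "u \<in> product_set (flow Q) (eps Q) u (base Q i)" unfolding product_set_def by blast
  moreover have "u \<in> basic Q" "base Q i \<in> basic Q" "dist u (base Q i) < \<delta>"
    using rectangle(1,7)[OF assms(1)] base_in[OF assms(1)] assms(2) by blast+
  ultimately show ?thesis using product_set_eq(1)[of u "base Q i"] by auto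
qed

lemma Us_subset_rect: "i < num Q \<Longrightarrow> Us Q i \<subseteq> rect Q i"
  using br_base base_in(2) unfolding rect_def by force

lemma br_mem:
  assumes "i < num Q" "u \<in> Us Q i" "s \<in> Ss Q i"
  shows "br Q u s \<in> basic Q" "br Q u s \<in> product_set (flow Q) (eps Q) u s" "br Q u s \<in> rect Q i"
proof -
  have "u \<in> basic Q" "s \<in> basic Q" "dist u s < \<delta>" using rectangle(1,2,7)[OF assms(1)] assms by blast+
  then show "br Q u s \<in> basic Q" "br Q u s \<in> product_set (flow Q) (eps Q) u s"
    using product_set_eq by auto
  show "br Q u s \<in> rect Q i" using assms by (auto simp: rect_def)
qed

text \<open>The stable relation is symmetric, so u lies in the stable set of [u, s] as well as in
  the unstable set of the base; the diameter bound keeps these two points within the range of the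
  bracket. Thus a point of a rectangle determines its unstable coordinate, which justifies the
  definite description in \<open>projU\<close>.\<close>

lemma br_br_base:
  assumes i: "i < num Q" and "u \<in> Us Q i" "s \<in> Ss Q i"
  shows "br Q (br Q u s) (base Q i) = u"
proof -
  let ?p = "br Q u s"
  have b: "base Q i \<in> rect Q i" "base Q i \<in> basic Q" using Us_subset_rect base_in(1) rectangle(1) i by blast+
  have "dist ?p (base Q i) \<le> diameter (rect Q i)"
    using b br_mem[OF assms] rectangle(8)[OF i] by (intro diameter_bounded_bound) (auto intro: compact_imp_bounded)
  then have d: "dist ?p (base Q i) < \<delta>" using rectangle(9)[OF i] \<rho> by simp
  have "?p \<in> Ws (flow Q) (eps Q) u" using br_mem(2)[OF assms] by (simp add: product_set_def)
  then have "u \<in> Ws (flow Q) (eps Q) ?p" by (simp add: Ws_def dist_commute)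
  moreover have "u \<in> flow Q 0 ` Wu (flow Q) (eps Q) (base Q i)" "0 \<in> {- eps Q..eps Q}"
    using rectangle(1)[OF i] assms(2) flow_0 eps_pos by (auto simp: image_iff)
  ultimately have "u \<in> product_set (flow Q) (eps Q) ?p (base Q i)" unfolding product_set_def by blast
  then show ?thesis using product_set_eq(1)[OF br_mem(1)[OF assms] b(2) d] by auto
qed

lemma projU_br:
  assumes "i < num Q" "u \<in> Us Q i" "s \<in> Ss Q i"
  shows "projU Q (br Q u s) = u"
  unfolding projU_def
proof (rule the_equality)
  show "\<exists>i<num Q. u \<in> Us Q i \<and> (\<exists>s'\<in>Ss Q i. br Q u s = br Q u s')" using assms by blast
  fix v assume "\<exists>j<num Q. v \<in> Us Q j \<and> (\<exists>s'\<in>Ss Q j. br Q u s = br Q v s')"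
  then obtain j s' where v: "j < num Q" "v \<in> Us Q j" "s' \<in> Ss Q j" "br Q u s = br Q v s'" by blast
  then have "j = i" using rect_disjoint br_mem(3) assms by metis
  then show "v = u" using br_br_base assms v by metis
qed

lemma rect_projU:
  assumes "i < num Q" "p \<in> rect Q i"
  shows "projU Q p \<in> Us Q i"
  using assms projU_br unfolding rect_def by force

lemma rect_subset_basic: "i < num Q \<Longrightarrow> rect Q i \<subseteq> basic Q"
  using br_mem(1) unfolding rect_def by blast

section \<open>The return map and its symbolic dynamics\<close>

lemma closed_other_rects: "closed (\<Union>i\<in>{..<num Q} - {j}. rect Q i)"
  using rectangle(8) by (intro closed_UN) (auto intro: compact_imp_closed)

lemma continuous_orbit: "continuous_on UNIV (\<lambda>t. flow Q t x)"
proof -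
  have "continuous_on UNIV (\<lambda>t::real. (t, x))" by (intro continuous_intros)
  from continuous_on_compose2[OF continuous_flow this] show ?thesis by simp
qed

text \<open>For small times the orbit avoids the other rectangles, which are closed and disjoint
  from its own, and for positive times up to \<rho> it avoids its own by the cross-section property.
  So the return times stay away from 0, form a closed set and contain their infimum.\<close>

lemma return_attained:
  assumes "x \<in> Rset Q"
  shows "0 < return_time Q x" "return_time Q x \<le> \<rho>" "poincare Q x \<in> Rset Q"
proof -
  obtain j where j: "j < num Q" "x \<in> rect Q j" using assms by (auto simp: Rset_def)
  define E where "E = {t. 0 < t \<and> flow Q t x \<in> Rset Q}"
  define K where "K = (\<Union>i\<in>{..<num Q} - {j}. rect Q i)"
  obtain t1 where t1: "t1 \<in> E" "t1 \<le> \<rho>"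
    using recurrence rect_subset_basic j unfolding E_def by blast
  have "x \<notin> K" using j rect_disjoint by (auto simp: K_def)
  have "open ((\<lambda>t. flow Q t x) -` (- K))"
    using closed_other_rects[of j] continuous_orbit by (intro open_vimage) (simp_all only: K_def open_Compl)
  moreover have "0 \<in> (\<lambda>t. flow Q t x) -` (- K)" using \<open>x \<notin> K\<close> flow_0 by simp
  ultimately obtain d where d: "0 < d" "\<And>t. dist t 0 < d \<Longrightarrow> flow Q t x \<notin> K"
    unfolding open_dist by (metis ComplD vimageD)
  define d' where "d' = min d \<rho>"
  have "d' \<le> t" if "t \<in> E" for t
  proof (rule ccontr)
    assume "\<not> d' \<le> t"
    then have t: "0 < t" "t < d" "t \<le> \<rho>" "flow Q t x \<in> Rset Q" using that by (auto simp: d'_def E_def)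
    then have "flow Q t x \<notin> K" using d by simp
    moreover have "flow Q t x \<notin> rect Q j" using cross_time j t by blast
    ultimately show False using t by (auto simp: Rset_def K_def)
  qed
  moreover have d'0: "0 < d'" using d \<rho> by (simp add: d'_def)
  ultimately have E: "E = {d'..} \<inter> (\<lambda>t. flow Q t x) -` Rset Q" by (auto simp: E_def)
  have "closed (Rset Q)" unfolding Rset_def using rectangle(8) by (intro closed_UN) (auto intro: compact_imp_closed)
  then have "closed E" unfolding E using continuous_orbit by (intro closed_Int closed_vimage) auto
  moreover have bdd: "bdd_below E" unfolding E by (intro bdd_belowI[of _ d']) auto
  ultimately have "Inf E \<in> E" using t1 by (intro closed_contains_Inf) auto
  moreover have "Inf E \<le> \<rho>" using cInf_lower[OF t1(1) bdd] t1(2) by simp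
  moreover have "return_time Q x = Inf E" by (simp add: return_time_def E_def)
  ultimately show "0 < return_time Q x" "return_time Q x \<le> \<rho>" "poincare Q x \<in> Rset Q"
    by (auto simp: E_def poincare_def)
qed

lemma Uset_subset_Rset: "Uset Q \<subseteq> Rset Q"
  using Us_subset_rect by (auto simp: Uset_def Rset_def)

lemma Us_disj: "i < num Q \<Longrightarrow> j < num Q \<Longrightarrow> x \<in> Us Q i \<Longrightarrow> x \<in> Us Q j \<Longrightarrow> i = j"
  using rect_disjoint Us_subset_rect by blast

lemma shift_iff:
  assumes "x \<in> Uset Q" "j < num Q"
  shows "shift Q x \<in> Us Q j \<longleftrightarrow> poincare Q x \<in> rect Q j"
proof -
  have "poincare Q x \<in> Rset Q" using return_attained(3) assms Uset_subset_Rset by blast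
  then obtain i where i: "i < num Q" "poincare Q x \<in> rect Q i" by (auto simp: Rset_def)
  then have "shift Q x \<in> Us Q i" using rect_projU by (simp add: shift_def)
  then show ?thesis using i assms Us_disj rect_disjoint by blast
qed

lemma shift_Uset: "x \<in> Uset Q \<Longrightarrow> shift Q x \<in> Uset Q"
  using return_attained(3)[of x] Uset_subset_Rset shift_iff by (auto simp: Rset_def Uset_def subset_iff)

lemma continuous_poincare:
  assumes "i < num Q"
  shows "continuous_on (Us Q i) (poincare Q)"
proof -
  have "continuous_on (Us Q i) (\<lambda>x. (return_time Q x, x))"
    by (intro continuous_on_Pair continuous_return_time[OF assms] continuous_on_id)
  from continuous_on_compose2[OF continuous_flow this] show ?thesis by (simp add: poincare_def[abs_def])
qed

text \<open>
  Since the return time is continuous up to the boundary of \<open>U\<^sub>i\<close> and the rectangles are disjoint and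
  closed, the preimage of each rectangle is clopen in \<open>U\<^sub>i\<close>. Hence it contains points of the
  dense set \<^const>\<open>Uhat\<close>, at which the Markov property applies, and boundary points cause no harm.
\<close>

lemma locally_same_rect:
  assumes "i < num Q" "x \<in> Us Q i" "j < num Q" "poincare Q x \<in> rect Q j"
  shows "\<exists>d>0. \<forall>y\<in>Us Q i. dist y x < d \<longrightarrow> poincare Q y \<in> rect Q j"
proof -
  let ?K = "\<Union>l\<in>{..<num Q} - {j}. rect Q l"
  have "openin (top_of_set (Us Q i)) (Us Q i \<inter> poincare Q -` (- ?K))"
    using closed_other_rects[of j]
    by (intro continuous_openin_preimage_gen continuous_poincare assms(1)) (simp only: open_closed double_complement)
  moreover have "x \<in> Us Q i \<inter> poincare Q -` (- ?K)" using assms rect_disjoint by auto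
  ultimately obtain d where d: "d > 0" "\<And>y. y \<in> Us Q i \<Longrightarrow> dist y x < d \<Longrightarrow> poincare Q y \<notin> ?K"
    unfolding openin_euclidean_subtopology_iff by (metis ComplD Int_iff vimageD)
  have "poincare Q y \<in> Rset Q" if "y \<in> Us Q i" for y
    using return_attained(3) Uset_subset_Rset that assms(1) by (auto simp: Uset_def)
  then show ?thesis using d by (auto simp: Rset_def)
qed

lemma expansion_bounds:
  assumes "u \<in> Uset Q" "v \<in> Uset Q" 
    and "\<And>j. j \<le> m \<Longrightarrow> \<exists>i<num Q. (shift Q ^^ j) u \<in> Us Q i \<and> (shift Q ^^ j) v \<in> Us Q i"
  shows "\<kappa> * \<gamma>0 ^ m * dist u v \<le> dist ((shift Q ^^ m) u) ((shift Q ^^ m) v)"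
    and "dist ((shift Q ^^ m) u) ((shift Q ^^ m) v) \<le> inverse \<kappa> * \<gamma>1 ^ m * dist u v"
  using expansion assms unfolding expansion_constants_def by blast+

lemma constants: "0 < \<kappa>" "1 < \<gamma>0" "\<gamma>0 < \<gamma>1"
  using expansion unfolding expansion_constants_def by auto

text \<open>Nearby points return to the same rectangle, where the upper expansion bound with m = 1
  is a Lipschitz estimate.\<close>

lemma shift_continuous:
  assumes i: "i < num Q"
  shows "continuous_on (Us Q i) (shift Q)"
  unfolding continuous_on_iff
proof (intro ballI allI impI)
  fix x and e :: real assume x: "x \<in> Us Q i" and e: "0 < e"
  have xU: "x \<in> Uset Q" using x i by (auto simp: Uset_def)
  obtain j where j: "j < num Q" "poincare Q x \<in> rect Q j"
    using return_attained(3)[of x] Uset_subset_Rset xU by (auto simp: Rset_def)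
  obtain d where d: "d > 0" "\<And>y. y \<in> Us Q i \<Longrightarrow> dist y x < d \<Longrightarrow> poincare Q y \<in> rect Q j"
    using locally_same_rect[OF i x j] by blast
  show "\<exists>d>0. \<forall>y\<in>Us Q i. dist y x < d \<longrightarrow> dist (shift Q y) (shift Q x) < e"
  proof (intro exI[of _ "min d (e * \<kappa> / \<gamma>1)"] conjI ballI impI)
    show "0 < min d (e * \<kappa> / \<gamma>1)" using d e constants by simp
    fix y assume y: "y \<in> Us Q i" "dist y x < min d (e * \<kappa> / \<gamma>1)"
    have yU: "y \<in> Uset Q" using y i by (auto simp: Uset_def)
    have "\<exists>l<num Q. (shift Q ^^ n) y \<in> Us Q l \<and> (shift Q ^^ n) x \<in> Us Q l" if "n \<le> 1" for n
    proof (cases "n = 0")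
      case False
      then have "n = 1" using that by simp
      then show ?thesis using d(2) y j shift_iff[OF xU j(1)] shift_iff[OF yU j(1)] by auto
    qed (use i x y in auto)
    with expansion_bounds(2)[OF yU xU, of 1]
    have "dist (shift Q y) (shift Q x) \<le> \<gamma>1 / \<kappa> * dist y x" by (simp add: divide_inverse mult.commute)
    also have "\<dots> < \<gamma>1 / \<kappa> * (e * \<kappa> / \<gamma>1)" using y constants by (intro mult_strict_left_mono) auto
    also have "\<dots> = e" using constants by simp
    finally show "dist (shift Q y) (shift Q x) < e" .
  qed
qed

lemma Int_rect_if_not_boundary:
  "i < num Q \<Longrightarrow> x \<in> rect Q i \<Longrightarrow> x \<notin> boundary Q \<Longrightarrow> x \<in> Int_rect Q i"
  by (auto simp: boundary_def)

text \<open>The other pieces form a closed set that misses x, so points of the dense set close to x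
  lie in the same piece.\<close>

lemma Uhat_near:
  assumes i: "i < num Q" and x: "x \<in> Us Q i" and e: "0 < e"
  shows "\<exists>u\<in>Uhat Q \<inter> Us Q i. dist u x < e"
proof -
  define K where "K = (\<Union>l\<in>{..<num Q} - {i}. Us Q l)"
  have "closed K" unfolding K_def using rectangle(3) by (intro closed_UN) (auto intro: compact_imp_closed)
  moreover have "x \<notin> K" using x i Us_disj by (auto simp: K_def)
  ultimately obtain d where d: "0 < d" "\<And>y. dist y x < d \<Longrightarrow> y \<notin> K"
    by (metis ComplD ComplI open_Compl open_dist)
  have "x \<in> closure (Uhat Q)" using Uhat_dense x i by (auto simp: Uset_def)
  then obtain u where u: "u \<in> Uhat Q" "dist u x < min d e"
    using d e unfolding closure_approachable by (metis min_less_iff_conj)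
  then have "u \<in> Us Q i" using d(2)[of u] by (auto simp: Uhat_def Uset_def K_def)
  then show ?thesis using u by auto
qed

text \<open>The Markov property concerns interior points only. Applied at a nearby point of
  \<open>Uhat Q\<close>, with the base as stable coordinate, it shows that the image contains the
  interior of the piece; being compact, the image contains the closure too.\<close>

lemma full_branch_shift:
  assumes i: "i < num Q" and j: "j < num Q" and x: "x \<in> Us Q i" "shift Q x \<in> Us Q j"
  shows "Us Q j \<subseteq> shift Q ` Us Q i"
proof -
  have xU: "x \<in> Uset Q" using x i by (auto simp: Uset_def)
  then have "poincare Q x \<in> rect Q j" using shift_iff j x by blast
  then obtain d where d: "d > 0" "\<And>y. y \<in> Us Q i \<Longrightarrow> dist y x < d \<Longrightarrow> poincare Q y \<in> rect Q j"
    using locally_same_rect[OF i x(1) j] by blast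
  obtain u where u: "u \<in> Uhat Q" "u \<in> Us Q i" "dist u x < d" using Uhat_near[OF i x(1) d(1)] by blast
  have nb: "(poincare Q ^^ n) u \<notin> boundary Q" for n using u(1) by (simp add: Uhat_def)
  have "u \<in> Int_rect Q i"
    using nb[of 0] u(2) Us_subset_rect i by (intro Int_rect_if_not_boundary) auto
  then obtain u0 s0 where u0: "u = br Q u0 s0" "u0 \<in> IntU Q i" "s0 \<in> IntS Q i" by (auto simp: Int_rect_def)
  \<comment> \<open>The unstable coordinate of a point of the piece is the point itself, so u is an
    interior point of the piece.\<close>
  have "u0 = br Q u (base Q i)" 
    using br_br_base[OF i subsetD[OF IntU_subset u0(2)] subsetD[OF IntS_subset u0(3)]] u0(1) by simp
  then have uI: "u \<in> IntU Q i" using br_base[OF i u(2)] u0 by simp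
  have "poincare Q u \<in> Int_rect Q j"
    using nb[of 1] d(2)[OF u(2,3)] by (intro Int_rect_if_not_boundary j) auto
  then obtain u' s' where u': "poincare Q u = br Q u' s'" "u' \<in> IntU Q j" "s' \<in> IntS Q j"
    by (auto simp: Int_rect_def)
  then have "(\<lambda>x. br Q x s') ` IntU Q j \<subseteq> poincare Q ` ((\<lambda>x. br Q x (base Q i)) ` IntU Q i)"
    using markov_property[rule_format, OF i j uI rectangle(6)[OF i] u'(2,3)] u'(1) br_base[OF i u(2)] by simp
  have sub: "IntU Q j \<subseteq> shift Q ` Us Q i"
  proof
    fix v assume v: "v \<in> IntU Q j"
    then obtain y where y: "y \<in> IntU Q i" "br Q v s' = poincare Q (br Q y (base Q i))"
      using \<open>(\<lambda>x. br Q x s') ` IntU Q j \<subseteq> _\<close> by blast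
    have "y \<in> Us Q i" using y IntU_subset by blast
    then have "shift Q y = projU Q (br Q v s')" using y br_base[OF i] by (simp add: shift_def)
    also have "\<dots> = v" using projU_br[OF j] v u'(3) IntU_subset IntS_subset by blast
    finally show "v \<in> shift Q ` Us Q i" using \<open>y \<in> Us Q i\<close> by blast
  qed
  have "compact (shift Q ` Us Q i)"
    using shift_continuous[OF i] rectangle(3)[OF i] by (rule compact_continuous_image)
  then have "closure (IntU Q j) \<subseteq> shift Q ` Us Q i"
    using sub compact_imp_closed closure_minimal by blast
  moreover have "Us Q j \<subseteq> closure (IntU Q j)"
  proof -
    have "Utop Q j closure_of IntU Q j \<subseteq> euclidean closure_of IntU Q j"
      unfolding Utop_def by (rule closure_of_subtopology_subset)
    then show ?thesis using rectangle(4)[OF j] by (metis euclidean_closure_of)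
  qed
  ultimately show ?thesis by blast
qed

text \<open>The Markov property along stable leaves lets p slide to the point u on its leaf: the
  return point stays on the stable leaf of u' and so projects to u'.\<close>

lemma transition_shift:
  assumes "(i, j) \<in> transition Q"
  shows "i < num Q \<and> j < num Q \<and> (\<exists>x\<in>Us Q i. shift Q x \<in> Us Q j)"
proof -
  obtain p where p: "i < num Q" "j < num Q" "p \<in> Int_rect Q i" "poincare Q p \<in> Int_rect Q j"
    using assms by (auto simp: transition_def)
  obtain u s where u: "p = br Q u s" "u \<in> IntU Q i" "s \<in> IntS Q i" using p by (auto simp: Int_rect_def)
  obtain u' s' where u': "poincare Q p = br Q u' s'" "u' \<in> IntU Q j" "s' \<in> IntS Q j" 
    using p by (auto simp: Int_rect_def)
  have "poincare Q ` (br Q u ` IntS Q i) \<subseteq> br Q u' ` IntS Q j"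
    using markov_property[rule_format, OF p(1,2) u(2,3) u'(2,3)] u(1) u'(1) by simp
  then obtain s'' where s'': "s'' \<in> IntS Q j" "poincare Q (br Q u (base Q i)) = br Q u' s''"
    using rectangle(6)[OF p(1)] by blast
  have uU: "u \<in> Us Q i" using u IntU_subset by blast
  then have "shift Q u = projU Q (br Q u' s'')" using s'' br_base[OF p(1)] by (simp add: shift_def)
  also have "\<dots> = u'" using projU_br[OF p(2)] u'(2) s''(1) IntU_subset IntS_subset by blast
  finally show ?thesis using uU u'(2) p IntU_subset by blast
qed

sublocale markov_map Q \<kappa> \<gamma>0
proof
  show "compact (Us Q i)" if "i < num Q" for i using rectangle(3) that .
  show "Us Q i \<noteq> {}" if "i < num Q" for i using base_in(1) that by blast
  show "i = j" if "i < num Q" "j < num Q" "x \<in> Us Q i" "x \<in> Us Q j" for i j x using Us_disj that .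
  show "shift Q x \<in> Uset Q" if "x \<in> Uset Q" for x using shift_Uset that .
  show "continuous_on (Us Q i) (shift Q)" if "i < num Q" for i using shift_continuous that .
  show "Us Q j \<subseteq> shift Q ` Us Q i" if "i < num Q" "j < num Q" "x \<in> Us Q i" "shift Q x \<in> Us Q j" for i j x
    using full_branch_shift that .
  \<comment> \<open>The return happens within time \<rho>, during which a cross section cannot be
    hit again.\<close>
  show "shift Q x \<notin> Us Q i" if i: "i < num Q" "x \<in> Us Q i" for i x
  proof
    assume "shift Q x \<in> Us Q i"
    moreover have x: "x \<in> Uset Q" "x \<in> Rset Q" "x \<in> rect Q i"
      using i Uset_subset_Rset Us_subset_rect by (auto simp: Uset_def)
    ultimately have "flow Q (return_time Q x) x \<in> rect Q i"
      using shift_iff i by (simp add: poincare_def)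
    then show False using cross_time[OF i(1) return_attained(1,2)[OF x(2)] x(3)] by simp
  qed
  show "(i, j) \<in> {(i, j). i < num Q \<and> j < num Q \<and> (\<exists>x\<in>Us Q i. shift Q x \<in> Us Q j)}\<^sup>+"
    if "i < num Q" "j < num Q" for i j
  proof -
    have "(i, j) \<in> (transition Q)\<^sup>+"
      using irreducible_transition that unfolding irreducible_aperiodic_def by blast
    moreover have "transition Q \<subseteq> {(i, j). i < num Q \<and> j < num Q \<and> (\<exists>x\<in>Us Q i. shift Q x \<in> Us Q j)}"
      using transition_shift by auto
    ultimately show ?thesis using trancl_mono by blast
  qed
qed (use num_pos constants expansion_bounds(1) in auto)

text \<open>The set \<open>Uhat Q\<close> is dense in each piece, and both sides of the estimate are
  continuous, the right one also at distance 0 because the exponent is positive.\<close>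

lemma hoelder_on_Us:
  fixes w :: "'m \<Rightarrow> real"
  assumes w: "hoelder_extended Q \<nu> w" and \<nu>: "0 < \<nu>" and i: "i < num Q"
  shows "hoelder_on \<nu> (Us Q i) w"
proof -
  obtain C where C: "\<And>x y. x \<in> Us Q i \<inter> Uhat Q \<Longrightarrow> y \<in> Us Q i \<inter> Uhat Q \<Longrightarrow> norm (w x - w y) \<le> C * dist x y powr \<nu>"
    using w i unfolding hoelder_extended_def hoelder_on_def by blast
  have cont: "continuous_on (Us Q i) w" using w i by (simp add: hoelder_extended_def)
  have app: "\<exists>X. (\<forall>n. X n \<in> Us Q i \<inter> Uhat Q) \<and> X \<longlonglongrightarrow> x" if "x \<in> Us Q i" for x
  proof -
    have "x \<in> closure (Us Q i \<inter> Uhat Q)"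
      unfolding closure_approachable using Uhat_near[OF i that] by (metis Int_commute)
    then show ?thesis by (simp add: closure_sequential)
  qed
  have "norm (w x - w y) \<le> C * dist x y powr \<nu>" if x: "x \<in> Us Q i" and y: "y \<in> Us Q i" for x y
  proof -
    obtain X where X: "\<And>n. X n \<in> Us Q i \<inter> Uhat Q" "X \<longlonglongrightarrow> x" using app[OF x] by blast
    obtain Y where Y: "\<And>n. Y n \<in> Us Q i \<inter> Uhat Q" "Y \<longlonglongrightarrow> y" using app[OF y] by blast
    have wX: "(\<lambda>n. w (X n)) \<longlonglongrightarrow> w x" and wY: "(\<lambda>n. w (Y n)) \<longlonglongrightarrow> w y"
      using X Y x y by (auto intro!: continuous_on_tendsto_compose[OF cont])
    show ?thesis
    proof (rule LIMSEQ_le)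
      show "(\<lambda>n. norm (w (X n) - w (Y n))) \<longlonglongrightarrow> norm (w x - w y)"
        by (intro tendsto_intros wX wY)
      show "(\<lambda>n. C * dist (X n) (Y n) powr \<nu>) \<longlonglongrightarrow> C * dist x y powr \<nu>"
        using \<nu> by (intro tendsto_mult tendsto_const tendsto_powr' tendsto_dist X Y) auto
      show "\<exists>N. \<forall>n\<ge>N. norm (w (X n) - w (Y n)) \<le> C * dist (X n) (Y n) powr \<nu>"
        using C X Y by blast
    qed
  qed
  then show ?thesis unfolding hoelder_on_def by blast
qed

end

section \<open>Transfer operators\<close>

text \<open>On the convex half plane Re z \<le> ln W the derivative of exp is bounded by W. The
  factor W thus involves real parts only, and imaginary parts enter just through the
  difference.\<close>

lemma norm_exp_diff_le:
  fixes a b :: complex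
  assumes "exp (Re a) \<le> W" "exp (Re b) \<le> W"
  shows "cmod (exp a - exp b) \<le> W * cmod (a - b)"
proof -
  have W: "0 < W" using assms(1) exp_gt_zero[of "Re a"] by linarith
  have h: "z \<in> {z. Re z \<le> ln W} \<longleftrightarrow> exp (Re z) \<le> W" for z using W by (simp add: ln_ge_iff)
  show ?thesis
  proof (rule field_differentiable_bound[where S = "{z. Re z \<le> ln W}" and f' = exp])
    show "convex {z. Re z \<le> ln W}" by (rule convex_halfspace_Re_le)
    show "cmod (exp z) \<le> W" if "z \<in> {z. Re z \<le> ln W}" for z using that h by simp
  qed (use assms h in \<open>auto intro!: derivative_eq_intros\<close>)
qed

context markov_map
begin

lemma transfer_op_funpow:
  "x \<in> X \<Longrightarrow> (transfer_op Q h ^^ n) v x = (\<Sum>y | y \<in> X \<and> (T ^^ n) y = x. exp (bsum n h y) * v y)"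
proof (induction n arbitrary: x)
  case 0
  then have "{y. y \<in> X \<and> y = x} = {x}" by auto
  then show ?case by (simp add: birkhoff_sum_def)
next
  case (Suc n)
  let ?F = "\<lambda>w. exp (bsum (Suc n) h w) * v w"
  have "(transfer_op Q h ^^ Suc n) v x = (\<Sum>y | y \<in> X \<and> T y = x. exp (h y) * (transfer_op Q h ^^ n) v y)"
    by (simp add: transfer_op_def)
  also have "\<dots> = (\<Sum>y | y \<in> X \<and> T y = x. \<Sum>w | w \<in> {w. w \<in> X \<and> (T ^^ Suc n) w = x} \<and> (T ^^ n) w = y. ?F w)"
  proof (intro sum.cong refl)
    fix y assume y: "y \<in> {y. y \<in> X \<and> T y = x}"
    then have "exp (h y) * (transfer_op Q h ^^ n) v y = 
      (\<Sum>w | w \<in> X \<and> (T ^^ n) w = y. exp (h y) * (exp (bsum n h w) * v w))"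
      using Suc.IH[of y] by (simp add: sum_distrib_left)
    also have "\<dots> = (\<Sum>w | w \<in> {w. w \<in> X \<and> (T ^^ Suc n) w = x} \<and> (T ^^ n) w = y. ?F w)"
      using y by (intro sum.cong) (auto simp: birkhoff_sum_def exp_add)
    finally show "exp (h y) * (transfer_op Q h ^^ n) v y = \<dots>" .
  qed
  also have "\<dots> = (\<Sum>w | w \<in> X \<and> (T ^^ Suc n) w = x. ?F w)"
    by (intro sum.group finite_preimage finite_preimage1) (auto intro: funpow_in)
  finally show ?case .
qed

text \<open>\<open>T ^^ m\<close> is injective on a cylinder of length m, so the sum over preimages
  has a single nonzero term at most.\<close>

lemma transfer_op_branch:
  assumes ws: "ws \<in> wds m" and y: "y \<in> cyl ws" "(T ^^ m) y = x"
  shows "(transfer_op Q h ^^ m) (\<lambda>y. indicator (cyl ws) y * u y) x = exp (bsum m h y) * u y"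
proof -
  let ?F = "\<lambda>y. exp (bsum m h y) * (indicator (cyl ws) y * u y)"
  have "y \<in> X" using y cyl_subset_X by blast
  then have x: "x \<in> X" using y funpow_in by blast
  have "(\<Sum>y | y \<in> X \<and> (T ^^ m) y = x. ?F y) = (\<Sum>y\<in>{y}. ?F y)"
  proof (intro sum.mono_neutral_right finite_preimage ballI)
    fix w assume w: "w \<in> {w. w \<in> X \<and> (T ^^ m) w = x} - {y}"
    then have "w \<notin> cyl ws" using inj_cyl[OF ws _ y(1), of w] y(2) by auto
    then show "?F w = 0" by simp
  qed (use y \<open>y \<in> X\<close> in auto)
  then show ?thesis using y by (simp add: transfer_op_funpow[OF x])
qed

lemma transfer_op_branch_0:
  assumes "\<And>y. y \<in> cyl ws \<Longrightarrow> (T ^^ m) y \<noteq> x" "x \<in> X"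
  shows "(transfer_op Q h ^^ m) (\<lambda>y. indicator (cyl ws) y * u y) x = 0"
  unfolding transfer_op_funpow[OF assms(2)] using assms(1) by (intro sum.neutral) (auto simp: indicator_def)

text \<open>Explicit bounds replace the suprema of \<open>hoelder_norm\<close>, so that sums and
  products can be estimated without checking boundedness each time. The range is general, to serve
  real potentials and complex functions alike.\<close>

definition hoelder_bound :: "real \<Rightarrow> ('m \<Rightarrow> 'b::real_normed_vector) \<Rightarrow> real \<Rightarrow> real \<Rightarrow> bool" where
  "hoelder_bound \<nu> v A B \<longleftrightarrow> (\<forall>x\<in>X. norm (v x) \<le> A) \<and>
     (\<forall>i<k. \<forall>x\<in>U i. \<forall>y\<in>U i. norm (v x - v y) \<le> B * dist x y powr \<nu>)"

lemma hoelder_bound_add: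
  assumes "hoelder_bound \<nu> v A B" "hoelder_bound \<nu> w A' B'"
  shows "hoelder_bound \<nu> (\<lambda>x. v x + w x) (A + A') (B + B')"
  using assms unfolding hoelder_bound_def
  by (auto simp: distrib_right add_diff_add intro!: norm_triangle_mono)

lemma hoelder_bound_sum:
  fixes A B :: real
  assumes "\<And>i. i \<in> I \<Longrightarrow> hoelder_bound \<nu> (v i) A B"
  shows "hoelder_bound \<nu> (\<lambda>x. \<Sum>i\<in>I. v i x) (card I * A) (card I * B)"
  using assms
proof (induction I rule: infinite_finite_induct)
  case (insert i I)
  then have "hoelder_bound \<nu> (\<lambda>x. v i x + (\<Sum>i\<in>I. v i x)) (A + card I * A) (B + card I * B)"
    by (intro hoelder_bound_add) auto
  then show ?case using insert by (simp add: algebra_simps)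
qed (auto simp: hoelder_bound_def)

lemma hoelder_bound_scale:
  fixes v :: "'m \<Rightarrow> 'b::real_normed_field"
  assumes "hoelder_bound \<nu> v A B"
  shows "hoelder_bound \<nu> (\<lambda>x. c * v x) (norm c * A) (norm c * B)"
  using assms unfolding hoelder_bound_def
  by (auto simp: norm_mult mult.assoc right_diff_distrib[symmetric] intro!: mult_left_mono)

lemma hoelder_bound_of_real:
  "hoelder_bound \<nu> v A B \<Longrightarrow> hoelder_bound \<nu> (\<lambda>x. complex_of_real (v x)) A B"
  by (simp add: hoelder_bound_def flip: of_real_diff)

lemma hoelder_bound_mono:
  assumes "hoelder_bound \<nu> v A B" "A \<le> A'" "B \<le> B'"
  shows "hoelder_bound \<nu> v A' B'"
  using assms(1) order.trans[OF _ assms(2)] order.trans[OF _ mult_right_mono[OF assms(3) powr_ge_zero]]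
  unfolding hoelder_bound_def by blast

lemma hoelder_bound_cong:
  "hoelder_bound \<nu> v A B \<Longrightarrow> (\<And>x. x \<in> X \<Longrightarrow> v x = w x) \<Longrightarrow> hoelder_bound \<nu> w A B"
proof -
  assume v: "hoelder_bound \<nu> v A B" and eq: "\<And>x. x \<in> X \<Longrightarrow> v x = w x"
  have "v x = w x" if "i < k" "x \<in> U i" for i x using eq U_subset_X that by blast
  then show "hoelder_bound \<nu> w A B" using v eq by (simp add: hoelder_bound_def)
qed

lemma hoelder_if_bound: "hoelder_bound \<nu> v A B \<Longrightarrow> hoelder Q \<nu> v"
  unfolding hoelder_bound_def hoelder_def hoelder_on_def by blast

lemma hoelder_norm_le:
  assumes v: "hoelder_bound \<nu> v A B" and B: "0 \<le> B"
  shows "hoelder_norm Q \<nu> v \<le> A + B"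
proof -
  have "(SUP x\<in>X. cmod (v x)) \<le> A"
    using v X_nonempty unfolding hoelder_bound_def by (intro cSUP_least) auto
  moreover have "Sup (insert 0 {cmod (v x - v y) / dist x y powr \<nu> | x y i.
      i < k \<and> x \<in> U i \<and> y \<in> U i \<and> x \<noteq> y}) \<le> B"
  proof (intro cSup_least)
    fix r assume "r \<in> insert 0 {cmod (v x - v y) / dist x y powr \<nu> | x y i. i < k \<and> x \<in> U i \<and> y \<in> U i \<and> x \<noteq> y}"
    then show "r \<le> B"
    proof
      assume "r \<in> {cmod (v x - v y) / dist x y powr \<nu> | x y i. i < k \<and> x \<in> U i \<and> y \<in> U i \<and> x \<noteq> y}"
      then obtain x y i where r: "r = cmod (v x - v y) / dist x y powr \<nu>" and "i < k" "x \<in> U i" "y \<in> U i" "x \<noteq> y"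
        by blast
      moreover from this have "cmod (v x - v y) \<le> B * dist x y powr \<nu>" using v unfolding hoelder_bound_def by blast
      ultimately show "r \<le> B" by (simp add: divide_le_eq)
    qed (use B in simp)
  qed simp
  ultimately show ?thesis unfolding hoelder_norm_def by linarith
qed

text \<open>The sup bound comes from the value at one point of each piece, as the pieces have
  bounded diameter.\<close>

lemma hoelder_bound_exists:
  fixes w :: "'m \<Rightarrow> 'b::real_normed_vector"
  assumes w: "hoelder Q \<nu> w" and \<nu>: "0 < \<nu>"
  shows "\<exists>A\<ge>0. \<exists>B\<ge>0. hoelder_bound \<nu> w A B"
proof -
  have "\<forall>i. \<exists>C. i < k \<longrightarrow> (\<forall>x\<in>U i. \<forall>y\<in>U i. norm (w x - w y) \<le> C * dist x y powr \<nu>)"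
    using w unfolding hoelder_def hoelder_on_def by blast
  then obtain C where C: "\<And>i x y. i < k \<Longrightarrow> x \<in> U i \<Longrightarrow> y \<in> U i \<Longrightarrow> norm (w x - w y) \<le> C i * dist x y powr \<nu>"
    by metis
  define B where "B = (\<Sum>i<k. \<bar>C i\<bar>)"
  have B0: "0 \<le> B" by (simp add: B_def)
  have B: "norm (w x - w y) \<le> B * dist x y powr \<nu>" if "i < k" "x \<in> U i" "y \<in> U i" for i x y
  proof -
    have "C i \<le> \<bar>C i\<bar>" by simp
    also have "\<dots> \<le> B" unfolding B_def using that by (intro member_le_sum) auto
    finally have "C i * dist x y powr \<nu> \<le> B * dist x y powr \<nu>" by (intro mult_right_mono) auto
    then show ?thesis using C[OF that] by simp
  qed
  define p where "p i = (SOME x. x \<in> U i)" for i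
  have p: "p i \<in> U i" if "i < k" for i
    unfolding p_def using Us_nonempty[OF that] some_in_eq by blast
  define A where "A = (\<Sum>i<k. norm (w (p i))) + B * diam powr \<nu>"
  have "norm (w x) \<le> A" if x: "x \<in> X" for x
  proof -
    obtain i where i: "i < k" "x \<in> U i" using x Uset_iff by blast
    have "norm (w x) \<le> norm (w (p i)) + norm (w x - w (p i))" by (metis norm_triangle_sub)
    also have "norm (w (p i)) \<le> (\<Sum>i<k. norm (w (p i)))"
      using i by (intro member_le_sum) auto
    also have "norm (w x - w (p i)) \<le> B * dist x (p i) powr \<nu>" using B i p by blast
    also have "\<dots> \<le> B * diam powr \<nu>"
      using i p[OF i(1)] U_subset_X[OF i(1)] \<nu> B0
      by (intro mult_left_mono powr_mono2 dist_le_diam) auto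
    finally show ?thesis by (simp add: A_def)
  qed
  moreover have "0 \<le> A" unfolding A_def using B0 by (intro add_nonneg_nonneg sum_nonneg) auto
  ultimately show ?thesis using B B0 unfolding hoelder_bound_def by blast
qed

text \<open>A converse to \<open>hoelder_norm_le\<close>, with the supremum and the seminorm
  themselves as bounds. Boundedness is checked beforehand, as \<open>Sup\<close> of an unbounded set
  of reals says nothing.\<close>

lemma hoelder_norm_split:
  assumes v: "hoelder Q \<nu> v" and \<nu>: "0 < \<nu>"
  shows "\<exists>A B. 0 \<le> A \<and> 0 \<le> B \<and> hoelder_norm Q \<nu> v = A + B \<and> hoelder_bound \<nu> v A B"
proof -
  obtain A0 C0 where C0: "0 \<le> C0" "hoelder_bound \<nu> v A0 C0"
    using hoelder_bound_exists[OF v \<nu>] by blast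
  let ?R = "insert 0 {cmod (v x - v y) / dist x y powr \<nu> | x y i. i < k \<and> x \<in> U i \<and> y \<in> U i \<and> x \<noteq> y}"
  define A where "A = (SUP x\<in>X. cmod (v x))"
  define B where "B = Sup ?R"
  have bR: "bdd_above ?R"
    using C0 by (intro bdd_aboveI[of _ C0]) (auto simp: divide_le_eq hoelder_bound_def)
  then have B0: "0 \<le> B" unfolding B_def by (intro cSup_upper) auto
  have bA: "bdd_above ((\<lambda>x. cmod (v x)) ` X)"
    using C0(2) unfolding hoelder_bound_def by (intro bdd_aboveI2[of _ _ A0]) blast
  then have A: "cmod (v x) \<le> A" if "x \<in> X" for x unfolding A_def using that by (intro cSUP_upper)
  then have A0: "0 \<le> A" using X_nonempty by (metis ex_in_conv norm_ge_zero order.trans)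
  have "cmod (v x - v y) \<le> B * dist x y powr \<nu>" if "i < k" "x \<in> U i" "y \<in> U i" for i x y
  proof (cases "x = y")
    case False
    then have "cmod (v x - v y) / dist x y powr \<nu> \<le> B"
      unfolding B_def using that bR by (intro cSup_upper) auto
    then show ?thesis using False by (simp add: divide_le_eq)
  qed simp
  then have "hoelder_bound \<nu> v A B" using A by (simp add: hoelder_bound_def)
  moreover have "hoelder_norm Q \<nu> v = A + B" by (simp add: hoelder_norm_def A_def B_def)
  ultimately show ?thesis using A0 B0 by blast
qed

text \<open>B and D concern the real part only and can be chosen uniformly for bounded Re s and Re
  z. E is the Hoelder constant of the complex Birkhoff sums along inverse branches and carries all
  dependence on the imaginary parts.\<close>

definition transfer_potential ::
  "real \<Rightarrow> ('m \<Rightarrow> complex) \<Rightarrow> ('m \<Rightarrow> real) \<Rightarrow> real \<Rightarrow> real \<Rightarrow> real \<Rightarrow> bool" where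
  "transfer_potential \<nu> h \<phi> B D E \<longleftrightarrow> 0 < \<nu> \<and> 0 \<le> E \<and> potential \<phi> B D \<and> (\<forall>x. Re (h x) = \<phi> x) \<and>
     (\<forall>n. \<forall>ws\<in>wds n. \<forall>x\<in>cyl ws. \<forall>y\<in>cyl ws. letter ((T ^^ n) x) = letter ((T ^^ n) y) \<longrightarrow>
        cmod (bsum n h x - bsum n h y) \<le> E * dist ((T ^^ n) x) ((T ^^ n) y) powr \<nu>)"

lemma Re_birkhoff:
  assumes "transfer_potential \<nu> h \<phi> B D E"
  shows "Re (bsum n h x) = bsum n \<phi> x"
  using assms by (simp add: birkhoff_sum_def transfer_potential_def)

text \<open>On a piece the inverse branch is defined everywhere or nowhere, by
  \<open>cyl_onto\<close>. Where it is defined, the product rule gives two terms: A E from the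
  distortion of the weight and C (1/\<kappa>)^\<nu> from composing u with the branch.\<close>

lemma hoelder_bound_branch:
  assumes h: "transfer_potential \<nu> h \<phi> B D E" and ws: "ws \<in> wds m" "0 < m"
    and u: "hoelder_bound \<nu> u A C" and AC: "0 \<le> A" "0 \<le> C"
    and W: "cyl ws \<noteq> {} \<Longrightarrow> exp (bsum m \<phi> (pt ws) + D) \<le> W" "0 \<le> W"
  shows "hoelder_bound \<nu> ((transfer_op Q h ^^ m) (\<lambda>y. indicator (cyl ws) y * u y)) (W * A)
    (W * (A * E + C * (1 / \<kappa>) powr \<nu>))"
proof -
  let ?L = "(transfer_op Q h ^^ m) (\<lambda>y. indicator (cyl ws) y * u y)"
  have nu: "0 < \<nu>" "0 \<le> E" using h by (auto simp: transfer_potential_def)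
  have expW: "exp (bsum m \<phi> y) \<le> W" if "y \<in> cyl ws" for y
  proof -
    have ne: "cyl ws \<noteq> {}" using that by blast
    then have "bsum m \<phi> y \<le> bsum m \<phi> (pt ws) + D"
      using h ws that pt_in unfolding transfer_potential_def potential_def by blast
    then show ?thesis using W(1)[OF ne] by (metis exp_le_cancel_iff order.trans)
  qed
  have "cmod (?L x) \<le> W * A" if x: "x \<in> X" for x
  proof (cases "\<exists>y\<in>cyl ws. (T ^^ m) y = x")
    case True
    then obtain y where y: "y \<in> cyl ws" "(T ^^ m) y = x" by blast
    have "cmod (?L x) = exp (bsum m \<phi> y) * cmod (u y)"
      by (simp add: transfer_op_branch[OF ws(1) y] norm_mult Re_birkhoff[OF h])
    also have "\<dots> \<le> W * A"
      using expW[OF y(1)] u y(1) cyl_subset_X W(2) unfolding hoelder_bound_def by (intro mult_mono) auto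
    finally show ?thesis .
  next
    case False
    then have "?L x = 0" using x by (intro transfer_op_branch_0) auto
    then show ?thesis using W AC by simp
  qed
  moreover have "cmod (?L x - ?L x') \<le> W * (A * E + C * (1 / \<kappa>) powr \<nu>) * dist x x' powr \<nu>"
    if x: "i < k" "x \<in> U i" "x' \<in> U i" for i x x'
  proof (cases "\<exists>y\<in>cyl ws. (T ^^ m) y \<in> U i")
    case True
    then obtain y0 where y0: "y0 \<in> cyl ws" "(T ^^ m) y0 \<in> U i" by blast
    obtain y where y: "y \<in> cyl ws" "(T ^^ m) y = x" using cyl_onto[OF ws y0 x(1,2)] by blast
    obtain y' where y': "y' \<in> cyl ws" "(T ^^ m) y' = x'" using cyl_onto[OF ws y0 x(1,3)] by blast
    let ?h = "bsum m h"
    have l: "letter ((T ^^ m) y) = letter ((T ^^ m) y')" using y y' x letter_eq by metis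
    have hd: "cmod (?h y - ?h y') \<le> E * dist x x' powr \<nu>"
      using h ws(1) y y' l unfolding transfer_potential_def by metis
    have "dist y y' \<le> dist x x' / (\<kappa> * \<gamma> ^ m)"
      using dist_cyl_end[OF ws(1) y(1) y'(1) l, of 0] y y' by simp
    \<comment> \<open>The contraction by \<gamma>^m is given away in favour of a bound uniform in
      m.\<close>
    also have "\<dots> \<le> dist x x' / \<kappa>"
      using \<kappa>_pos \<gamma>_gt_1 by (intro divide_left_mono) (auto simp: mult_le_cancel_left1)
    finally have "dist y y' powr \<nu> \<le> (1 / \<kappa> * dist x x') powr \<nu>" using nu by (intro powr_mono2) auto
    also have "\<dots> = (1 / \<kappa>) powr \<nu> * dist x x' powr \<nu>" by (rule powr_mult)
    finally have dy: "dist y y' powr \<nu> \<le> (1 / \<kappa>) powr \<nu> * dist x x' powr \<nu>" .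
    have "y \<in> U (hd ws)" "y' \<in> U (hd ws)" "hd ws < k"
      using y y' cyl_subset_U[OF ws] ws by (auto simp: wds_def intro!: subsetD[of "set ws" "{..<k}", simplified] hd_in_set)
    then have ud: "cmod (u y - u y') \<le> C * dist y y' powr \<nu>" using u unfolding hoelder_bound_def by blast
    have uA: "cmod (u y) \<le> A" using u y cyl_subset_X unfolding hoelder_bound_def by blast
    have "?L x - ?L x' = (exp (?h y) - exp (?h y')) * u y + exp (?h y') * (u y - u y')"
      unfolding transfer_op_branch[OF ws(1) y] transfer_op_branch[OF ws(1) y'] by (simp add: algebra_simps)
    then have "cmod (?L x - ?L x') \<le> cmod ((exp (?h y) - exp (?h y')) * u y) + cmod (exp (?h y') * (u y - u y'))"
      by (simp only: norm_triangle_ineq)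
    also have "\<dots> = cmod (exp (?h y) - exp (?h y')) * cmod (u y) + cmod (exp (?h y')) * cmod (u y - u y')"
      by (simp only: norm_mult)
    also have "\<dots> \<le> (W * (E * dist x x' powr \<nu>)) * A + W * (C * ((1 / \<kappa>) powr \<nu> * dist x x' powr \<nu>))"
    proof (intro add_mono mult_mono)
      have "cmod (exp (?h y) - exp (?h y')) \<le> W * cmod (?h y - ?h y')"
        using expW[OF y(1)] expW[OF y'(1)] by (intro norm_exp_diff_le) (simp_all add: Re_birkhoff[OF h])
      also have "\<dots> \<le> W * (E * dist x x' powr \<nu>)" using hd W by (intro mult_left_mono)
      finally show "cmod (exp (?h y) - exp (?h y')) \<le> W * (E * dist x x' powr \<nu>)" .
      show "cmod (exp (?h y')) \<le> W" using expW[OF y'(1)] by (simp add: Re_birkhoff[OF h])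
      show "cmod (u y - u y') \<le> C * ((1 / \<kappa>) powr \<nu> * dist x x' powr \<nu>)"
        using ud mult_left_mono[OF dy AC(2)] by (rule order.trans)
    qed (use uA W AC nu in auto)
    also have "\<dots> = W * (A * E + C * (1 / \<kappa>) powr \<nu>) * dist x x' powr \<nu>" by (simp add: algebra_simps)
    finally show ?thesis .
  next
    case False
    then have "?L x = 0" "?L x' = 0" using x U_subset_X by (auto intro!: transfer_op_branch_0)
    then show ?thesis using W AC nu by simp
  qed
  ultimately show ?thesis unfolding hoelder_bound_def by blast
qed

lemma indicator_partition:
  assumes "y \<in> X"
  shows "(\<Sum>i<k. indicator (U i) y * u y) = (u y :: complex)"
proof -
  have "(\<Sum>i<k. indicator (U i) y * u y) = (\<Sum>i\<in>{letter y}. indicator (U i) y * u y)"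
    using letter_less[OF assms] in_U_iff[OF assms] by (intro sum.mono_neutral_right) auto
  then show ?thesis using in_U_letter[OF assms] by simp
qed

lemma transfer_op_sum_branches:
  assumes "x \<in> X"
  shows "transfer_op Q h v x = (\<Sum>i<k. (transfer_op Q h ^^ 1) (\<lambda>y. indicator (cyl [i]) y * v y) x)"
proof -
  have "transfer_op Q h v x = (\<Sum>y | y \<in> X \<and> T y = x. \<Sum>i<k. exp (h y) * (indicator (U i) y * v y))"
    unfolding transfer_op_def
  proof (intro sum.cong refl)
    fix y assume "y \<in> {y. y \<in> X \<and> T y = x}"
    then show "exp (h y) * v y = (\<Sum>i<k. exp (h y) * (indicator (U i) y * v y))"
      using indicator_partition[of y v] by (simp only: sum_distrib_left[symmetric]) simp
  qed
  also have "\<dots> = (\<Sum>i<k. \<Sum>y | y \<in> X \<and> T y = x. exp (h y) * (indicator (U i) y * v y))" by (rule sum.swap)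
  finally show ?thesis by (simp add: transfer_op_def cyl_single)
qed

text \<open>The operator is the sum of its k one-letter branches, each bounded by
  \<open>hoelder_bound_branch\<close>. This is what keeps the supremum in \<open>op_norm\<close>
  finite.\<close>

lemma transfer_op_bounded:
  assumes h: "transfer_potential \<nu> h \<phi> B D E"
  shows "\<exists>c\<ge>0. \<forall>v. hoelder Q \<nu> v \<longrightarrow> hoelder Q \<nu> (transfer_op Q h v) \<and>
    hoelder_norm Q \<nu> (transfer_op Q h v) \<le> c * hoelder_norm Q \<nu> v"
proof -
  have nu: "0 < \<nu>" "0 \<le> E" using h by (auto simp: transfer_potential_def)
  define W where "W = exp (B + D)"
  define q where "q = (1 / \<kappa>) powr \<nu>"
  have q: "0 \<le> q" by (simp add: q_def)
  show ?thesis
  proof (intro exI[of _ "k * W * (1 + E + q)"] conjI allI impI)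
    show "0 \<le> k * W * (1 + E + q)" using nu q by (simp add: W_def)
    fix v :: "'m \<Rightarrow> complex" assume v: "hoelder Q \<nu> v"
    obtain A C where AC: "0 \<le> A" "0 \<le> C" "hoelder_norm Q \<nu> v = A + C" "hoelder_bound \<nu> v A C"
      using hoelder_norm_split[OF v nu(1)] by blast
    have "hoelder_bound \<nu> ((transfer_op Q h ^^ 1) (\<lambda>y. indicator (cyl [i]) y * v y)) (W * A) (W * (A * E + C * q))"
      if "i \<in> {..<k}" for i
      unfolding q_def
    proof (rule hoelder_bound_branch[OF h _ _ AC(4,1,2)])
      show "[i] \<in> wds 1" using that by (simp add: wds_def)
      assume "cyl [i] \<noteq> {}"
      then have "pt [i] \<in> X" using pt_in cyl_subset_X by blast
      then show "exp (bsum 1 \<phi> (pt [i]) + D) \<le> W"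
        using h by (simp add: W_def transfer_potential_def potential_def birkhoff_sum_def abs_le_iff)
    qed (auto simp: W_def)
    then have "hoelder_bound \<nu> (\<lambda>x. \<Sum>i<k. (transfer_op Q h ^^ 1) (\<lambda>y. indicator (cyl [i]) y * v y) x)
      (card {..<k} * (W * A)) (card {..<k} * (W * (A * E + C * q)))" by (rule hoelder_bound_sum)
    then have b: "hoelder_bound \<nu> (transfer_op Q h v) (k * (W * A)) (k * (W * (A * E + C * q)))"
      using transfer_op_sum_branches[of _ h v, symmetric] hoelder_bound_cong by fastforce
    then show "hoelder Q \<nu> (transfer_op Q h v)" by (rule hoelder_if_bound)
    have "hoelder_norm Q \<nu> (transfer_op Q h v) \<le> k * (W * A) + k * (W * (A * E + C * q))"
      using b nu q AC by (intro hoelder_norm_le) (auto simp: W_def)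
    also have "\<dots> = k * W * (A + A * E + C * q)" by (simp add: algebra_simps)
    also have "\<dots> \<le> k * W * ((1 + E + q) * (A + C))"
    proof (intro mult_left_mono)
      have "0 \<le> A * q" "0 \<le> C" "0 \<le> C * E" using AC q nu by auto
      then show "A + A * E + C * q \<le> (1 + E + q) * (A + C)" by (simp add: algebra_simps)
    qed (simp add: W_def)
    finally show "hoelder_norm Q \<nu> (transfer_op Q h v) \<le> k * W * (1 + E + q) * hoelder_norm Q \<nu> v"
      using AC by (simp add: mult.assoc)
  qed
qed

lemma transfer_op_funpow_bounded:
  assumes h: "transfer_potential \<nu> h \<phi> B D E"
  shows "\<exists>c\<ge>0. \<forall>v. hoelder Q \<nu> v \<longrightarrow> hoelder Q \<nu> ((transfer_op Q h ^^ r) v) \<and>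
    hoelder_norm Q \<nu> ((transfer_op Q h ^^ r) v) \<le> c * hoelder_norm Q \<nu> v"
proof (induction r)
  case 0
  show ?case by (intro exI[of _ 1]) simp
next
  case (Suc r)
  then obtain c where c: "c \<ge> 0" "\<And>v. hoelder Q \<nu> v \<Longrightarrow> hoelder Q \<nu> ((transfer_op Q h ^^ r) v)"
    "\<And>v. hoelder Q \<nu> v \<Longrightarrow> hoelder_norm Q \<nu> ((transfer_op Q h ^^ r) v) \<le> c * hoelder_norm Q \<nu> v" by blast
  obtain d where d: "d \<ge> 0" "\<And>v. hoelder Q \<nu> v \<Longrightarrow> hoelder Q \<nu> (transfer_op Q h v)"
    "\<And>v. hoelder Q \<nu> v \<Longrightarrow> hoelder_norm Q \<nu> (transfer_op Q h v) \<le> d * hoelder_norm Q \<nu> v"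
    using transfer_op_bounded[OF h] by blast
  show ?case
  proof (intro exI[of _ "d * c"] conjI allI impI)
    fix v :: "'m \<Rightarrow> complex" assume v: "hoelder Q \<nu> v"
    show "hoelder Q \<nu> ((transfer_op Q h ^^ Suc r) v)" using d(2) c(2)[OF v] by simp
    have "hoelder_norm Q \<nu> ((transfer_op Q h ^^ Suc r) v) \<le> d * hoelder_norm Q \<nu> ((transfer_op Q h ^^ r) v)"
      using d(3)[OF c(2)[OF v]] by simp
    also have "\<dots> \<le> d * (c * hoelder_norm Q \<nu> v)" using c(3)[OF v] d(1) by (intro mult_left_mono)
    finally show "hoelder_norm Q \<nu> ((transfer_op Q h ^^ Suc r) v) \<le> d * c * hoelder_norm Q \<nu> v" by simp
  qed (use c d in simp)
qed

text \<open>Boundedness makes the supremum in \<open>op_norm\<close> an actual bound on the unit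
  ball, and scaling extends it to all functions. A function of norm 0 cannot be normalised and is
  treated separately.\<close>

lemma op_norm_ge:
  assumes h: "transfer_potential \<nu> h \<phi> B D E"
  shows "0 \<le> op_norm Q \<nu> (transfer_op Q h ^^ r)"
    and "hoelder Q \<nu> v \<Longrightarrow> hoelder Q \<nu> ((transfer_op Q h ^^ r) v)"
    and "hoelder Q \<nu> v \<Longrightarrow> hoelder_norm Q \<nu> ((transfer_op Q h ^^ r) v) \<le> 
      op_norm Q \<nu> (transfer_op Q h ^^ r) * hoelder_norm Q \<nu> v"
proof -
  let ?F = "transfer_op Q h ^^ r"
  let ?S = "{hoelder_norm Q \<nu> (?F v) | v. hoelder Q \<nu> v \<and> hoelder_norm Q \<nu> v \<le> 1}"
  have nu: "0 < \<nu>" using h by (auto simp: transfer_potential_def)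
  obtain c where c: "c \<ge> 0" "\<And>v. hoelder Q \<nu> v \<Longrightarrow> hoelder Q \<nu> (?F v)"
    "\<And>v. hoelder Q \<nu> v \<Longrightarrow> hoelder_norm Q \<nu> (?F v) \<le> c * hoelder_norm Q \<nu> v" 
    using transfer_op_funpow_bounded[OF h, of r] by blast
  have bdd: "bdd_above ?S"
  proof (intro bdd_aboveI[of _ c])
    fix x assume "x \<in> ?S"
    then obtain v where v: "x = hoelder_norm Q \<nu> (?F v)" "hoelder Q \<nu> v" "hoelder_norm Q \<nu> v \<le> 1" by blast
    then show "x \<le> c" using c(3)[OF v(2)] mult_left_mono[OF v(3) c(1)] by simp
  qed
  have le: "hoelder_norm Q \<nu> (?F v) \<le> op_norm Q \<nu> ?F" if "hoelder Q \<nu> v" "hoelder_norm Q \<nu> v \<le> 1" for v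
    unfolding op_norm_def using bdd that by (intro cSup_upper) auto
  have nn: "0 \<le> hoelder_norm Q \<nu> v" if "hoelder Q \<nu> v" for v
    using hoelder_norm_split[OF that nu] by auto
  have z: "hoelder_bound \<nu> (\<lambda>_. 0 :: complex) 0 0" by (simp add: hoelder_bound_def)
  have hz: "hoelder Q \<nu> (\<lambda>_. 0 :: complex)" by (rule hoelder_if_bound[OF z])
  show "0 \<le> op_norm Q \<nu> ?F"
    using le[OF hz] hoelder_norm_le[OF z] nn[OF c(2)[OF hz]] by simp
  show "hoelder Q \<nu> (?F v)" if "hoelder Q \<nu> v" by (rule c(2)[OF that])
  show "hoelder_norm Q \<nu> (?F v) \<le> op_norm Q \<nu> ?F * hoelder_norm Q \<nu> v" if v: "hoelder Q \<nu> v"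
  proof (cases "hoelder_norm Q \<nu> v = 0")
    case True
    then show ?thesis using c(3)[OF v] by simp
  next
    case False
    define N where "N = hoelder_norm Q \<nu> v"
    have N: "0 < N" using False nn[OF v] by (simp add: N_def)
    define v' where "v' x = complex_of_real (1 / N) * v x" for x
    obtain A C where AC: "0 \<le> A" "0 \<le> C" "N = A + C" "hoelder_bound \<nu> v A C"
      using hoelder_norm_split[OF v nu] unfolding N_def by blast
    have v'b: "hoelder_bound \<nu> v' (cmod (complex_of_real (1 / N)) * A) (cmod (complex_of_real (1 / N)) * C)"
      unfolding v'_def by (rule hoelder_bound_scale[OF AC(4)])
    then have v'h: "hoelder Q \<nu> v'" by (rule hoelder_if_bound)
    have "hoelder_norm Q \<nu> v' \<le> cmod (complex_of_real (1 / N)) * A + cmod (complex_of_real (1 / N)) * C"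
      using AC by (intro hoelder_norm_le[OF v'b]) simp
    also have "\<dots> = 1 / N * (A + C)" unfolding norm_of_real using N by (simp add: distrib_left)
    also have "\<dots> = 1" using N unfolding AC(3)[symmetric] by simp
    finally have v'1: "hoelder_norm Q \<nu> v' \<le> 1" .
    obtain A' C' where AC': "0 \<le> A'" "0 \<le> C'" "hoelder_norm Q \<nu> (?F v') = A' + C'" "hoelder_bound \<nu> (?F v') A' C'"
      using hoelder_norm_split[OF c(2)[OF v'h] nu] by blast
    have "?F v x = complex_of_real N * ?F v' x" if x: "x \<in> X" for x
      unfolding transfer_op_funpow[OF x] v'_def sum_distrib_left using N by (intro sum.cong) auto
    then have "hoelder_bound \<nu> (?F v) (cmod (complex_of_real N) * A') (cmod (complex_of_real N) * C')"
      by (intro hoelder_bound_cong[OF hoelder_bound_scale[OF AC'(4)]]) simp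
    then have "hoelder_norm Q \<nu> (?F v) \<le> cmod (complex_of_real N) * A' + cmod (complex_of_real N) * C'"
      using AC' by (intro hoelder_norm_le) auto
    also have "\<dots> = N * hoelder_norm Q \<nu> (?F v')" using N AC'(3) by (simp add: distrib_left)
    also have "\<dots> \<le> N * op_norm Q \<nu> ?F" using le[OF v'h v'1] N by (intro mult_left_mono) auto
    finally show ?thesis by (simp add: N_def mult.commute)
  qed
qed

end

section \<open>Distortion\<close>

context markov_map
begin

text \<open>One estimate for two situations: r is the distance of the end points when these lie in
  one piece, and the diameter when only the words agree. Distances decrease geometrically backwards
  from the end, so a geometric series of ratio \<gamma>^(-\<nu>) bounds the sum uniformly in
  n.\<close>

lemma birkhoff_distortion:
  fixes h :: "'m \<Rightarrow> 'b::real_normed_vector"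
  assumes h: "hoelder_bound \<nu> h A C"
    and C: "0 \<le> C" and \<nu>: "0 < \<nu>"
    and ws: "ws \<in> wds n" "x \<in> cyl ws" "y \<in> cyl ws"
    and r: "0 \<le> r" "\<And>j. j < n \<Longrightarrow> dist ((T ^^ j) x) ((T ^^ j) y) \<le> r / (\<kappa> * \<gamma> ^ (n - 1 - j))"
  shows "norm (bsum n h x - bsum n h y) \<le> 
    C * (1 / \<kappa>) powr \<nu> / (1 - (1 / \<gamma>) powr \<nu>) * r powr \<nu>"
proof -
  define q where "q = (1 / \<gamma>) powr \<nu>"
  have q: "0 < q" "q < 1" using \<gamma>_gt_1 \<nu> powr_less_mono2[of \<nu> "1 / \<gamma>" 1] by (auto simp: q_def)
  have "norm (h ((T ^^ j) x) - h ((T ^^ j) y)) \<le> C * (1 / \<kappa>) powr \<nu> * r powr \<nu> * q ^ (n - 1 - j)" if j: "j < n" for j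
  proof -
    have "(T ^^ j) x \<in> U (ws ! j)" "(T ^^ j) y \<in> U (ws ! j)" "ws ! j < k"
      using ws j wds_nth[OF ws(1) j] by (auto simp: cyl_def wds_length)
    then have "norm (h ((T ^^ j) x) - h ((T ^^ j) y)) \<le> C * dist ((T ^^ j) x) ((T ^^ j) y) powr \<nu>"
      using h unfolding hoelder_bound_def by blast
    also have "\<dots> \<le> C * (1 / \<kappa> * r * (1 / \<gamma>) ^ (n - 1 - j)) powr \<nu>"
      using r(2)[OF j] C \<nu> by (intro mult_left_mono powr_mono2) (auto simp: power_one_over field_simps)
    also have "(1 / \<kappa> * r * (1 / \<gamma>) ^ (n - 1 - j)) powr \<nu> = (1 / \<kappa>) powr \<nu> * r powr \<nu> * ((1 / \<gamma>) ^ (n - 1 - j)) powr \<nu>"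
      by (simp only: powr_mult)
    also have "((1 / \<gamma>) ^ (n - 1 - j)) powr \<nu> = q ^ (n - 1 - j)"
      using \<gamma>_gt_1 by (simp add: q_def powr_power powr_powr mult.commute flip: powr_realpow)
    finally show ?thesis by (simp add: mult.assoc)
  qed
  then have "(\<Sum>j<n. norm (h ((T ^^ j) x) - h ((T ^^ j) y))) \<le> (\<Sum>j<n. C * (1 / \<kappa>) powr \<nu> * r powr \<nu> * q ^ (n - 1 - j))"
    by (intro sum_mono) auto
  also have "\<dots> = C * (1 / \<kappa>) powr \<nu> * r powr \<nu> * (\<Sum>j<n. q ^ (n - 1 - j))"
    by (simp add: sum_distrib_left)
  also have "(\<Sum>j<n. q ^ (n - 1 - j)) = (\<Sum>j<n. q ^ j)"
    by (rule sum.reindex_bij_witness[where i = "\<lambda>j. n - 1 - j" and j = "\<lambda>j. n - 1 - j"]) auto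
  also have "(\<Sum>j<n. q ^ j) = (1 - q ^ n) / (1 - q)"
    using q by (subst geometric_sum) (auto simp: field_simps)
  also have "C * (1 / \<kappa>) powr \<nu> * r powr \<nu> * ((1 - q ^ n) / (1 - q)) \<le> C * (1 / \<kappa>) powr \<nu> * r powr \<nu> * (1 / (1 - q))"
    using q C by (intro mult_left_mono divide_right_mono) auto
  also have "\<dots> = C * (1 / \<kappa>) powr \<nu> / (1 - q) * r powr \<nu>" by simp
  finally have "(\<Sum>j<n. norm (h ((T ^^ j) x) - h ((T ^^ j) y))) \<le> C * (1 / \<kappa>) powr \<nu> / (1 - q) * r powr \<nu>" .
  moreover have "norm (bsum n h x - bsum n h y) \<le> (\<Sum>j<n. norm (h ((T ^^ j) x) - h ((T ^^ j) y)))"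
    unfolding birkhoff_sum_def sum_subtractf[symmetric] by (rule norm_sum)
  ultimately show ?thesis by (simp add: q_def)
qed

definition distortion :: "real \<Rightarrow> real" where
  "distortion \<nu> = (1 / \<kappa>) powr \<nu> / (1 - (1 / \<gamma>) powr \<nu>)"

lemma distortion_nonneg: "0 < \<nu> \<Longrightarrow> 0 \<le> distortion \<nu>"
  using \<gamma>_gt_1 powr_less_mono2[of \<nu> "1 / \<gamma>" 1] by (simp add: distortion_def)

lemma birkhoff_distortion_inverse_branch:
  fixes h :: "'m \<Rightarrow> 'b::real_normed_vector"
  assumes h: "hoelder_bound \<nu> h A C"
    and C: "0 \<le> C" and \<nu>: "0 < \<nu>"
    and ws: "ws \<in> wds n" "x \<in> cyl ws" "y \<in> cyl ws" and l: "letter ((T ^^ n) x) = letter ((T ^^ n) y)"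
  shows "norm (bsum n h x - bsum n h y) \<le> C * distortion \<nu> * dist ((T ^^ n) x) ((T ^^ n) y) powr \<nu>"
proof -
  have "dist ((T ^^ j) x) ((T ^^ j) y) \<le> dist ((T ^^ n) x) ((T ^^ n) y) / (\<kappa> * \<gamma> ^ (n - 1 - j))" if "j < n" for j
  proof -
    have "dist ((T ^^ j) x) ((T ^^ j) y) \<le> dist ((T ^^ n) x) ((T ^^ n) y) / (\<kappa> * \<gamma> ^ (n - j))"
      using dist_cyl_end[OF ws l] that by simp
    \<comment> \<open>One factor \<gamma> is given away to fit the common form.\<close>
    also have "\<dots> \<le> dist ((T ^^ n) x) ((T ^^ n) y) / (\<kappa> * \<gamma> ^ (n - 1 - j))"
      using \<kappa>_pos \<gamma>_gt_1 by (intro divide_left_mono mult_left_mono power_increasing) auto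
    finally show ?thesis .
  qed
  from birkhoff_distortion[OF h C \<nu> ws _ this] show ?thesis by (simp add: distortion_def)
qed

lemma birkhoff_distortion_cyl:
  fixes h :: "'m \<Rightarrow> 'b::real_normed_vector"
  assumes h: "hoelder_bound \<nu> h A C"
    and C: "0 \<le> C" and \<nu>: "0 < \<nu>"
    and ws: "ws \<in> wds n" "x \<in> cyl ws" "y \<in> cyl ws"
  shows "norm (bsum n h x - bsum n h y) \<le> C * distortion \<nu> * diam powr \<nu>"
proof -
  have "dist ((T ^^ j) x) ((T ^^ j) y) \<le> diam / (\<kappa> * \<gamma> ^ (n - 1 - j))" if "j < n" for j
    using dist_cyl[of ws "n - 1" x y j] ws that by simp
  from birkhoff_distortion[OF h C \<nu> ws diam_nonneg this] show ?thesis by (simp add: distortion_def)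
qed

lemma fixed_point_unique:
  assumes ws: "ws \<in> wds n" "0 < n" and p: "p \<in> cyl ws" "(T ^^ n) p = p" and q: "q \<in> cyl ws" "(T ^^ n) q = q"
  shows "p = q"
proof (rule eq_if_all_letters)
  fix t
  have "letter ((T ^^ t) x) = ws ! (t mod n)" if "x \<in> cyl ws" "(T ^^ n) x = x" for x
    using funpow_mod_eq[OF that(2), of t] cyl_letters[OF ws(1)] that(1) ws(2) by (metis mod_less_divisor)
  then show "letter ((T ^^ t) p) = letter ((T ^^ t) q)" using p q by simp
qed (use p q cyl_subset_X in auto)

section \<open>Comparison of the periodic orbit sum with the transfer operator\<close>

context
  fixes xs :: "nat \<Rightarrow> 'm" and n :: nat
  assumes xs: "\<And>i. i < k \<Longrightarrow> xs i \<in> U i" and n: "2 \<le> n"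
begin

text \<open>
  In an empty cylinder no representative exists; its value is then irrelevant, but it has to lie
  in the domain of the map, hence the detour over \<open>xs\<close>.
\<close>

definition rep :: "nat list \<Rightarrow> 'm" where
  "rep ws = (if length ws = 1 \<or> cyl ws = {} then xs (hd ws)
     else if length ws = n \<and> (\<exists>p\<in>cyl ws. (T ^^ n) p = p) then (SOME p. p \<in> cyl ws \<and> (T ^^ n) p = p)
     else pt ws)"

lemma wds_hd: "ws \<in> wds m \<Longrightarrow> 0 < m \<Longrightarrow> hd ws < k"
  using wds_nth[of ws m 0] wds_length[of ws m] by (cases ws) auto

lemma rep_in_cyl:
  assumes "ws \<in> wds m" "0 < m" "cyl ws \<noteq> {}"
  shows "rep ws \<in> cyl ws"
proof (cases "length ws = 1")
  case True
  then have "ws = [hd ws]" by (cases ws) auto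
  then have "cyl ws = U (hd ws)" using wds_hd[OF assms(1,2)] cyl_single by metis
  then show ?thesis using True xs wds_hd[OF assms(1,2)] by (simp add: rep_def)
next
  case False
  have "(SOME p. p \<in> cyl ws \<and> (T ^^ n) p = p) \<in> cyl ws" if "\<exists>p\<in>cyl ws. (T ^^ n) p = p"
    using someI_ex[of "\<lambda>p. p \<in> cyl ws \<and> (T ^^ n) p = p"] that by blast
  then show ?thesis using False assms(3) pt_in by (simp add: rep_def)
qed

lemma rep_in_X:
  assumes "ws \<in> wds m" "0 < m"
  shows "rep ws \<in> X"
proof (cases "cyl ws = {}")
  case True
  then show ?thesis using xs[OF wds_hd[OF assms]] U_subset_X wds_hd[OF assms] by (auto simp: rep_def)
qed (use rep_in_cyl[OF assms] cyl_subset_X in blast)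

abbreviation branch_value :: "('m \<Rightarrow> complex) \<Rightarrow> nat list \<Rightarrow> 'm \<Rightarrow> complex" where
  "branch_value h ws \<equiv> (transfer_op Q h ^^ n) (indicator (cyl ws))"

lemma branch_value_eq:
  assumes "x \<in> X"
  shows "branch_value h ws x = (\<Sum>y | y \<in> cyl ws \<and> (T ^^ n) y = x. exp (bsum n h y))"
proof -
  have "branch_value h ws x = (\<Sum>y | y \<in> X \<and> (T ^^ n) y = x. exp (bsum n h y) * indicator (cyl ws) y)"
    by (rule transfer_op_funpow[OF assms])
  also have "\<dots> = (\<Sum>y | y \<in> cyl ws \<and> (T ^^ n) y = x. exp (bsum n h y) * indicator (cyl ws) y)"
    using cyl_subset_X by (intro sum.mono_neutral_right finite_preimage) (auto simp: indicator_def)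
  also have "\<dots> = (\<Sum>y | y \<in> cyl ws \<and> (T ^^ n) y = x. exp (bsum n h y))"
    by (intro sum.cong) auto
  finally show ?thesis .
qed

text \<open>If the word has a periodic point, \<open>rep\<close> is that point and its only preimage
  in the cylinder is itself. If not, \<open>rep\<close> has no preimage in the cylinder, since an
  orbit leading from the cylinder back to its first piece would produce a periodic point. As n is at
  least 2, words of length n are distinct from those of length 1, where \<open>rep\<close> is
  prescribed.\<close>

lemma periodic_sum: "Zsum Q n h = (\<Sum>ws\<in>wds n. branch_value h ws (rep ws))"
proof -
  let ?P = "{x \<in> X. (T ^^ n) x = x}"
  have inj: "inj_on (word n) ?P"
  proof (rule inj_onI)
    fix p q assume a: "p \<in> ?P" "q \<in> ?P" "word n p = word n q"
    then show "p = q"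
      using fixed_point_unique[of "word n p" n p q] word_in in_cyl_iff[of "word n p" n] n by auto
  qed
  have fin: "finite ?P"
    using inj word_in by (intro inj_on_finite[OF _ _ finite_wds[of n]]) auto
  have "Zsum Q n h = (\<Sum>ws\<in>wds n. \<Sum>x | x \<in> ?P \<and> word n x = ws. exp (bsum n h x))"
    unfolding Zsum_def using word_in fin by (intro sum.group[symmetric]) auto
  also have "\<dots> = (\<Sum>ws\<in>wds n. branch_value h ws (rep ws))"
  proof (intro sum.cong refl)
    fix ws assume ws: "ws \<in> wds n"
    have "{x. x \<in> ?P \<and> word n x = ws} = {y. y \<in> cyl ws \<and> (T ^^ n) y = y}"
      using in_cyl_iff[OF ws] by auto
    also have "\<dots> = {y. y \<in> cyl ws \<and> (T ^^ n) y = rep ws}"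
    proof (cases "\<exists>p\<in>cyl ws. (T ^^ n) p = p")
      case True
      then have "rep ws \<in> cyl ws \<and> (T ^^ n) (rep ws) = rep ws"
        using someI_ex[of "\<lambda>p. p \<in> cyl ws \<and> (T ^^ n) p = p"] wds_length[OF ws] n by (auto simp: rep_def)
      then show ?thesis
        using fixed_point_unique[OF ws] inj_cyl[OF ws] n by (metis (lifting) Collect_cong gr0I not_numeral_le_zero)
    next
      case False
      have "(T ^^ n) y \<noteq> rep ws" if y: "y \<in> cyl ws" for y
      proof
        assume eq: "(T ^^ n) y = rep ws"
        have "rep ws \<in> cyl ws" using rep_in_cyl[OF ws] y n by auto
        then have "(T ^^ n) y \<in> U (hd ws)" using eq cyl_subset_U[OF ws] n by auto
        then show False using fixed_point_in_cyl[OF ws _ y] False n by auto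
      qed
      then show ?thesis using False by blast
    qed
    finally show "(\<Sum>x | x \<in> ?P \<and> word n x = ws. exp (bsum n h x)) = branch_value h ws (rep ws)"
      using branch_value_eq[OF rep_in_X[OF ws]] n by simp
  qed
  finally show ?thesis .
qed

text \<open>A cylinder is the disjoint union of its one-letter extensions. Evaluation at one common
  point is essential: the telescoping terms measure the change of point.\<close>

lemma branch_value_refine:
  assumes vs: "vs \<in> wds m" and x: "x \<in> X"
  shows "(\<Sum>i<k. branch_value h (vs @ [i]) x) = branch_value h vs x"
proof -
  have *: "(\<Sum>i<k. indicator (cyl (vs @ [i])) y) = (indicator (cyl vs) y :: complex)" for y
  proof (cases "y \<in> cyl vs")
    case True
    then have y: "(T ^^ m) y \<in> X" using cyl_subset_X funpow_in by blast
    have "(\<Sum>i<k. indicator (cyl (vs @ [i])) y) = (\<Sum>i<k. indicator (U i) ((T ^^ m) y) * (1 :: complex))"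
      using True wds_length[OF vs] by (intro sum.cong refl) (auto simp: indicator_def cyl_append cyl_single)
    then show ?thesis using indicator_partition[OF y, of "\<lambda>_. 1"] True by simp
  qed (auto simp: indicator_def cyl_append intro!: sum.neutral)
  have "(\<Sum>i<k. branch_value h (vs @ [i]) x) = 
    (\<Sum>y | y \<in> X \<and> (T ^^ n) y = x. \<Sum>i<k. exp (bsum n h y) * indicator (cyl (vs @ [i])) y)"
    unfolding transfer_op_funpow[OF x] by (rule sum.swap)
  also have "\<dots> = branch_value h vs x"
    unfolding transfer_op_funpow[OF x] sum_distrib_left[symmetric] * ..
  finally show ?thesis .
qed

lemma periodic_sum_telescope:
  "Zsum Q n h - (\<Sum>i<k. (transfer_op Q h ^^ n) (indicator (U i)) (xs i)) =
    (\<Sum>m=2..n. \<Sum>ws\<in>wds m. branch_value h ws (rep ws) - branch_value h ws (rep (butlast ws)))"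
proof -
  define S where "S m = (\<Sum>ws\<in>wds m. branch_value h ws (rep ws))" for m
  have S1: "S 1 = (\<Sum>i<k. (transfer_op Q h ^^ n) (indicator (U i)) (xs i))"
    using sum_wds_Suc[of "\<lambda>ws. branch_value h ws (rep ws)" 0]
    by (simp add: S_def wds_0 cyl_single rep_def)
  have step: "S m - S (m - 1) = (\<Sum>ws\<in>wds m. branch_value h ws (rep ws) - branch_value h ws (rep (butlast ws)))"
    if "m \<in> {2..n}" for m
  proof -
    obtain l where m: "m = Suc l" "0 < l" using \<open>m \<in> {2..n}\<close> by (cases m) auto
    have "(\<Sum>ws\<in>wds m. branch_value h ws (rep (butlast ws))) = (\<Sum>vs\<in>wds l. \<Sum>i<k. branch_value h (vs @ [i]) (rep vs))"
      unfolding m sum_wds_Suc by simp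
    also have "\<dots> = S l" unfolding S_def using rep_in_X m by (intro sum.cong refl branch_value_refine) auto
    finally show ?thesis using m by (simp add: S_def sum_subtractf)
  qed
  have "Zsum Q n h - (\<Sum>i<k. (transfer_op Q h ^^ n) (indicator (U i)) (xs i)) = S n - S 1"
    unfolding S1 by (simp add: periodic_sum S_def)
  also have "\<dots> = (\<Sum>m\<in>{Suc 1..n}. S m - S (m - 1))"
    using n by (intro sum_telescope''[symmetric]) simp
  also have "{Suc 1..n} = {2..n}" by (simp add: numeral_2_eq_2)
  also have "(\<Sum>m\<in>{2..n}. S m - S (m - 1)) = (\<Sum>m=2..n. \<Sum>ws\<in>wds m. branch_value h ws (rep ws) - branch_value h ws (rep (butlast ws)))"
    by (intro sum.cong refl step)
  finally show ?thesis .
qed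

lemma branch_value_diff:
  assumes h: "transfer_potential \<nu> h \<phi> B D E" and m: "2 \<le> m" "m \<le> n" and ws: "ws \<in> wds m" "cyl ws \<noteq> {}"
  shows "cmod (branch_value h ws (rep ws) - branch_value h ws (rep (butlast ws)))
    \<le> op_norm Q \<nu> (transfer_op Q h ^^ (n - m)) * (exp (bsum m \<phi> (pt ws) + D) * (1 + E)) *
      ((diam * \<gamma>\<^sup>2 / \<kappa>) powr \<nu> * \<gamma> powr (- real m * \<nu>))"
proof -
  have nu: "0 < \<nu>" "0 \<le> E" using h by (auto simp: transfer_potential_def)
  let ?W = "exp (bsum m \<phi> (pt ws) + D)"
  define w where "w = (transfer_op Q h ^^ m) (indicator (cyl ws))"
  have one: "hoelder_bound \<nu> (\<lambda>_. 1 :: complex) 1 0" by (simp add: hoelder_bound_def)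
  have "hoelder_bound \<nu> ((transfer_op Q h ^^ m) (\<lambda>y. indicator (cyl ws) y * 1)) (?W * 1) (?W * (1 * E + 0 * (1 / \<kappa>) powr \<nu>))"
    using m ws by (intro hoelder_bound_branch[OF h _ _ one]) auto
  then have w: "hoelder_bound \<nu> w ?W (?W * E)" by (simp add: w_def)
  have "hoelder_norm Q \<nu> w \<le> ?W + ?W * E" using nu by (intro hoelder_norm_le[OF w]) simp
  then have wn: "hoelder_norm Q \<nu> w \<le> ?W * (1 + E)" by (simp add: algebra_simps)
  have whoelder: "hoelder Q \<nu> w" by (rule hoelder_if_bound[OF w])
  let ?L = "transfer_op Q h ^^ (n - m)"
  have bw: "branch_value h ws = ?L w"
    using funpow_add[of "n - m" m "transfer_op Q h"] m(2) by (simp add: w_def)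
  obtain A C where AC: "0 \<le> A" "0 \<le> C" "hoelder_norm Q \<nu> (?L w) = A + C" "hoelder_bound \<nu> (?L w) A C"
    using hoelder_norm_split[OF op_norm_ge(2)[OF h whoelder] nu(1)] by blast
  obtain l where l: "m = Suc (Suc l)" using that[of "m - 2"] m(1) by simp
  have b: "butlast ws \<in> wds (Suc l)" using ws(1) l by (auto simp: wds_def dest: in_set_butlastD)
  have ab: "ws = butlast ws @ [last ws]" 
    using ws(1) l by (intro append_butlast_last_id[symmetric]) (auto simp: wds_def)
  have sub: "cyl ws \<subseteq> cyl (butlast ws)" by (subst (1) ab) (auto simp: cyl_append)
  let ?x = "rep ws" and ?y = "rep (butlast ws)"
  have x: "?x \<in> cyl (butlast ws)" using rep_in_cyl[OF ws(1) _ ws(2)] l sub by auto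
  have y: "?y \<in> cyl (butlast ws)" using rep_in_cyl[OF b] sub ws(2) by auto
  have "?x \<in> U (hd (butlast ws))" "?y \<in> U (hd (butlast ws))" using x y cyl_subset_U[OF b] by auto
  then have "cmod (?L w ?x - ?L w ?y) \<le> C * dist ?x ?y powr \<nu>"
    using AC(4) wds_hd[OF b] unfolding hoelder_bound_def by blast
  also have "\<dots> \<le> (op_norm Q \<nu> ?L * (?W * (1 + E))) * ((diam * \<gamma>\<^sup>2 / \<kappa>) powr \<nu> * \<gamma> powr (- real m * \<nu>))"
  proof (intro mult_mono)
    have "C \<le> hoelder_norm Q \<nu> (?L w)" using AC by simp
    also have "\<dots> \<le> op_norm Q \<nu> ?L * hoelder_norm Q \<nu> w" by (rule op_norm_ge(3)[OF h whoelder])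
    also have "\<dots> \<le> op_norm Q \<nu> ?L * (?W * (1 + E))" using wn op_norm_ge(1)[OF h] by (rule mult_left_mono)
    finally show "C \<le> op_norm Q \<nu> ?L * (?W * (1 + E))" .
    then show "0 \<le> op_norm Q \<nu> ?L * (?W * (1 + E))" using AC by simp
    \<comment> \<open>The points share a word of m - 1 letters, hence m - 2 expanding steps; the
      missing two are the factor \<gamma>^2 in the constant.\<close>
    have "dist ?x ?y \<le> diam / (\<kappa> * \<gamma> ^ l)" using dist_cyl[OF b x y, of 0] by simp
    also have "\<dots> = diam * \<gamma>\<^sup>2 / \<kappa> * (1 / \<gamma> ^ m)" using \<gamma>_gt_1 \<kappa>_pos by (simp add: l power2_eq_square field_simps)
    finally have "dist ?x ?y powr \<nu> \<le> (diam * \<gamma>\<^sup>2 / \<kappa> * (1 / \<gamma> ^ m)) powr \<nu>" using nu by (intro powr_mono2) auto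
    also have "\<dots> = (diam * \<gamma>\<^sup>2 / \<kappa>) powr \<nu> * (1 / \<gamma> ^ m) powr \<nu>"
      by (rule powr_mult)
    also have "1 / \<gamma> ^ m = \<gamma> powr (- real m)" using \<gamma>_gt_1 by (simp add: powr_minus powr_realpow divide_inverse)
    also have "(\<gamma> powr (- real m)) powr \<nu> = \<gamma> powr (- real m * \<nu>)" by (rule powr_powr)
    finally show "dist ?x ?y powr \<nu> \<le> (diam * \<gamma>\<^sup>2 / \<kappa>) powr \<nu> * \<gamma> powr (- real m * \<nu>)" .
  qed simp
  finally show ?thesis unfolding bw .
qed

text \<open>All factors in \<open>branch_value_diff\<close> except the weight at
  \<open>pt ws\<close> are the same for every word of length m, so summing over the words leaves the
  partition sum, to which the pressure bound applies.\<close>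

lemma periodic_sum_estimate:
  assumes h: "transfer_potential \<nu> h \<phi> B D E" and e: "0 \<le> \<epsilon>"
  shows "cmod (Zsum Q n h - (\<Sum>i<k. (transfer_op Q h ^^ n) (indicator (U i)) (xs i))) \<le>
    ((1 + E) * exp D * (diam * \<gamma>\<^sup>2 / \<kappa>) powr \<nu> * pressure_factor B D) *
    (\<Sum>m=2..n. op_norm Q \<nu> (transfer_op Q h ^^ (n - m)) * \<gamma> powr (- real m * \<nu>) * exp (real m * (\<epsilon> + pressure Q \<phi>)))"
proof -
  let ?N = "\<lambda>m. op_norm Q \<nu> (transfer_op Q h ^^ (n - m))"
  let ?R = "(diam * \<gamma>\<^sup>2 / \<kappa>) powr \<nu>"
  let ?K = "pressure_factor B D"
  let ?d = "\<lambda>ws. branch_value h ws (rep ws) - branch_value h ws (rep (butlast ws))"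
  have pot: "potential \<phi> B D" "0 \<le> E" using h by (auto simp: transfer_potential_def)
  have "cmod (\<Sum>ws\<in>wds m. ?d ws) \<le> (1 + E) * exp D * ?R * ?K * (?N m * \<gamma> powr (- real m * \<nu>) * exp (real m * (\<epsilon> + pressure Q \<phi>)))"
    if m: "m \<in> {2..n}" for m
  proof -
    have m0: "0 < m" using m by auto
    have "cmod (\<Sum>ws\<in>wds m. ?d ws) \<le> (\<Sum>ws\<in>wds m. cmod (?d ws))" by (rule norm_sum)
    \<comment> \<open>Forbidden words give 0 at every point of \<open>X\<close>; this is why
      \<open>rep\<close> has to lie in \<open>X\<close> even for them.\<close>
    also have "\<dots> = (\<Sum>ws | ws \<in> wds m \<and> cyl ws \<noteq> {}. cmod (?d ws))"
    proof (intro sum.mono_neutral_right ballI)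
      fix ws assume a: "ws \<in> wds m - {ws \<in> wds m. cyl ws \<noteq> {}}"
      then have "rep ws \<in> X" using rep_in_X m0 by blast
      moreover have "rep (butlast ws) \<in> X"
        using a m by (intro rep_in_X[of _ "m - 1"]) (auto simp: wds_def dest: in_set_butlastD)
      moreover have "{y. y \<in> cyl ws \<and> (T ^^ n) y = x} = {}" for x using a by auto
      ultimately show "cmod (?d ws) = 0" by (simp only: branch_value_eq) simp
    qed auto
    also have "\<dots> \<le> (\<Sum>ws | ws \<in> wds m \<and> cyl ws \<noteq> {}. ?N m * (exp (bsum m \<phi> (pt ws) + D) * (1 + E)) * (?R * \<gamma> powr (- real m * \<nu>)))"
      using m by (intro sum_mono branch_value_diff[OF h]) auto
    also have "\<dots> = ?N m * exp D * (1 + E) * (?R * \<gamma> powr (- real m * \<nu>)) * partition_sum \<phi> m"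
      by (simp add: partition_sum_def sum_distrib_left exp_add mult_ac)
    also have "\<dots> \<le> ?N m * exp D * (1 + E) * (?R * \<gamma> powr (- real m * \<nu>)) * (?K * exp (real m * (\<epsilon> + pressure Q \<phi>)))"
    proof (intro mult_left_mono)
      have "partition_sum \<phi> m \<le> ?K * exp (real m * pressure Q \<phi>)"
        by (rule partition_sum_le_pressure[OF pot(1) m0])
      also have "\<dots> \<le> ?K * exp (real m * (\<epsilon> + pressure Q \<phi>))"
        using e by (intro mult_left_mono) (auto simp: distrib_left pressure_factor_def)
      finally show "partition_sum \<phi> m \<le> ?K * exp (real m * (\<epsilon> + pressure Q \<phi>))" .
      show "0 \<le> ?N m * exp D * (1 + E) * (?R * \<gamma> powr (- real m * \<nu>))"
        using op_norm_ge(1)[OF h] pot(2) by (intro mult_nonneg_nonneg) auto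
    qed
    finally show ?thesis by (simp only: mult_ac)
  qed
  then have "(\<Sum>m=2..n. cmod (\<Sum>ws\<in>wds m. ?d ws)) \<le> 
    (\<Sum>m=2..n. (1 + E) * exp D * ?R * ?K * (?N m * \<gamma> powr (- real m * \<nu>) * exp (real m * (\<epsilon> + pressure Q \<phi>))))"
    by (rule sum_mono)
  then have "cmod (\<Sum>m=2..n. \<Sum>ws\<in>wds m. ?d ws) \<le> 
    (\<Sum>m=2..n. (1 + E) * exp D * ?R * ?K * (?N m * \<gamma> powr (- real m * \<nu>) * exp (real m * (\<epsilon> + pressure Q \<phi>))))"
    by (rule order.trans[OF norm_sum])
  then show ?thesis unfolding periodic_sum_telescope sum_distrib_left .
qed

end

text \<open>For \<open>n = 1\<close> the bound is an empty sum. Both terms vanish, as no rectangle is mapped to itself.\<close>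

lemma periodic_sum_1: "Zsum Q 1 h - (\<Sum>i<k. (transfer_op Q h ^^ 1) (indicator (U i)) (xs i)) = 0"
  if xs: "\<And>i. i < k \<Longrightarrow> xs i \<in> U i"
proof -
  have e: "{x \<in> X. (T ^^ 1) x = x} = {}"
    using no_self_transition in_U_letter letter_less by fastforce
  have "(transfer_op Q h ^^ 1) (indicator (U i)) (xs i) = 0" if i: "i < k" for i
  proof -
    have "exp (h y) * indicator (U i) y = 0" if "T y = xs i" for y
      using no_self_transition[OF i, of y] xs[OF i] that by (auto simp: indicator_def)
    then show ?thesis by (simp add: transfer_op_def)
  qed
  then show ?thesis unfolding Zsum_def e by simp
qed

end

section \<open>Constants for the family of potentials\<close>

context markov_map
begin

text \<open>Only Re s and Re z enter B and D, which a0 and c0 therefore bound uniformly. For E, the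
  Hoelder constant Cf + |s| Ct + |z| Cg is at most (Cf + Ct + Cg) (1 + |s|) (1 + |z|), whence these
  factors in the final estimate.\<close>

lemma transfer_potential_combination:
  fixes f g \<tau> :: "'m \<Rightarrow> real" and s z :: complex
  assumes \<nu>: "0 < \<nu>" and cont: "continuous_on X f" "continuous_on X \<tau>" "continuous_on X g"
    and hb: "hoelder_bound \<nu> f Bf Cf" "hoelder_bound \<nu> \<tau> Bt Ct" "hoelder_bound \<nu> g Bg Cg"
    and nn: "0 \<le> Bt" "0 \<le> Bg" "0 \<le> Cf" "0 \<le> Ct" "0 \<le> Cg"
    and sz: "\<bar>Re s\<bar> \<le> a0" "\<bar>Re z\<bar> \<le> c0"
  shows "transfer_potential \<nu> (\<lambda>y. of_real (f y) - s * of_real (\<tau> y) + z * of_real (g y))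
    (\<lambda>y. f y - Re s * \<tau> y + Re z * g y) (Bf + a0 * Bt + c0 * Bg)
    ((Cf + a0 * Ct + c0 * Cg) * distortion \<nu> * diam powr \<nu>)
    ((Cf + Ct + Cg) * (1 + cmod s) * (1 + cmod z) * distortion \<nu>)"
proof -
  let ?h = "\<lambda>y. complex_of_real (f y) - s * of_real (\<tau> y) + z * of_real (g y)"
  let ?\<phi> = "\<lambda>y. f y - Re s * \<tau> y + Re z * g y"
  let ?B = "Bf + a0 * Bt + c0 * Bg" and ?C = "Cf + a0 * Ct + c0 * Cg"
  let ?E = "(Cf + Ct + Cg) * (1 + cmod s) * (1 + cmod z)"
  have ac: "0 \<le> a0" "0 \<le> c0" using sz by auto
  have "hoelder_bound \<nu> ?\<phi> (Bf + \<bar>Re s\<bar> * Bt + \<bar>Re z\<bar> * Bg) (Cf + \<bar>Re s\<bar> * Ct + \<bar>Re z\<bar> * Cg)"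
    using hoelder_bound_add[OF hoelder_bound_add[OF hb(1) hoelder_bound_scale[OF hb(2), of "- Re s"]]
        hoelder_bound_scale[OF hb(3), of "Re z"]] by simp
  then have \<phi>: "hoelder_bound \<nu> ?\<phi> ?B ?C"
    using sz nn by (elim hoelder_bound_mono) (auto intro!: add_mono mult_right_mono)
  have h: "hoelder_bound \<nu> ?h (Bf + cmod s * Bt + cmod z * Bg) (Cf + cmod s * Ct + cmod z * Cg)"
    using hoelder_bound_add[OF hoelder_bound_add[OF hoelder_bound_of_real[OF hb(1)]
          hoelder_bound_scale[OF hoelder_bound_of_real[OF hb(2)], of "- s"]]
        hoelder_bound_scale[OF hoelder_bound_of_real[OF hb(3)], of z]] by simp
  have "Cf + cmod s * Ct + cmod z * Cg \<le> ?E"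
  proof -
    let ?p = "(1 + cmod s) * (1 + cmod z)"
    have "1 \<le> ?p" "cmod s \<le> ?p" "cmod z \<le> ?p" by (simp_all add: algebra_simps)
    then have "1 * Cf + cmod s * Ct + cmod z * Cg \<le> ?p * Cf + ?p * Ct + ?p * Cg"
      using nn by (intro add_mono mult_right_mono) auto
    then show ?thesis by (simp add: algebra_simps)
  qed
  with h have h: "hoelder_bound \<nu> ?h (Bf + cmod s * Bt + cmod z * Bg) ?E"
    by (rule hoelder_bound_mono[OF _ order.refl])
  have C0: "0 \<le> ?E" "0 \<le> ?C" using nn ac by auto
  have "bsum n ?\<phi> x \<le> bsum n ?\<phi> y + ?C * distortion \<nu> * diam powr \<nu>"
    if "ws \<in> wds n" "x \<in> cyl ws" "y \<in> cyl ws" for n ws x y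
    using birkhoff_distortion_cyl[OF \<phi> C0(2) \<nu> that] unfolding real_norm_def by linarith
  moreover have "continuous_on X ?\<phi>" by (intro continuous_intros cont)
  ultimately have "potential ?\<phi> ?B (?C * distortion \<nu> * diam powr \<nu>)"
    using \<phi> unfolding potential_def hoelder_bound_def real_norm_def by blast
  then show ?thesis
    unfolding transfer_potential_def
    using \<nu> C0(1) distortion_nonneg[OF \<nu>] birkhoff_distortion_inverse_branch[OF h C0(1) \<nu>] by auto
qed

end

theorem theorem4:
  fixes M :: "('m::metric_space, 'e::euclidean_space) manifold"
    and Q :: "'m rectangles"
    and \<delta> \<rho> \<kappa> \<gamma>0 \<gamma>1 \<nu> :: real
    and f g \<tau> :: "'m \<Rightarrow> real"
    and xs :: "nat \<Rightarrow> 'm"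
  assumes "complete_riemannian_manifold M"
    and "C2_flow M (flow Q)"
    and "axiom_A M (flow Q)"
    and "basic_set M (flow Q) (basic Q)"
    and "weak_mixing_on (basic Q) (flow Q)"
    and "local_product_structure (flow Q) (basic Q) (eps Q) \<delta>"
    and "markov_partition \<delta> \<rho> Q"
    and "Uset Q \<subseteq> closure (Uhat Q)"
    and "irreducible_aperiodic (num Q) (transition Q)"
    and "expansion_constants Q \<kappa> \<gamma>0 \<gamma>1"
    and "0 < \<nu>"
    and "\<tau> = return_time Q"
    and "hoelder_extended Q \<nu> f"
    and "hoelder_extended Q \<nu> g"
    and "hoelder_extended Q \<nu> \<tau>"
    and "\<forall>i<num Q. xs i \<in> Us Q i"
  shows "\<forall>\<epsilon>>0. \<exists>\<eta>>0. \<forall>a0 c0. 0 < a0 \<and> a0 < \<eta> \<and> 0 < c0 \<and> c0 < \<eta> \<longrightarrow>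
    (\<exists>C>0. \<forall>s z :: complex. \<forall>n::nat. 1 \<le> n \<and> \<bar>Re s\<bar> \<le> a0 \<and> \<bar>Re z\<bar> \<le> c0 \<longrightarrow>
      (let h = (\<lambda>y. of_real (f y) - s * of_real (\<tau> y) + z * of_real (g y)) in
       cmod (Zsum Q n h - (\<Sum>i<num Q. (transfer_op Q h ^^ n) (indicator (Us Q i)) (xs i)))
       \<le> C * (1 + cmod s) * (1 + cmod z) *
         (\<Sum>m=2..n. op_norm Q \<nu> (transfer_op Q h ^^ (n - m)) * \<gamma>0 powr (- real m * \<nu>) *
            exp (real m * (\<epsilon> + pressure Q (\<lambda>y. f y - Re s * \<tau> y + Re z * g y))))))"
proof -
  have ret: "continuous_on (Us Q i) (return_time Q)" if "i < num Q" for i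
    using assms(12,15) that by (simp add: hoelder_extended_def)
  interpret markov_partition_flow M Q \<delta> \<rho> \<kappa> \<gamma>0 \<gamma>1
    by unfold_locales (use assms(2,6,7,8,9,10) ret in auto)
  have xs: "xs i \<in> U i" if "i < k" for i using assms(16) that by blast
  have cont: "continuous_on X w" if "hoelder_extended Q \<nu> w" for w :: "'m \<Rightarrow> real"
    using that by (intro continuous_on_X) (simp add: hoelder_extended_def)
  note cts = cont[OF assms(13)] cont[OF assms(15)] cont[OF assms(14)]
  have hb: "\<exists>A\<ge>0. \<exists>B\<ge>0. hoelder_bound \<nu> w A B" if "hoelder_extended Q \<nu> w" for w :: "'m \<Rightarrow> real"
    using hoelder_on_Us[OF that assms(11)] by (intro hoelder_bound_exists assms(11)) (simp add: hoelder_def)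
  obtain Bf Cf where f: "0 \<le> Bf" "0 \<le> Cf" "hoelder_bound \<nu> f Bf Cf" using hb[OF assms(13)] by blast
  obtain Bt Ct where t: "0 \<le> Bt" "0 \<le> Ct" "hoelder_bound \<nu> \<tau> Bt Ct" using hb[OF assms(15)] by blast
  obtain Bg Cg where g: "0 \<le> Bg" "0 \<le> Cg" "hoelder_bound \<nu> g Bg Cg" using hb[OF assms(14)] by blast
  note potential = transfer_potential_combination[OF assms(11) cts f(3) t(3) g(3) t(1) g(1) f(2) t(2) g(2)]
  show ?thesis
  \<comment> \<open>a0 and c0 enter only through the constants B and D below, so any positive
    threshold is a witness.\<close>
  proof (intro allI impI, rule exI[of _ "1 :: real"], rule conjI[OF zero_less_one], intro allI impI)
    fix \<epsilon> a0 c0 :: real assume \<epsilon>: "0 < \<epsilon>"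
    define B where "B = Bf + a0 * Bt + c0 * Bg"
    define D where "D = (Cf + a0 * Ct + c0 * Cg) * distortion \<nu> * diam powr \<nu>"
    define G where "G = (Cf + Ct + Cg) * distortion \<nu>"
    define R where "R = exp D * (diam * \<gamma>0\<^sup>2 / \<kappa>) powr \<nu> * pressure_factor B D"
    have GR: "0 \<le> G" "0 \<le> R"
      using f(2) t(2) g(2) distortion_nonneg[OF assms(11)] by (auto simp: G_def R_def pressure_factor_def)
    show "\<exists>C>0. \<forall>s z :: complex. \<forall>n::nat. 1 \<le> n \<and> \<bar>Re s\<bar> \<le> a0 \<and> \<bar>Re z\<bar> \<le> c0 \<longrightarrow>
      (let h = (\<lambda>y. of_real (f y) - s * of_real (\<tau> y) + z * of_real (g y)) in
       cmod (Zsum Q n h - (\<Sum>i<num Q. (transfer_op Q h ^^ n) (indicator (Us Q i)) (xs i)))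
       \<le> C * (1 + cmod s) * (1 + cmod z) *
         (\<Sum>m=2..n. op_norm Q \<nu> (transfer_op Q h ^^ (n - m)) * \<gamma>0 powr (- real m * \<nu>) *
            exp (real m * (\<epsilon> + pressure Q (\<lambda>y. f y - Re s * \<tau> y + Re z * g y)))))"
    \<comment> \<open>The factor 1 + G comes from 1 + G p \<le> (1 + G) p for p \<ge> 1. The summand
      1 keeps the constant positive, as R vanishes when the diameter is 0.\<close>
    proof (intro exI[of _ "(1 + G) * R + 1"] conjI allI impI)
      show "0 < (1 + G) * R + 1" using GR by (intro add_nonneg_pos) auto
      fix s z :: complex and n :: nat
      assume n: "1 \<le> n \<and> \<bar>Re s\<bar> \<le> a0 \<and> \<bar>Re z\<bar> \<le> c0"
      define h where "h = (\<lambda>y. of_real (f y) - s * of_real (\<tau> y) + z * of_real (g y))"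
      define \<phi> where "\<phi> = (\<lambda>y. f y - Re s * \<tau> y + Re z * g y)"
      define S where "S = (\<Sum>m=2..n. op_norm Q \<nu> (transfer_op Q h ^^ (n - m)) * \<gamma>0 powr (- real m * \<nu>) *
            exp (real m * (\<epsilon> + pressure Q \<phi>)))"
      define p where "p = (1 + cmod s) * (1 + cmod z)"
      have p: "1 \<le> p" by (simp add: p_def algebra_simps)
      have tp: "transfer_potential \<nu> h \<phi> B D (G * p)"
        using potential[of s a0 z c0] n by (simp add: h_def \<phi>_def B_def D_def G_def p_def mult_ac)
      have S: "0 \<le> S" unfolding S_def using op_norm_ge(1)[OF tp] by (intro sum_nonneg) simp
      have "cmod (Zsum Q n h - (\<Sum>i<k. (transfer_op Q h ^^ n) (indicator (U i)) (xs i))) \<le> ((1 + G) * R + 1) * p * S"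
      proof (cases "n = 1")
        case True
        have "cmod (Zsum Q n h - (\<Sum>i<k. (transfer_op Q h ^^ n) (indicator (U i)) (xs i))) = 0"
          unfolding True by (subst periodic_sum_1) (simp_all add: xs)
        then show ?thesis using GR p S by simp
      next
        case False
        then have "2 \<le> n" using n by simp
        have "cmod (Zsum Q n h - (\<Sum>i<k. (transfer_op Q h ^^ n) (indicator (U i)) (xs i))) \<le> (1 + G * p) * R * S"
          using periodic_sum_estimate[of xs n, OF _ \<open>2 \<le> n\<close> tp less_imp_le[OF \<epsilon>]] xs
          by (simp only: R_def S_def mult_ac)
        also have "\<dots> \<le> (((1 + G) * R + 1) * p) * S"
        proof (intro mult_right_mono S)
          have "1 + G * p \<le> (1 + G) * p" using p by (simp add: algebra_simps)
          then have "(1 + G * p) * R \<le> (1 + G) * p * R" using GR by (intro mult_right_mono)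
          also have "\<dots> \<le> ((1 + G) * R + 1) * p" using p by (simp add: algebra_simps)
          finally show "(1 + G * p) * R \<le> ((1 + G) * R + 1) * p" .
        qed
        finally show ?thesis .
      qed
      then show "let h = (\<lambda>y. of_real (f y) - s * of_real (\<tau> y) + z * of_real (g y)) in
       cmod (Zsum Q n h - (\<Sum>i<num Q. (transfer_op Q h ^^ n) (indicator (Us Q i)) (xs i)))
       \<le> ((1 + G) * R + 1) * (1 + cmod s) * (1 + cmod z) *
         (\<Sum>m=2..n. op_norm Q \<nu> (transfer_op Q h ^^ (n - m)) * \<gamma>0 powr (- real m * \<nu>) *
            exp (real m * (\<epsilon> + pressure Q (\<lambda>y. f y - Re s * \<tau> y + Re z * g y))))"
        unfolding Let_def h_def[symmetric] \<phi>_def[symmetric] S_def[symmetric] by (simp only: p_def mult.assoc)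
    qed
  qed
qed

end
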